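(* Let $L$ be a transitive corneration of a map $\mathcal{M}$ whose elements are wedges. Then there are four possibilities for the way that patterns of in-wedges appear in the faces of $\mathcal{M}$: (1) $\mathcal{M}$ is face-bipartite and all faces of one color have pattern A, while the rest have pattern E. (2) Every face has pattern B. (3) Faces are of two patterns, C and E. Faces with pattern E border only those with pattern C, while a face with pattern C meets faces with patterns C and E. (4) Every face has pattern D.
   Context: Graphs are finite, may have parallel edges, and have no loops or semi-edges. A map $\mathcal{M}$ is an embedding of a graph (its skeleton) into a connected compact surface without boundary such that each component of the complement (a face) is topologically a disk. A symmetry of $\mathcal{M}$ is an automorphism of the skeleton induced by a homeomorphism of the surface; $\mathrm{Aut}(\mathcal{M})$ is the group of all symmetries. $\mathcal{M}$ is face-bipartite if its faces can be partitioned into two classes (colors) so that each face of a given color borders only faces of the other color. A dart is an incident vertex-edge pair. A corner is a set $\{e_1,v,e_2\}$ with $e_1\ne e_2$ edges incident to the vertex $v$; it contains the darts $\{e_1,v\}$ and $\{e_2,v\}$. A wedge is a corner whose edges are consecutive in some face of $\mathcal{M}$. Each wedge is regarded as belonging to a unique face, in the sense that its two edges appear as two consecutive edges on the boundary of a unique face. A corneration of $\mathcal{M}$ is a set $L$ of corners such that every dart is contained in exactly one corner of $L$. $\mathrm{Aut}(L)$ is the group of symmetries of $\mathcal{M}$ preserving $L$, and $L$ is transitive if $\mathrm{Aut}(L)$ acts transitively on the corners in $L$. Wedges in $L$ are called in-wedges; wedges not in $L$ are called out-wedges. A face $f$ of length $p$ has: pattern A if every wedge of $f$ is an in-wedge;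 pattern B if $p$ is even and every other wedge of $f$ is an in-wedge (in- and out-wedges alternate around $f$); pattern C if $p$ is divisible by 3 and every third wedge of $f$ is an out-wedge (the others being in-wedges); pattern D if $p$ is divisible by 4 and pairs of consecutive in-wedges alternate with pairs of consecutive out-wedges around $f$; pattern E if every wedge of $f$ is an out-wedge.
   Formalization: Each wedge is assumed to occur at only one place on the boundary of its unique face; beyond the stated unique-face convention this excludes only cycles in the projective plane, where the single face has all in-wedges but borders itself, so none of (1)–(4) holds. *)

theory Defs
  imports "HOL-Analysis.Analysis"
begin

text \<open>
  A finite loopless graph, possibly with parallel edges, drawn on a space: \<open>ends e\<close> is the set of
  the two end vertices of \<open>e\<close>, \<open>vpos v\<close> the point representing \<open>v\<close>, and \<open>epath e\<close> parametrizes
  the arc representing \<open>e\<close> by the unit interval.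
\<close>

record ('v, 'e, 'a) drawing =
  surface :: "'a topology"
  verts :: "'v set"
  edges :: "'e set"
  ends :: "'e \<Rightarrow> 'v set"
  vpos :: "'v \<Rightarrow> 'a"
  epath :: "'e \<Rightarrow> real \<Rightarrow> 'a"

definition graph :: "('v, 'e, 'a) drawing \<Rightarrow> bool" where
  "graph M \<longleftrightarrow> finite (verts M) \<and> finite (edges M) \<and>
     (\<forall>e\<in>edges M. ends M e \<subseteq> verts M \<and> card (ends M e) = 2)"

definition closed_surface :: "'a topology \<Rightarrow> bool" where
  "closed_surface X \<longleftrightarrow> connected_space X \<and> compact_space X \<and> Hausdorff_space X \<and>
     (\<forall>x\<in>topspace X. \<exists>U. openin X U \<and> x \<in> U \<and>
        subtopology X U homeomorphic_space (euclidean :: complex topology))"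

abbreviation edge_points :: "('v, 'e, 'a) drawing \<Rightarrow> 'e \<Rightarrow> 'a set" where
  "edge_points M e \<equiv> epath M e ` {0..1}"

abbreviation edge_interior :: "('v, 'e, 'a) drawing \<Rightarrow> 'e \<Rightarrow> 'a set" where
  "edge_interior M e \<equiv> epath M e ` {0<..<1}"

definition embedded :: "('v, 'e, 'a) drawing \<Rightarrow> bool" where
  "embedded M \<longleftrightarrow>
     vpos M ` verts M \<subseteq> topspace (surface M) \<and> inj_on (vpos M) (verts M) \<and>
     (\<forall>e\<in>edges M. embedding_map (top_of_set {0..1}) (surface M) (epath M e) \<and>
        {epath M e 0, epath M e 1} = vpos M ` ends M e \<and>
        edge_interior M e \<inter> vpos M ` verts M = {}) \<and>
     (\<forall>e\<in>edges M. \<forall>e'\<in>edges M. e \<noteq> e' \<longrightarrow> edge_interior M e \<inter> edge_interior M e' = {})"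

definition skeleton_points :: "('v, 'e, 'a) drawing \<Rightarrow> 'a set" where
  "skeleton_points M = vpos M ` verts M \<union> (\<Union>e\<in>edges M. edge_points M e)"

definition faces :: "('v, 'e, 'a) drawing \<Rightarrow> 'a set set" where
  "faces M = connected_components_of
     (subtopology (surface M) (topspace (surface M) - skeleton_points M))"

text \<open>The \<open>k\<close>-th side of the closed unit disk, regarded as a polygon with \<open>p\<close> sides.\<close>

definition side :: "nat \<Rightarrow> nat \<Rightarrow> complex set" where
  "side p k = (\<lambda>t. cis (2 * pi * t / real p)) ` {real k .. real (k + 1)}"

text \<open>
  A boundary walk of a face \<open>F\<close> of length \<open>p\<close> is a list of \<open>p\<close> darts: its \<open>k\<close>-th entry \<open>(v, e)\<close>
  says that the walk runs from \<open>v\<close> along \<open>e\<close> to the vertex of the next entry (cyclically). It is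
  read off from a parametrization of \<open>F\<close> by the open unit disk that extends continuously to the
  closed disk, regarded as a polygon with \<open>p\<close> sides, and takes each side bijectively to an edge.
  The walk of a face is unique up to rotation and reversal. The empty walk occurs only when the
  skeleton is a single vertex (on the sphere).
\<close>

definition boundary_walk ::
    "('v, 'e, 'a) drawing \<Rightarrow> 'a set \<Rightarrow> ('v \<times> 'e) list \<Rightarrow> bool" where
  "boundary_walk M F w \<longleftrightarrow> (\<exists>\<phi> :: complex \<Rightarrow> 'a.
     continuous_map (top_of_set (cball 0 1)) (surface M) \<phi> \<and>
     homeomorphic_map (top_of_set (ball 0 1)) (subtopology (surface M) F) \<phi> \<and>
     (if w = [] then \<exists>v\<in>verts M. \<forall>z\<in>sphere 0 1. \<phi> z = vpos M v
      else \<forall>k<length w. case w ! k of (v, e) \<Rightarrow>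
        v \<in> verts M \<and> e \<in> edges M \<and>
        \<phi> (cis (2 * pi * real k / real (length w))) = vpos M v \<and>
        inj_on \<phi> (side (length w) k) \<and>
        \<phi> ` side (length w) k = edge_points M e))"

text \<open>
  That a face is topologically a disk is taken in the usual sense for 2-cell embeddings, i.e. the
  open disk is attached along a closed walk in the skeleton; this is what gives a meaning to
  ``consecutive in a face'' and to the length of a face.
\<close>

definition is_map :: "('v, 'e, 'a) drawing \<Rightarrow> bool" where
  "is_map M \<longleftrightarrow> graph M \<and> closed_surface (surface M) \<and> embedded M \<and>
     (\<forall>F\<in>faces M. \<exists>w. boundary_walk M F w)"

text \<open>
  A symmetry is the automorphism of the skeleton, given by its actions on vertices and edges,
  rather than a homeomorphism inducing it.
\<close>

definition skeleton_automorphism ::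
    "('v, 'e, 'a) drawing \<Rightarrow> ('v \<Rightarrow> 'v) \<times> ('e \<Rightarrow> 'e) \<Rightarrow> bool" where
  "skeleton_automorphism M \<sigma> \<longleftrightarrow> (case \<sigma> of (\<alpha>, \<beta>) \<Rightarrow>
     bij_betw \<alpha> (verts M) (verts M) \<and> bij_betw \<beta> (edges M) (edges M) \<and>
     (\<forall>e\<in>edges M. ends M (\<beta> e) = \<alpha> ` ends M e))"

definition symmetries :: "('v, 'e, 'a) drawing \<Rightarrow> (('v \<Rightarrow> 'v) \<times> ('e \<Rightarrow> 'e)) set" where
  "symmetries M = {(\<alpha>, \<beta>). skeleton_automorphism M (\<alpha>, \<beta>) \<and>
     (\<exists>h. homeomorphic_map (surface M) (surface M) h \<and>
        (\<forall>v\<in>verts M. h (vpos M v) = vpos M (\<alpha> v)) \<and>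
        (\<forall>e\<in>edges M. h ` edge_points M e = edge_points M (\<beta> e)))}"

definition darts :: "('v, 'e, 'a) drawing \<Rightarrow> ('v \<times> 'e) set" where
  "darts M = {(v, e). e \<in> edges M \<and> v \<in> ends M e}"

text \<open>The corner \<open>{e\<^sub>1, v, e\<^sub>2}\<close> is encoded as the pair \<open>(v, {e\<^sub>1, e\<^sub>2})\<close>.\<close>

type_synonym ('v, 'e) corner = "'v \<times> 'e set"

definition corners :: "('v, 'e, 'a) drawing \<Rightarrow> ('v, 'e) corner set" where
  "corners M = {(v, {e1, e2}) | v e1 e2. e1 \<noteq> e2 \<and> (v, e1) \<in> darts M \<and> (v, e2) \<in> darts M}"

definition corner_darts :: "('v, 'e) corner \<Rightarrow> ('v \<times> 'e) set" where
  "corner_darts c = {fst c} \<times> snd c"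

definition corneration :: "('v, 'e, 'a) drawing \<Rightarrow> ('v, 'e) corner set \<Rightarrow> bool" where
  "corneration M L \<longleftrightarrow> L \<subseteq> corners M \<and> (\<forall>d\<in>darts M. \<exists>!c. c \<in> L \<and> d \<in> corner_darts c)"

definition corner_image :: "('v \<Rightarrow> 'v) \<times> ('e \<Rightarrow> 'e) \<Rightarrow> ('v, 'e) corner \<Rightarrow> ('v, 'e) corner" where
  "corner_image \<sigma> c = (fst \<sigma> (fst c), snd \<sigma> ` snd c)"

definition corner_symmetries ::
    "('v, 'e, 'a) drawing \<Rightarrow> ('v, 'e) corner set \<Rightarrow> (('v \<Rightarrow> 'v) \<times> ('e \<Rightarrow> 'e)) set" where
  "corner_symmetries M L = {\<sigma> \<in> symmetries M. corner_image \<sigma> ` L = L}"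

definition transitive :: "('v, 'e, 'a) drawing \<Rightarrow> ('v, 'e) corner set \<Rightarrow> bool" where
  "transitive M L \<longleftrightarrow> (\<forall>c\<in>L. \<forall>c'\<in>L. \<exists>\<sigma>\<in>corner_symmetries M L. corner_image \<sigma> c = c')"

text \<open>
  The place of a boundary walk between its \<open>k\<close>-th and its next edge. At a vertex of degree 1 both
  edges coincide, and the result is not a corner.
\<close>

definition walk_corner :: "('v \<times> 'e) list \<Rightarrow> nat \<Rightarrow> ('v, 'e) corner" where
  "walk_corner w k = (let next = w ! ((k + 1) mod length w)
     in (fst next, {snd (w ! k), snd next}))"

definition wedges :: "('v, 'e, 'a) drawing \<Rightarrow> ('v, 'e) corner set" where
  "wedges M = {c \<in> corners M. \<exists>F\<in>faces M. \<exists>w. boundary_walk M F w \<and>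
     (\<exists>k<length w. walk_corner w k = c)}"

text \<open>
  The convention that each wedge belongs to a unique face: its two edges are consecutive in only
  one face and at only one place of its boundary. This is automatic at vertices of degree at least
  3 and fails at vertices of degree 2. Uniqueness of the face alone would not suffice: for a cycle
  in the projective plane, each corner occurs twice on the boundary of the only face.
\<close>

definition wedges_unambiguous :: "('v, 'e, 'a) drawing \<Rightarrow> bool" where
  "wedges_unambiguous M \<longleftrightarrow> (\<forall>c\<in>wedges M.
     (\<exists>!F. F \<in> faces M \<and> (\<exists>w. boundary_walk M F w \<and> (\<exists>k<length w. walk_corner w k = c))) \<and>
     (\<forall>F\<in>faces M. \<forall>w. boundary_walk M F w \<longrightarrow>
        (\<forall>j<length w. \<forall>k<length w. walk_corner w j = c \<longrightarrow> walk_corner w k = c \<longrightarrow> j = k)))"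

text \<open>Two faces border if they are on the two sides of an edge; a face may border itself.\<close>

definition borders :: "('v, 'e, 'a) drawing \<Rightarrow> 'a set \<Rightarrow> 'a set \<Rightarrow> bool" where
  "borders M F G \<longleftrightarrow> F \<in> faces M \<and> G \<in> faces M \<and>
     (if F = G
      then \<exists>w. boundary_walk M F w \<and>
        (\<exists>j<length w. \<exists>k<length w. j \<noteq> k \<and> snd (w ! j) = snd (w ! k))
      else \<exists>w w'. boundary_walk M F w \<and> boundary_walk M G w' \<and>
        (\<exists>j<length w. \<exists>k<length w'. snd (w ! j) = snd (w' ! k)))"

definition face_coloring :: "('v, 'e, 'a) drawing \<Rightarrow> 'a set set \<Rightarrow> 'a set set \<Rightarrow> bool" where
  "face_coloring M P Q \<longleftrightarrow> P \<union> Q = faces M \<and> P \<inter> Q = {} \<and>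
     (\<forall>F\<in>P. \<forall>G. borders M F G \<longrightarrow> G \<in> Q) \<and> (\<forall>F\<in>Q. \<forall>G. borders M F G \<longrightarrow> G \<in> P)"

text \<open>
  In the patterns, \<open>s\<close> accounts for the arbitrary starting point of the boundary walk.
\<close>

definition pattern_A ::
    "('v, 'e, 'a) drawing \<Rightarrow> ('v, 'e) corner set \<Rightarrow> 'a set \<Rightarrow> bool" where
  "pattern_A M L F \<longleftrightarrow> (\<exists>w. boundary_walk M F w \<and>
     (\<forall>k<length w. walk_corner w k \<in> L))"

definition pattern_B ::
    "('v, 'e, 'a) drawing \<Rightarrow> ('v, 'e) corner set \<Rightarrow> 'a set \<Rightarrow> bool" where
  "pattern_B M L F \<longleftrightarrow> (\<exists>w. boundary_walk M F w \<and> 2 dvd length w \<and>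
     (\<exists>s. \<forall>k<length w. walk_corner w k \<in> L \<longleftrightarrow> (k + s) mod 2 = 0))"

definition pattern_C ::
    "('v, 'e, 'a) drawing \<Rightarrow> ('v, 'e) corner set \<Rightarrow> 'a set \<Rightarrow> bool" where
  "pattern_C M L F \<longleftrightarrow> (\<exists>w. boundary_walk M F w \<and> 3 dvd length w \<and>
     (\<exists>s. \<forall>k<length w. walk_corner w k \<in> L \<longleftrightarrow> (k + s) mod 3 \<noteq> 0))"

definition pattern_D ::
    "('v, 'e, 'a) drawing \<Rightarrow> ('v, 'e) corner set \<Rightarrow> 'a set \<Rightarrow> bool" where
  "pattern_D M L F \<longleftrightarrow> (\<exists>w. boundary_walk M F w \<and> 4 dvd length w \<and>
     (\<exists>s. \<forall>k<length w. walk_corner w k \<in> L \<longleftrightarrow> (k + s) mod 4 \<in> {0, 1}))"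

definition pattern_E ::
    "('v, 'e, 'a) drawing \<Rightarrow> ('v, 'e) corner set \<Rightarrow> 'a set \<Rightarrow> bool" where
  "pattern_E M L F \<longleftrightarrow> (\<exists>w. boundary_walk M F w \<and>
     (\<forall>k<length w. walk_corner w k \<notin> L))"

end

theory Submission
  imports Defs
begin

text \<open>
  The in-wedge at a dart \<open>(v, e)\<close> lies on one of the two sides of \<open>e\<close>, the out-wedge on the other. Call
  \<open>e\<close> straight if the in-wedges at its two ends lie on the same side. Along a face, two consecutive
  wedges are of the same kind if and only if the edge between them is straight. By transitivity
  all in-wedges have the same number of straight edges. If it is 2, every face is constant and
  faces across an edge are opposite (1); if it is 0, every face alternates (2). If it is 1, then
  the group is transitive on darts of straight edges and on darts of the other edges, so either
  every out-wedge has exactly one straight edge as well (4), or none has (3).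

  On the topological side, this needs that an edge has exactly two sides, that the boundary walks
  of a face agree up to relabelling, and that symmetries carry boundary walks to boundary walks.
  The half disks attached along two sides of an edge fit together to an open disk around the edge, so
  invariance of domain excludes a third side, and also a single one. Two parametrizations of a face differ by a
  homeomorphism of the open disk that extends to the closed disk, because points of the circle
  have finite fibres.
\<close>

subsection \<open>Invariance of domain and polygons\<close>

text \<open>\<open>boundary_walk\<close>, \<open>borders\<close> and the patterns quantify over
  arbitrary walks, while counting needs definite positions. Hence one walk \<open>W F\<close> is
  fixed per face, in-wedges and out-wedges become positions in these walks, and facts about other
  walks are carried over by the homeomorphism between two parametrizations, up to reversal of
  direction. An edge may occur twice on one face, so its sides are occurrences in walks, not faces.
  Each dart has exactly two places: the corneration and the convention on wedges give exactly one
  in-place, and the two sides of the edge supply the other place. If each in-wedge has exactly one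
  straight edge, a symmetry between two in-wedges has no choice which edge goes where, because it
  preserves straightness; this gives transitivity on each class of darts. As a dart determines its
  out-wedge, all out-wedges with a straight edge look alike, and so do all those with an edge of the
  other kind. A single mixed out-wedge belongs to both groups and forces all out-wedges to be
  mixed.\<close>

lemma surface_chart:
  assumes "closed_surface X" "x \<in> topspace X"
  obtains U and h :: "'a \<Rightarrow> complex" and h' where "openin X U" "x \<in> U" "U \<subseteq> topspace X"
    "continuous_map (subtopology X U) euclidean h" "continuous_map euclidean (subtopology X U) h'"
    "\<And>y. y \<in> U \<Longrightarrow> h' (h y) = y" "\<And>z. h (h' z) = z"
proof -
  obtain U where U: "openin X U" "x \<in> U"
    and "subtopology X U homeomorphic_space (euclidean :: complex topology)"
    using assms unfolding closed_surface_def by metis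
  then obtain h :: "'a \<Rightarrow> complex" and h' where h: "homeomorphic_maps (subtopology X U) euclidean h h'"
    unfolding homeomorphic_space_def by metis
  have cU: "U \<subseteq> topspace X" using U(1) by (rule openin_subset)
  then have tU: "topspace (subtopology X U) = U" by (simp add: Int_absorb1)
  show ?thesis
    using that[OF U cU, of h h'] h unfolding homeomorphic_maps_def tU by simp
qed

text \<open>Openness is local in the surface. Near each image point a chart turns \<open>f\<close>
  into an injective continuous map between planar sets, where invariance of domain is
  available.\<close>

lemma invariance_of_domain_into_surface:
  assumes X: "closed_surface X" and D: "open (D :: complex set)"
    and f: "continuous_map (top_of_set D) X f" and inj: "inj_on f D"
  shows "openin X (f ` D)"
proof (subst openin_subopen, intro ballI)
  fix x assume "x \<in> f ` D"
  then obtain d where d: "d \<in> D" "x = f d" by auto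
  have "x \<in> topspace X" using d continuous_map_image_subset_topspace[OF f] by auto
  then obtain U and h :: "'a \<Rightarrow> complex" and h' where U: "openin X U" "x \<in> U" and cU: "U \<subseteq> topspace X"
    and ch: "continuous_map (subtopology X U) euclidean h"
    and ch': "continuous_map euclidean (subtopology X U) h'"
    and hh: "\<And>y. y \<in> U \<Longrightarrow> h' (h y) = y" and hh': "\<And>z. h (h' z) = z"
    by (rule surface_chart[OF X]) (rule that)
  define E where "E = {z \<in> D. f z \<in> U}"
  have "openin (top_of_set D) E"
    using openin_continuous_map_preimage[OF f U(1)] by (simp add: E_def)
  then have E: "open E" using openin_open_eq[OF D] by simp
  have fE: "continuous_map (top_of_set E) (subtopology X U) f"
  proof -
    have "continuous_map (top_of_set E) X f"
      by (rule continuous_map_from_subtopology_mono[OF f]) (auto simp: E_def)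
    moreover have "f ` E \<subseteq> U" by (auto simp: E_def)
    ultimately show ?thesis by (simp add: continuous_map_in_subtopology image_subset_iff_funcset)
  qed
  have "continuous_on E (h \<circ> f)"
    using continuous_map_compose[OF fE ch] by simp
  moreover have "inj_on (h \<circ> f) E"
  proof (rule inj_onI)
    fix a b assume "a \<in> E" "b \<in> E" "(h \<circ> f) a = (h \<circ> f) b"
    then have "h (f a) = h (f b)" and ab: "f a \<in> U" "f b \<in> U" "a \<in> D" "b \<in> D" by (auto simp: E_def)
    then have "f a = f b" using hh[OF ab(1)] hh[OF ab(2)] by metis
    then show "a = b" using inj ab(3,4) by (meson inj_onD)
  qed
  ultimately have o: "open ((h \<circ> f) ` E)" using E by (intro invariance_of_domain)
  have "openin (subtopology X U) {y \<in> topspace (subtopology X U). h y \<in> (h \<circ> f) ` E}"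
    by (rule openin_continuous_map_preimage[OF ch]) (use o in auto)
  then have "openin X {y \<in> topspace (subtopology X U). h y \<in> (h \<circ> f) ` E}"
    using U(1) by (rule openin_trans_full)
  moreover have "{y \<in> topspace (subtopology X U). h y \<in> (h \<circ> f) ` E} = f ` E"
  proof (intro equalityI subsetI)
    fix y assume "y \<in> {y \<in> topspace (subtopology X U). h y \<in> (h \<circ> f) ` E}"
    then obtain e where e: "y \<in> U" "e \<in> E" "h y = h (f e)" by auto
    moreover have "f e \<in> U" using e(2) by (simp add: E_def)
    ultimately have "y = f e" using hh[of y] hh[of "f e"] by metis
    then show "y \<in> f ` E" using e(2) by blast
  qed (use cU in \<open>auto simp: E_def\<close>)
  ultimately have "openin X (f ` E)" by simp
  then show "\<exists>T. openin X T \<and> x \<in> T \<and> T \<subseteq> f ` D"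
    using d U(2) by (intro exI[of _ "f ` E"]) (auto simp: E_def)
qed

text \<open>The same reduction in the other direction: near each point of \<open>N\<close>,
  \<open>g\<close> is composed with the inverse of a chart.\<close>

lemma invariance_of_domain_from_surface:
  assumes X: "closed_surface X" and N: "openin X N"
    and g: "continuous_map (subtopology X N) (euclidean :: complex topology) g" and inj: "inj_on g N"
  shows "open (g ` N)"
proof (subst open_subopen, intro ballI)
  fix y assume "y \<in> g ` N"
  then obtain x where x: "x \<in> N" "y = g x" by auto
  then have "x \<in> topspace X" using openin_subset[OF N] by blast
  then obtain U and h :: "'a \<Rightarrow> complex" and h' where U: "openin X U" "x \<in> U" and cU: "U \<subseteq> topspace X"
    and ch: "continuous_map (subtopology X U) euclidean h"
    and ch': "continuous_map euclidean (subtopology X U) h'"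
    and hh: "\<And>y. y \<in> U \<Longrightarrow> h' (h y) = y" and hh': "\<And>z. h (h' z) = z"
    by (rule surface_chart[OF X]) (rule that)
  define D where "D = {z. h' z \<in> N}"
  have ch'X: "continuous_map euclidean X h'" and im: "\<And>z. h' z \<in> U"
    using ch' cU by (auto simp: continuous_map_in_subtopology)
  have "open D"
    using openin_continuous_map_preimage[OF ch'X N] by (simp add: D_def)
  have "continuous_map (top_of_set D) (subtopology X N) h'"
    using ch'X by (auto simp: D_def continuous_map_in_subtopology continuous_map_from_subtopology)
  then have "continuous_on D (g \<circ> h')" using continuous_map_compose[OF _ g] by fastforce
  moreover have "inj_on (g \<circ> h') D"
  proof (rule inj_onI)
    fix a b assume "a \<in> D" "b \<in> D" "(g \<circ> h') a = (g \<circ> h') b"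
    then have "h' a = h' b" using inj by (auto simp: D_def dest: inj_onD)
    then show "a = b" using hh'[of a] hh'[of b] by metis
  qed
  ultimately have "open ((g \<circ> h') ` D)" using \<open>open D\<close> by (intro invariance_of_domain)
  then show "\<exists>T. open T \<and> y \<in> T \<and> T \<subseteq> g ` N"
  proof (intro exI[of _ "(g \<circ> h') ` D"] conjI)
    show "y \<in> (g \<circ> h') ` D" using x hh[OF U(2)] by (auto simp: D_def image_iff intro!: exI[of _ "h x"])
  qed (auto simp: D_def)
qed

text \<open>The set \<open>U i\<close> that contains one point of \<open>S\<close> and the union of
  all the others would otherwise separate \<open>S\<close>. It serves to pin a transition map to one
  point of a finite fibre, and the image of an open side to one sector.\<close>

lemma connected_in_one_of_disjoint_open:
  fixes S :: "'b::topological_space set"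
  assumes S: "connected S" "S \<noteq> {}" and cov: "S \<subseteq> (\<Union>i\<in>I. U i)"
    and op: "\<And>i. i \<in> I \<Longrightarrow> open (U i)"
    and dj: "\<And>i j. i \<in> I \<Longrightarrow> j \<in> I \<Longrightarrow> i \<noteq> j \<Longrightarrow> U i \<inter> U j \<inter> S = {}"
  obtains i where "i \<in> I" "S \<subseteq> U i"
proof -
  obtain x i where x: "x \<in> S" "i \<in> I" "x \<in> U i" using S cov by blast
  define V where "V = (\<Union>j\<in>I - {i}. U j)"
  have "open (U i)" "open V" using op x by (auto simp: V_def)
  moreover have "U i \<inter> V \<inter> S = {}" using dj x by (fastforce simp: V_def)
  moreover have "S \<subseteq> U i \<union> V" using cov by (auto simp: V_def)
  ultimately have "U i \<inter> S = {} \<or> V \<inter> S = {}" using S connectedD by blast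
  then have "V \<inter> S = {}" using x by auto
  then show ?thesis using \<open>S \<subseteq> U i \<union> V\<close> x that by blast
qed

section \<open>Sides and sectors of the polygon on the unit circle\<close>

definition circ :: "nat \<Rightarrow> real \<Rightarrow> complex" where
  "circ p t = cis (2 * pi * t / real p)"

text \<open>The unbounded open cone over an open side. Being open in the plane, it yields the open
  side when cut with the circle and the half disk behind that side when cut with the open
  disk.\<close>

definition sector :: "nat \<Rightarrow> nat \<Rightarrow> complex set" where
  "sector p k = {of_real r * circ p t | r t. 0 < r \<and> real k < t \<and> t < real k + 1}"

lemma norm_circ [simp]: "cmod (circ p t) = 1"
  by (simp add: circ_def)

lemma continuous_on_circ [continuous_intros]:
  "continuous_on S f \<Longrightarrow> continuous_on S (\<lambda>x. circ p (f x))"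
  unfolding circ_def cis_conv_exp divide_inverse by (intro continuous_intros)

lemma circ_add_period [simp]: "circ p (t + real p) = circ p t"
proof (cases "p = 0")
  case False
  then have "2 * pi * (t + real p) / real p = 2 * pi * t / real p + 2 * pi"
    by (simp add: field_simps)
  then show ?thesis by (simp only: circ_def flip: cis_mult) simp
qed (simp add: circ_def)

text \<open>Parameters of the same point differ by an integer multiple of the period
  \<open>p\<close>, and a difference below \<open>p\<close> leaves only the multiple 0.\<close>

lemma circ_inj:
  assumes "circ p s = circ p t" "\<bar>s - t\<bar> < real p"
  shows "s = t"
proof -
  have p: "0 < real p" using assms by linarith
  obtain n :: int where "2 * pi * s / real p = 2 * pi * t / real p + 2 * of_int n * pi"
    using assms(1) unfolding circ_def cis_conv_exp exp_eq
    by (auto simp: complex_eq_iff algebra_simps)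
  then have "2 * pi * (s - t) = 2 * pi * (of_int n * real p)"
    using p by (simp add: field_simps)
  then have n: "s - t = of_int n * real p" by simp
  have "\<bar>of_int n :: real\<bar> < 1"
    using assms(2) p by (simp add: n abs_mult)
  then have "n = 0" by linarith
  then show ?thesis using n by simp
qed

lemma polar_circ_eq:
  assumes "of_real r * circ p s = of_real r' * circ p t" "0 < r" "0 < r'"
  shows "r = r'" "circ p s = circ p t"
proof -
  have "cmod (of_real r * circ p s) = cmod (of_real r' * circ p t)" using assms by simp
  then show "r = r'" using assms(2,3) by (simp only: norm_mult norm_circ norm_of_real abs_of_pos mult_1_right)
  then show "circ p s = circ p t" using assms by simp
qed

lemma side_eq_circ: "side p k = circ p ` {real k..real k + 1}"
  by (simp add: side_def circ_def add.commute)

lemma compact_side [simp]: "compact (side p k)"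
  unfolding side_eq_circ by (intro compact_continuous_image continuous_intros) auto

lemma side_subset_sphere: "side p k \<subseteq> sphere 0 1"
  by (auto simp: side_eq_circ)

lemma sector_Int_sphere: "sector p k \<inter> sphere 0 1 = circ p ` {real k<..<real k + 1}"
proof
  show "sector p k \<inter> sphere 0 1 \<subseteq> circ p ` {real k<..<real k + 1}"
    by (auto simp: sector_def norm_mult)
  show "circ p ` {real k<..<real k + 1} \<subseteq> sector p k \<inter> sphere 0 1"
    by (force simp: sector_def intro: exI[of _ "1::real"])
qed

lemma side_eq: "side p k = {circ p (real k), circ p (real k + 1)} \<union> (sector p k \<inter> sphere 0 1)"
proof -
  have "{real k..real k + 1} = {real k, real k + 1} \<union> {real k<..<real k + 1}" by auto
  then show ?thesis unfolding side_eq_circ sector_Int_sphere by (simp only: image_Un) simp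
qed

lemma sphere_in_side:
  assumes "0 < p" "z \<in> sphere 0 1"
  obtains k where "k < p" "z \<in> side p k"
proof -
  have "z \<noteq> 0" "sgn z = z" using assms by (auto simp: sgn_div_norm scaleR_conv_of_real)
  then have "z = cis (Arg z)" using cis_Arg by metis
  \<comment> \<open>\<open>Arg\<close> takes values in the half-open interval from -pi to pi; the
    shift to angles from 0 to 2 pi makes the floor of \<open>t\<close> a valid side number.\<close>
  define a where "a = (if Arg z < 0 then Arg z + 2 * pi else Arg z)"
  have a: "0 \<le> a" "a < 2 * pi" using Arg_bounded[of z] pi_gt_zero unfolding a_def by (auto simp del: pi_gt_zero)
  have "cis (Arg z + 2 * pi) = cis (Arg z)" by (simp only: flip: cis_mult) simp
  then have za: "z = cis a" using \<open>z = cis (Arg z)\<close> by (simp add: a_def)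
  define t where "t = a * real p / (2 * pi)"
  have t: "0 \<le> t" "t < real p" "z = circ p t" using a za assms(1)
    by (auto simp: t_def circ_def field_simps)
  define k where "k = nat \<lfloor>t\<rfloor>"
  have k: "real k \<le> t" "t < real k + 1" using t(1) by (auto simp: k_def)
  have "k < p" using k(1) t(2) by linarith
  moreover have "z \<in> side p k" using k t(3) by (auto simp: side_eq_circ)
  ultimately show ?thesis using that by blast
qed

text \<open>A sector is the image under \<open>exp\<close> of an open horizontal strip of height at
  most 2 pi, on which \<open>exp\<close> is injective.\<close>

lemma open_sector:
  assumes "0 < p" shows "open (sector p k)"
proof -
  let ?R = "{z. 2 * pi * real k / real p < Im z} \<inter> {z. Im z < 2 * pi * (real k + 1) / real p}"
  have "inj_on exp ?R"
  proof (rule inj_onI)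
    fix x y assume xy: "x \<in> ?R" "y \<in> ?R" "exp x = exp y"
    have "2 * pi * (real k + 1) / real p = 2 * pi * real k / real p + 2 * pi / real p"
      by (simp add: add_divide_distrib ring_distribs)
    moreover have "2 * pi / real p \<le> 2 * pi" using assms by (simp add: field_simps)
    ultimately have "\<bar>Im x - Im y\<bar> < 2 * pi" using xy by auto
    then show "x = y" using xy(3) by (rule exp_complex_eqI)
  qed
  then have "open (exp ` ?R)"
    by (intro invariance_of_domain continuous_intros open_Int open_halfspace_Im_lt open_halfspace_Im_gt)
  moreover have "exp ` ?R = sector p k"
  proof (intro equalityI subsetI)
    fix y assume "y \<in> exp ` ?R"
    then obtain z where z: "z \<in> ?R" "y = exp z" by auto
    have "y = of_real (exp (Re z)) * circ p (Im z * real p / (2 * pi))"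
      using assms z by (simp add: circ_def exp_eq_polar)
    moreover have "real k < Im z * real p / (2 * pi)" "Im z * real p / (2 * pi) < real k + 1"
      using z assms by (auto simp: field_simps)
    ultimately show "y \<in> sector p k" unfolding sector_def
      by (intro CollectI exI[of _ "exp (Re z)"] exI[of _ "Im z * real p / (2 * pi)"]) auto
  next
    fix y assume "y \<in> sector p k"
    then obtain r t where y: "y = of_real r * circ p t" "0 < r" "real k < t" "t < real k + 1"
      by (auto simp: sector_def)
    have "y = exp (Complex (ln r) (2 * pi * t / real p))"
      using y by (simp add: exp_eq_polar circ_def)
    moreover have "Complex (ln r) (2 * pi * t / real p) \<in> ?R"
      using y(3,4) assms by (simp add: divide_less_cancel)
    ultimately show "y \<in> exp ` ?R" by blast
  qed
  ultimately show ?thesis by simp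
qed

lemma sector_disjoint:
  assumes "j < p" "k < p" "j \<noteq> k" shows "sector p j \<inter> sector p k = {}"
proof -
  have False if z: "z \<in> sector p j" "z \<in> sector p k" for z
  proof -
    obtain r s where r: "z = of_real r * circ p s" "0 < r" "real j < s" "s < real j + 1"
      using z(1) by (auto simp: sector_def)
    obtain r' t where r': "z = of_real r' * circ p t" "0 < r'" "real k < t" "t < real k + 1"
      using z(2) by (auto simp: sector_def)
    have "circ p s = circ p t" using polar_circ_eq(2) r r' by metis
    moreover have "real j + 1 \<le> real p" "real k + 1 \<le> real p" using assms by linarith+
    then have "\<bar>s - t\<bar> < real p" using r r' by linarith
    ultimately have "s = t" by (rule circ_inj)
    then show False using r r' assms(3) by linarith
  qed
  then show ?thesis by blast
qed

lemma circ_not_in_sector: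
  assumes "j < p" "k < p" shows "circ p (real j) \<notin> sector p k"
proof
  assume "circ p (real j) \<in> sector p k"
  then obtain r t where r: "circ p (real j) = of_real r * circ p t" "0 < r" "real k < t" "t < real k + 1"
    by (auto simp: sector_def)
  have "circ p (real j) = circ p t" using polar_circ_eq(2)[of 1 p "real j" r t] r by simp
  moreover have "real j + 1 \<le> real p" "real k + 1 \<le> real p" using assms by linarith+
  then have "\<bar>real j - t\<bar> < real p" using r by linarith
  ultimately have "real j = t" by (rule circ_inj)
  then have "real k < real j" "real j < real (k + 1)" using r(3,4) by auto
  then show False by (simp only: of_nat_less_iff)
qed

lemma circ_Suc_mod:
  assumes "k < p" shows "circ p (real k + 1) = circ p (real ((k + 1) mod p))"
proof (cases "k + 1 = p")
  case True
  then have "real k + 1 = 0 + real p" by simp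
  then have "circ p (real k + 1) = circ p 0" by (simp only: circ_add_period)
  then show ?thesis using True by simp
next
  case False
  then show ?thesis using assms by (simp add: add.commute)
qed

lemma circ_real_inj:
  assumes "j < p" "k < p" "circ p (real j) = circ p (real k)" shows "j = k"
  using circ_inj[OF assms(3)] assms(1,2) by linarith

subsection \<open>Maps and parametrized faces\<close>

locale embedded_map =
  fixes M :: "('v, 'e, 'a) drawing"
  assumes is_map: "is_map M"
begin

lemma surface: "closed_surface (surface M)"
  using is_map by (simp add: is_map_def)

lemma Hausdorff: "Hausdorff_space (surface M)"
  using surface by (simp add: closed_surface_def)

lemma finite_verts: "finite (verts M)" and finite_edges: "finite (edges M)"
  using is_map by (auto simp: is_map_def graph_def)

lemma ends_subset: "e \<in> edges M \<Longrightarrow> ends M e \<subseteq> verts M"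
  and card_ends: "e \<in> edges M \<Longrightarrow> card (ends M e) = 2"
  using is_map by (auto simp: is_map_def graph_def)

lemma inj_vpos: "inj_on (vpos M) (verts M)"
  and vpos_in: "v \<in> verts M \<Longrightarrow> vpos M v \<in> topspace (surface M)"
  and epath_embedding: "e \<in> edges M \<Longrightarrow> embedding_map (top_of_set {0..1}) (surface M) (epath M e)"
  and epath_ends: "e \<in> edges M \<Longrightarrow> {epath M e 0, epath M e 1} = vpos M ` ends M e"
  and edge_interior_not_vertex: "e \<in> edges M \<Longrightarrow> edge_interior M e \<inter> vpos M ` verts M = {}"
  and edge_interiors_disjoint: "e \<in> edges M \<Longrightarrow> e' \<in> edges M \<Longrightarrow> e \<noteq> e' \<Longrightarrow>
    edge_interior M e \<inter> edge_interior M e' = {}"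
  using is_map by (auto simp: is_map_def embedded_def)

lemma inj_epath: "e \<in> edges M \<Longrightarrow> inj_on (epath M e) {0..1}"
  using epath_embedding by (fastforce simp: embedding_map_def homeomorphic_eq_everything_map)

lemma continuous_epath: "e \<in> edges M \<Longrightarrow> continuous_map (top_of_set {0..1}) (surface M) (epath M e)"
  using epath_embedding by (auto simp: embedding_map_def homeomorphic_eq_everything_map continuous_map_in_subtopology)

lemma compactin_edge: "e \<in> edges M \<Longrightarrow> compactin (surface M) (edge_points M e)"
  by (rule image_compactin[OF _ continuous_epath]) (auto simp: compactin_subtopology)

lemma edge_points_eq: "edge_points M e = edge_interior M e \<union> {epath M e 0, epath M e 1}"
proof -
  have "{0..1::real} = {0<..<1} \<union> {0, 1}" by auto
  then show ?thesis by (metis image_Un image_empty image_insert)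
qed

lemma edge_points_eq_ends: "e \<in> edges M \<Longrightarrow> edge_points M e = edge_interior M e \<union> vpos M ` ends M e"
  using edge_points_eq epath_ends by metis

lemma edge_interior_in_edge:
  assumes "e \<in> edges M" "e' \<in> edges M" "x \<in> edge_interior M e" "x \<in> edge_points M e'"
  shows "e' = e"
proof (rule ccontr)
  assume "e' \<noteq> e"
  then have "x \<in> vpos M ` ends M e'"
    using assms edge_interiors_disjoint edge_points_eq_ends by blast
  then show False using assms ends_subset edge_interior_not_vertex by blast
qed

text \<open>A real coordinate on the edge, defined on points of the surface. It is what detects that
  an arc is one-dimensional, both for loops and for neighbourhoods inside an edge.\<close>

lemma edge_inverse:
  assumes "e \<in> edges M"
  obtains g where "continuous_map (subtopology (surface M) (edge_points M e)) euclideanreal g"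
    "\<And>t. t \<in> {0..1} \<Longrightarrow> g (epath M e t) = t"
proof -
  have "homeomorphic_map (top_of_set {0..1}) (subtopology (surface M) (edge_points M e)) (epath M e)"
    using epath_embedding[OF assms] by (simp add: embedding_map_def)
  then obtain g where g: "homeomorphic_maps (top_of_set {0..1}) (subtopology (surface M) (edge_points M e)) (epath M e) g"
    unfolding homeomorphic_map_maps by blast
  show ?thesis
  proof (rule that[of g])
    show "continuous_map (subtopology (surface M) (edge_points M e)) euclideanreal g"
      using g by (auto simp: homeomorphic_maps_def continuous_map_in_subtopology)
    show "g (epath M e t) = t" if "t \<in> {0..1}" for t
      using g that by (auto simp: homeomorphic_maps_def)
  qed
qed

lemma edge_in_skeleton: "e \<in> edges M \<Longrightarrow> edge_points M e \<subseteq> skeleton_points M"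
  by (auto simp: skeleton_points_def)

lemma vertex_in_skeleton: "v \<in> verts M \<Longrightarrow> vpos M v \<in> skeleton_points M"
  by (auto simp: skeleton_points_def)

lemma face_subset: "F \<in> faces M \<Longrightarrow> F \<subseteq> topspace (surface M) - skeleton_points M"
  unfolding faces_def using connected_components_of_subset by fastforce

lemma faces_disjoint: "F \<in> faces M \<Longrightarrow> G \<in> faces M \<Longrightarrow> F \<noteq> G \<Longrightarrow> F \<inter> G = {}"
  unfolding faces_def by (metis connected_components_of_disjoint disjnt_def)

lemma Union_faces: "\<Union> (faces M) = topspace (surface M) - skeleton_points M"
  unfolding faces_def Union_connected_components_of by auto

end

section \<open>A single face with a fixed parametrization of its closed disk and a nonempty
  walk\<close>

locale parametrized_face = embedded_map M for M :: "('v, 'e, 'a) drawing" +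
  fixes F :: "'a set" and w :: "('v \<times> 'e) list" and \<phi> :: "complex \<Rightarrow> 'a"
  assumes face: "F \<in> faces M"
    and cont: "continuous_map (top_of_set (cball 0 1)) (surface M) \<phi>"
    and hom: "homeomorphic_map (top_of_set (ball 0 1)) (subtopology (surface M) F) \<phi>"
    and nonempty: "w \<noteq> []"
    and walk: "\<And>k. k < length w \<Longrightarrow> case w ! k of (v, e) \<Rightarrow>
        v \<in> verts M \<and> e \<in> edges M \<and>
        \<phi> (cis (2 * pi * real k / real (length w))) = vpos M v \<and>
        inj_on \<phi> (side (length w) k) \<and>
        \<phi> ` side (length w) k = edge_points M e"
begin

abbreviation "p \<equiv> length w"
abbreviation "V k \<equiv> fst (w ! k)"
abbreviation "E k \<equiv> snd (w ! k)"

lemma p_pos [simp]: "0 < p"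
  using nonempty by simp

lemma V_in: "k < p \<Longrightarrow> V k \<in> verts M"
  and E_in: "k < p \<Longrightarrow> E k \<in> edges M"
  and at_corner: "k < p \<Longrightarrow> \<phi> (circ p (real k)) = vpos M (V k)"
  and inj_side: "k < p \<Longrightarrow> inj_on \<phi> (side p k)"
  and image_side: "k < p \<Longrightarrow> \<phi> ` side p k = edge_points M (E k)"
  using walk[of k] by (auto simp: circ_def split: prod.splits)

lemma at_next_corner: "k < p \<Longrightarrow> \<phi> (circ p (real k + 1)) = vpos M (V ((k + 1) mod p))"
  using at_corner[of "(k + 1) mod p"] circ_Suc_mod[of k p] mod_less_divisor[OF p_pos, of "k + 1"] by simp

lemma inj_ball: "inj_on \<phi> (ball 0 1)" and image_ball: "\<phi> ` ball 0 1 = F"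
proof -
  have "F \<subseteq> topspace (surface M)" using face_subset face by blast
  then show "inj_on \<phi> (ball 0 1)" "\<phi> ` ball 0 1 = F"
    using hom by (auto simp: homeomorphic_eq_everything_map)
qed

lemma sphere_skeleton:
  assumes "z \<in> sphere 0 1" shows "\<phi> z \<in> skeleton_points M"
proof -
  obtain k where "k < p" "z \<in> side p k" using sphere_in_side[OF p_pos assms] by blast
  then show ?thesis using image_side E_in edge_in_skeleton by blast
qed

lemma ball_iff: "z \<in> cball 0 1 \<Longrightarrow> z \<in> ball 0 1 \<longleftrightarrow> \<phi> z \<in> F"
  using image_ball sphere_skeleton[of z] face_subset[OF face] by fastforce

lemma sphere_iff: "z \<in> cball 0 1 \<Longrightarrow> z \<in> sphere 0 1 \<longleftrightarrow> \<phi> z \<in> skeleton_points M"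
  using image_ball sphere_skeleton[of z] face_subset[OF face] by fastforce

text \<open>A loop cannot be mapped injectively to an arc: the coordinate along the arc takes
  equal values at some pair of antipodal points.\<close>

lemma p_ge_2: "2 \<le> p"
proof (rule ccontr)
  assume "\<not> 2 \<le> p"
  then have p1: "p = 1" using p_pos by linarith
  obtain g where g: "continuous_map (subtopology (surface M) (edge_points M (E 0))) euclideanreal g"
    and ge: "\<And>t. t \<in> {0..1} \<Longrightarrow> g (epath M (E 0) t) = t"
    using edge_inverse[OF E_in[OF p_pos]] by metis
  have inj_g: "inj_on g (edge_points M (E 0))"
    using ge by (auto simp: inj_on_def) 
  have s: "circ p t \<in> side p 0" if "0 \<le> t" "t \<le> 1" for t
    using that by (auto simp: side_eq_circ)
  define f where "f t = g (\<phi> (circ p t))" for t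
  have "continuous_map (top_of_set {0..1}) (surface M) (\<phi> \<circ> circ p)"
    by (rule continuous_map_compose[OF _ cont])
      (auto simp: continuous_map_in_subtopology intro!: continuous_intros)
  moreover have "(\<phi> \<circ> circ p) ` {0..1} \<subseteq> edge_points M (E 0)"
    using s image_side[OF p_pos] by auto
  ultimately have "continuous_map (top_of_set {0..1}) (subtopology (surface M) (edge_points M (E 0))) (\<phi> \<circ> circ p)"
    by (auto simp: continuous_map_in_subtopology)
  from continuous_map_compose[OF this g] have cf: "continuous_on {0..1} f"
    by (simp add: o_def f_def)
  define D where "D t = f t - f (t + 1 / 2)" for t
  have cD: "continuous_on {0..1/2} D"
    unfolding D_def
    by (intro continuous_intros continuous_on_compose2[OF cf] continuous_on_subset[OF cf]) auto
  have "f 1 = f 0" using circ_add_period[of p 0] p1 by (simp add: f_def)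
  then have "D (1/2) = - D 0" by (simp add: D_def)
  then have "\<exists>t. 0 \<le> t \<and> t \<le> 1/2 \<and> D t = 0"
    using IVT'[of D 0 0 "1/2"] IVT2'[of D "1/2" 0 0] cD by (cases "D 0 \<le> 0") auto
  then obtain t where t: "0 \<le> t" "t \<le> 1/2" "D t = 0" by blast
  have st: "circ p t \<in> side p 0" "circ p (t + 1/2) \<in> side p 0" using s t by auto
  then have "\<phi> (circ p t) \<in> edge_points M (E 0)" "\<phi> (circ p (t + 1/2)) \<in> edge_points M (E 0)"
    using image_side[OF p_pos] by blast+
  moreover have "g (\<phi> (circ p t)) = g (\<phi> (circ p (t + 1/2)))" using t(3) by (simp add: D_def f_def)
  ultimately have "\<phi> (circ p t) = \<phi> (circ p (t + 1/2))" using inj_onD[OF inj_g] by blast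
  then have "circ p t = circ p (t + 1/2)"
    using inj_onD[OF inj_side[OF p_pos]] st by blast
  then show False using circ_inj[of p t "t + 1/2"] p1 by simp
qed

lemma Suc_mod_neq: "k < p \<Longrightarrow> (k + 1) mod p \<noteq> k"
  using p_ge_2 by (cases "k + 1 = p") auto

lemma corner_in_side: "circ p (real k) \<in> side p k" "circ p (real k + 1) \<in> side p k"
  by (auto simp: side_eq)

text \<open>As \<open>p\<close> is at least 2, the two corners of a side are different points, and
  injectivity on the side makes their vertices different. Vertices that lie on an edge are ends of
  it, and there are only two ends.\<close>

lemma ends_E:
  assumes "k < p"
  shows "ends M (E k) = {V k, V ((k + 1) mod p)}" "V k \<noteq> V ((k + 1) mod p)"
proof -
  let ?k = "(k + 1) mod p"
  have k': "?k < p" using p_pos by (rule mod_less_divisor)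
  have "circ p (real k) \<noteq> circ p (real k + 1)"
    unfolding circ_Suc_mod[OF assms] using circ_real_inj[OF assms k'] Suc_mod_neq[OF assms] by metis
  then have "vpos M (V k) \<noteq> vpos M (V ?k)"
    using inj_onD[OF inj_side[OF assms]] corner_in_side[of k] at_corner[OF assms] at_next_corner[OF assms] by metis
  then show ne: "V k \<noteq> V ?k" by metis
  have sub: "V j \<in> ends M (E k)" if "j < p" "vpos M (V j) \<in> edge_points M (E k)" for j
  proof -
    have "vpos M (V j) \<in> vpos M ` ends M (E k)"
      using that(2) edge_interior_not_vertex[OF E_in[OF assms]] V_in[OF that(1)]
      unfolding edge_points_eq_ends[OF E_in[OF assms]] by blast
    then show ?thesis
      using inj_vpos ends_subset[OF E_in[OF assms]] V_in[OF that(1)] by (auto simp: inj_on_def)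
  qed
  have "V k \<in> ends M (E k)" "V ?k \<in> ends M (E k)"
    using sub[OF assms] sub[OF k'] at_corner[OF assms] at_next_corner[OF assms] corner_in_side[of k]
      image_side[OF assms] by (metis imageI)+
  moreover have "card (ends M (E k)) = 2" using card_ends E_in assms by blast
  ultimately show "ends M (E k) = {V k, V ?k}"
    using ne by (auto simp: card_2_iff)
qed

text \<open>Both ends of the edge are already taken as values at the two corners of the side, and
  \<open>\<phi>\<close> is injective on the side.\<close>

lemma sector_edge_interior:
  assumes k: "k < p" and z: "z \<in> sector p k \<inter> sphere 0 1"
  shows "\<phi> z \<in> edge_interior M (E k)"
proof -
  have zs: "z \<in> side p k" using z by (simp add: side_eq)
  have "\<phi> z \<noteq> vpos M v" if v: "v \<in> ends M (E k)" for v
  proof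
    assume eq: "\<phi> z = vpos M v"
    let ?k = "(k + 1) mod p"
    have k': "?k < p" using p_pos by (rule mod_less_divisor)
    have "\<phi> z = \<phi> (circ p (real k)) \<or> \<phi> z = \<phi> (circ p (real k + 1))"
      using v eq ends_E(1)[OF k] at_corner[OF k] at_next_corner[OF k] by auto
    then have "z = circ p (real k) \<or> z = circ p (real k + 1)"
      using inj_onD[OF inj_side[OF k]] zs corner_in_side[of k] by metis
    then show False using z circ_not_in_sector[OF k k] circ_not_in_sector[OF k' k] circ_Suc_mod[OF k] by auto
  qed
  moreover have "\<phi> z \<in> edge_points M (E k)" using zs image_side[OF k] by blast
  ultimately show ?thesis using edge_points_eq_ends[OF E_in[OF k]] by blast
qed

lemma sphere_cases:
  assumes "z \<in> sphere 0 1"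
  obtains k where "k < p" "z = circ p (real k)" | k where "k < p" "z \<in> sector p k"
proof -
  obtain k where k: "k < p" "z \<in> side p k" using sphere_in_side[OF p_pos assms] by blast
  have "(k + 1) mod p < p" using p_pos by (rule mod_less_divisor)
  then show ?thesis using k that circ_Suc_mod[OF k(1)] unfolding side_eq by auto
qed

text \<open>The face, the vertices and the open edges are disjoint, so the type of the point
  \<open>\<phi> z\<close> decides whether \<open>z\<close> is inside the disk, a corner, or on an
  open side, and in the last case which edge the side carries. The next lemma is the version for
  vertices.\<close>

lemma edge_interior_preimage:
  assumes "z \<in> cball 0 1" "e \<in> edges M" "\<phi> z \<in> edge_interior M e"
  obtains k where "k < p" "z \<in> sector p k \<inter> sphere 0 1" "E k = e"
proof -
  have "\<phi> z \<in> skeleton_points M" using assms edge_in_skeleton edge_points_eq by blast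
  then have z: "z \<in> sphere 0 1" using sphere_iff assms(1) by blast
  then show ?thesis
  proof (cases rule: sphere_cases)
    case (1 k)
    then show ?thesis using at_corner[of k] V_in[of k] edge_interior_not_vertex[OF assms(2)] assms(3) by auto
  next
    case (2 k)
    then have "\<phi> z \<in> edge_interior M (E k)" using sector_edge_interior z by blast
    then have "E k = e" using edge_interiors_disjoint[OF assms(2) E_in[OF 2(1)]] assms(3) by blast
    then show ?thesis using that 2 z by blast
  qed
qed

lemma vertex_preimage:
  assumes "z \<in> cball 0 1" "v \<in> verts M" "\<phi> z = vpos M v"
  obtains k where "k < p" "z = circ p (real k)" "V k = v"
proof -
  have "\<phi> z \<in> skeleton_points M" using assms vertex_in_skeleton by simp
  then have z: "z \<in> sphere 0 1" using sphere_iff assms(1) by blast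
  then show ?thesis
  proof (cases rule: sphere_cases)
    case (1 k)
    then have "V k = v" using at_corner[of k] V_in[of k] inj_vpos assms by (auto simp: inj_on_def)
    then show ?thesis using that 1 by blast
  next
    case (2 k)
    then have "\<phi> z \<in> edge_interior M (E k)" using sector_edge_interior z by blast
    then show ?thesis using edge_interior_not_vertex[OF E_in[OF 2(1)]] assms by auto
  qed
qed

text \<open>Each of the finitely many sides contributes at most one point. Finiteness of the fibre
  is what lets the transition between two parametrizations converge at the circle.\<close>

lemma finite_fibre: "finite {z \<in> sphere 0 1. \<phi> z = y}"
proof -
  have sub: "{z \<in> sphere 0 1. \<phi> z = y} \<subseteq> (\<Union>k<p. {z \<in> side p k. \<phi> z = y})"
  proof
    fix z assume z: "z \<in> {z \<in> sphere 0 1. \<phi> z = y}"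
    then obtain k where "k < p" "z \<in> side p k" using sphere_in_side[OF p_pos] by blast
    then show "z \<in> (\<Union>k<p. {z \<in> side p k. \<phi> z = y})" using z by auto
  qed
  have fin: "finite {z \<in> side p k. \<phi> z = y}" if "k < p" for k
  proof (cases "\<exists>z\<in>side p k. \<phi> z = y")
    case True
    then obtain z where "z \<in> side p k" "\<phi> z = y" by blast
    then have "{z \<in> side p k. \<phi> z = y} \<subseteq> {z}"
      using inj_onD[OF inj_side[OF that]] by blast
    then show ?thesis using finite_subset by blast
  next
    case False
    then have e: "{z \<in> side p k. \<phi> z = y} = {}" by blast
    show ?thesis unfolding e by simp
  qed
  show ?thesis by (rule finite_subset[OF sub finite_UN_I]) (use fin in auto)
qed

text \<open>Different sides may be glued to the same edge, so injectivity on the whole closed disk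
  cannot be expected; one open side at a time may be added to the open disk.\<close>

lemma inj_on_ball_sector:
  assumes "k < p" shows "inj_on \<phi> (ball 0 1 \<union> (sector p k \<inter> sphere 0 1))"
proof (rule inj_onI)
  fix x y assume x: "x \<in> ball 0 1 \<union> (sector p k \<inter> sphere 0 1)"
    and y: "y \<in> ball 0 1 \<union> (sector p k \<inter> sphere 0 1)" and eq: "\<phi> x = \<phi> y"
  have "x \<in> cball 0 1" "y \<in> cball 0 1" using x y by auto
  then have "x \<in> ball 0 1 \<longleftrightarrow> y \<in> ball 0 1" using ball_iff eq by metis
  then consider "x \<in> ball 0 1" "y \<in> ball 0 1" | "x \<in> side p k" "y \<in> side p k"
    using x y unfolding side_eq by blast
  then show "x = y" using eq inj_onD[OF inj_ball] inj_onD[OF inj_side[OF assms]] by cases auto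
qed

lemma closed_map: "closed_map (top_of_set (cball 0 1)) (surface M) \<phi>"
  by (rule continuous_imp_closed_map[OF cont _ Hausdorff]) (simp add: compact_space_subtopology)

lemma closedin_image: "closed S \<Longrightarrow> S \<subseteq> cball 0 1 \<Longrightarrow> closedin (surface M) (\<phi> ` S)"
  using closed_map by (auto simp: closed_map_def intro: closed_subset)

end

subsection \<open>Uniqueness of boundary walks\<close>

lemma finite_set_separation:
  fixes Z :: "'b::metric_space set"
  assumes "finite Z"
  obtains d where "d > 0" "\<And>x y. x \<in> Z \<Longrightarrow> y \<in> Z \<Longrightarrow> x \<noteq> y \<Longrightarrow> d \<le> dist x y"
proof -
  \<comment> \<open>The extra 1 keeps the set nonempty when \<open>Z\<close> has at most one
    point.\<close>
  let ?D = "insert 1 ((\<lambda>(x, y). dist x y) ` {(x, y) \<in> Z \<times> Z. x \<noteq> y})"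
  have fin: "finite ?D" using assms by (auto intro: finite_subset[of _ "Z \<times> Z"])
  show ?thesis
  proof (rule that[of "Min ?D"])
    show "Min ?D > 0" using fin by (subst Min_gr_iff) auto
    show "Min ?D \<le> dist x y" if "x \<in> Z" "y \<in> Z" "x \<noteq> y" for x y
      using fin that by (intro Min_le) auto
  qed
qed

locale two_parametrizations =
  A: parametrized_face M F w \<phi> + B: parametrized_face M F w' \<psi>
  for M :: "('v, 'e, 'a) drawing" and F w \<phi> w' \<psi>
begin

text \<open>The closed disk without the \<open>\<epsilon>\<close>-balls around the fibre is compact,
  so its image under \<open>\<psi>\<close> is closed. This image misses
  \<open>\<phi> \<zeta>\<close>, hence also all values of \<open>\<phi>\<close> near
  \<open>\<zeta>\<close>.\<close>

lemma transition_near_boundary: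
  assumes g: "\<And>z. z \<in> ball 0 1 \<Longrightarrow> g z \<in> ball 0 1 \<and> \<psi> (g z) = \<phi> z"
    and \<zeta>: "\<zeta> \<in> sphere 0 1" and "0 < \<epsilon>"
  obtains \<delta> where "0 < \<delta>"
    "g ` (ball \<zeta> \<delta> \<inter> ball 0 1) \<subseteq> (\<Union>\<xi>\<in>{\<xi> \<in> sphere 0 1. \<psi> \<xi> = \<phi> \<zeta>}. ball \<xi> \<epsilon>)"
proof -
  let ?Z = "{\<xi> \<in> sphere 0 1. \<psi> \<xi> = \<phi> \<zeta>}"
  define C where "C = cball 0 1 - (\<Union>\<xi>\<in>?Z. ball \<xi> \<epsilon>)"
  have "closed C" unfolding C_def by (intro closed_Diff) auto
  then have "closedin (surface M) (\<psi> ` C)" using B.closedin_image C_def by blast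
  then have "openin (surface M) (topspace (surface M) - \<psi> ` C)" by blast
  from openin_continuous_map_preimage[OF A.cont this]
  have op: "openin (top_of_set (cball 0 1)) {z \<in> cball 0 1. \<phi> z \<in> topspace (surface M) - \<psi> ` C}" by simp
  have "\<phi> \<zeta> \<notin> \<psi> ` C"
  proof
    assume "\<phi> \<zeta> \<in> \<psi> ` C"
    then obtain c where c: "c \<in> C" "\<phi> \<zeta> = \<psi> c" by blast
    \<comment> \<open>The value of \<open>\<psi>\<close> at \<open>c\<close> lies in the skeleton,
      so \<open>c\<close> is on the circle and thus in the fibre.\<close>
    then have "c \<in> ?Z" using A.sphere_skeleton[OF \<zeta>] B.sphere_iff[of c] by (auto simp: C_def)
    then show False using c \<open>0 < \<epsilon>\<close> by (auto simp: C_def)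
  qed
  moreover have "\<phi> \<zeta> \<in> topspace (surface M)"
    using continuous_map_image_subset_topspace[OF A.cont] \<zeta> by force
  ultimately have "\<zeta> \<in> {z \<in> cball 0 1. \<phi> z \<in> topspace (surface M) - \<psi> ` C}" using \<zeta> by auto
  then obtain \<delta> where \<delta>: "0 < \<delta>" "ball \<zeta> \<delta> \<inter> cball 0 1 \<subseteq> {z \<in> cball 0 1. \<phi> z \<in> topspace (surface M) - \<psi> ` C}"
    using op unfolding openin_contains_ball by blast
  have "g z \<in> (\<Union>\<xi>\<in>?Z. ball \<xi> \<epsilon>)" if "z \<in> ball \<zeta> \<delta> \<inter> ball 0 1" for z
  proof -
    have "\<phi> z \<notin> \<psi> ` C" using \<delta>(2) that by auto
    moreover have "g z \<in> cball 0 1" "\<psi> (g z) = \<phi> z" using g[of z] that by auto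
    ultimately have "g z \<notin> C" by (metis imageI)
    then show ?thesis using \<open>g z \<in> cball 0 1\<close> unfolding C_def by blast
  qed
  then show ?thesis using that \<delta>(1) by blast
qed

text \<open>Near \<open>\<zeta>\<close> the transition map stays close to a finite fibre; by connectedness it stays close to a
  single point of it.\<close>

lemma transition_limit:
  assumes g: "\<And>z. z \<in> ball 0 1 \<Longrightarrow> g z \<in> ball 0 1 \<and> \<psi> (g z) = \<phi> z"
    and cg: "continuous_on (ball 0 1) g" and \<zeta>: "\<zeta> \<in> sphere 0 1"
  shows "\<exists>\<xi>. limitin euclidean g \<xi> (atin_within euclidean \<zeta> (ball 0 1))"
proof -
  let ?Z = "{\<xi> \<in> sphere 0 1. \<psi> \<xi> = \<phi> \<zeta>}"
  obtain d where d: "d > 0" "\<And>x y. x \<in> ?Z \<Longrightarrow> y \<in> ?Z \<Longrightarrow> x \<noteq> y \<Longrightarrow> d \<le> dist x y"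
    using finite_set_separation[OF B.finite_fibre] by blast
  define \<epsilon>0 where "\<epsilon>0 = d / 2"
  have dj: "x = y" if "x \<in> ?Z" "y \<in> ?Z" "z \<in> ball x \<epsilon>0" "z \<in> ball y \<epsilon>0" for x y z
  proof (rule ccontr)
    assume "x \<noteq> y"
    then have "d \<le> dist x y" using d that by blast
    also have "\<dots> \<le> dist x z + dist y z" using dist_triangle2 by blast
    finally show False using that(3,4) by (simp add: \<epsilon>0_def)
  qed
  have near: "ball \<zeta> \<delta> \<inter> ball 0 1 \<noteq> {}" if \<delta>: "0 < \<delta>" for \<delta>
  proof -
    have "\<zeta> \<in> closure (ball 0 1)" using \<zeta> by simp
    then obtain z where "z \<in> ball 0 1" "dist z \<zeta> < \<delta>" using \<delta> unfolding closure_approachable by blast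
    then have "z \<in> ball \<zeta> \<delta> \<inter> ball 0 1" by (simp add: dist_commute)
    then show ?thesis by blast
  qed
  have one: "\<exists>\<xi>\<in>?Z. \<exists>\<delta>>0. g ` (ball \<zeta> \<delta> \<inter> ball 0 1) \<subseteq> ball \<xi> \<epsilon>" if \<epsilon>: "0 < \<epsilon>" "\<epsilon> \<le> \<epsilon>0" for \<epsilon>
  proof -
    obtain \<delta> where \<delta>: "0 < \<delta>" "g ` (ball \<zeta> \<delta> \<inter> ball 0 1) \<subseteq> (\<Union>\<xi>\<in>?Z. ball \<xi> \<epsilon>)"
      using transition_near_boundary[OF g \<zeta> \<epsilon>(1)] by blast
    have "connected (g ` (ball \<zeta> \<delta> \<inter> ball 0 1))"
      by (intro connected_continuous_image continuous_on_subset[OF cg] convex_connected convex_Int) auto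
    moreover have "ball x \<epsilon> \<inter> ball y \<epsilon> \<inter> g ` (ball \<zeta> \<delta> \<inter> ball 0 1) = {}"
      if "x \<in> ?Z" "y \<in> ?Z" "x \<noteq> y" for x y
      using dj[OF that(1,2)] that(3) subset_ball[OF \<epsilon>(2)] by blast
    ultimately obtain \<xi> where "\<xi> \<in> ?Z" "g ` (ball \<zeta> \<delta> \<inter> ball 0 1) \<subseteq> ball \<xi> \<epsilon>"
      using near[OF \<delta>(1)] \<delta>(2) connected_in_one_of_disjoint_open[where S = "g ` (ball \<zeta> \<delta> \<inter> ball 0 1)" and I = ?Z and U = "\<lambda>\<xi>. ball \<xi> \<epsilon>"]
      by (metis (no_types, lifting) image_is_empty open_ball)
    then show ?thesis using \<delta>(1) by blast
  qed
  have "0 < \<epsilon>0" using d(1) by (simp add: \<epsilon>0_def)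
  then obtain \<xi> \<delta>0 where \<xi>: "\<xi> \<in> ?Z" "0 < \<delta>0" "g ` (ball \<zeta> \<delta>0 \<inter> ball 0 1) \<subseteq> ball \<xi> \<epsilon>0"
    using one[of \<epsilon>0] by blast
  \<comment> \<open>A smaller radius could in principle select another point of the fibre. Both
    selected balls contain \<open>g z\<close> for some \<open>z\<close> close to
    \<open>\<zeta>\<close>, and the \<open>\<epsilon>0\<close>-balls around the fibre are disjoint,
    so the point is always \<open>\<xi>\<close>.\<close>
  have "\<exists>\<delta>>0. g ` (ball \<zeta> \<delta> \<inter> ball 0 1) \<subseteq> ball \<xi> \<epsilon>" if "0 < \<epsilon>" for \<epsilon>
  proof -
    have m: "0 < min \<epsilon> \<epsilon>0" "min \<epsilon> \<epsilon>0 \<le> \<epsilon>0" using that \<open>0 < \<epsilon>0\<close> by auto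
    obtain \<xi>' \<delta> where \<xi>': "\<xi>' \<in> ?Z" "0 < \<delta>" "g ` (ball \<zeta> \<delta> \<inter> ball 0 1) \<subseteq> ball \<xi>' (min \<epsilon> \<epsilon>0)"
      using one[OF m] by blast
    obtain z where z: "z \<in> ball \<zeta> (min \<delta> \<delta>0) \<inter> ball 0 1" using near[of "min \<delta> \<delta>0"] \<xi>(2) \<xi>'(2)
      by (metis all_not_in_conv min_less_iff_conj)
    then have "z \<in> ball \<zeta> \<delta>0 \<inter> ball 0 1" by auto
    then have "g z \<in> ball \<xi> \<epsilon>0" using \<xi>(3) by blast
    moreover have "z \<in> ball \<zeta> \<delta> \<inter> ball 0 1" using z by auto
    then have "g z \<in> ball \<xi>' (min \<epsilon> \<epsilon>0)" using \<xi>'(3) by blast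
    then have "g z \<in> ball \<xi>' \<epsilon>0" by auto
    ultimately have "\<xi>' = \<xi>" using dj \<xi>(1) \<xi>'(1) by blast
    then show ?thesis using \<xi>'(2,3) by fastforce
  qed
  then have lim: "\<exists>\<delta>>0. g ` (ball \<zeta> \<delta> \<inter> ball 0 1) \<subseteq> ball \<xi> \<epsilon>" if "0 < \<epsilon>" for \<epsilon> using that .
  have "(g \<longlongrightarrow> \<xi>) (atin_within euclidean \<zeta> (ball 0 1))"
  proof (rule tendstoI)
    fix \<epsilon> :: real assume "0 < \<epsilon>"
    then obtain \<delta> where \<delta>: "0 < \<delta>" "g ` (ball \<zeta> \<delta> \<inter> ball 0 1) \<subseteq> ball \<xi> \<epsilon>" using lim by blast
    then have "\<forall>x\<in>ball \<zeta> \<delta>. x \<in> ball 0 1 \<and> x \<noteq> \<zeta> \<longrightarrow> dist (g x) \<xi> < \<epsilon>"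
      by (metis (no_types, lifting) IntI dist_commute image_subset_iff mem_ball)
    then show "\<forall>\<^sub>F x in atin_within euclidean \<zeta> (ball 0 1). dist (g x) \<xi> < \<epsilon>"
      using \<delta>(1) unfolding eventually_atin_within by (intro disjI2 exI[of _ "ball \<zeta> \<delta>"]) simp
  qed
  then show ?thesis by auto
qed

text \<open>On the open disk the transition is the inverse of \<open>\<psi>\<close> after
  \<open>\<phi>\<close>. Limits at all boundary points give a continuous extension, and the equation
  between \<open>\<psi>\<close> and \<open>\<phi>\<close> passes to the closed disk because the open
  disk is dense and the surface is Hausdorff.\<close>

lemma transition_extends:
  obtains G where "continuous_on (cball 0 1) G" "\<And>z. z \<in> ball 0 1 \<Longrightarrow> G z \<in> ball 0 1"
    "\<And>z. z \<in> cball 0 1 \<Longrightarrow> G z \<in> cball 0 1" "\<And>z. z \<in> cball 0 1 \<Longrightarrow> \<psi> (G z) = \<phi> z"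
proof -
  obtain \<psi>' where \<psi>': "homeomorphic_maps (top_of_set (ball 0 1)) (subtopology (surface M) F) \<psi> \<psi>'"
    using B.hom unfolding homeomorphic_map_maps by blast
  define g where "g = \<psi>' \<circ> \<phi>"
  have "continuous_map (top_of_set (ball 0 1)) (subtopology (surface M) F) \<phi>"
    using A.hom homeomorphic_imp_continuous_map by blast
  moreover have c': "continuous_map (subtopology (surface M) F) (top_of_set (ball 0 1)) \<psi>'"
    using \<psi>' homeomorphic_maps_def by blast
  ultimately have "continuous_map (top_of_set (ball 0 1)) (top_of_set (ball 0 1)) g"
    unfolding g_def by (rule continuous_map_compose)
  then have cg: "continuous_on (ball 0 1) g" and g1: "\<And>z. z \<in> ball 0 1 \<Longrightarrow> g z \<in> ball 0 1"
    by (auto simp: continuous_map_in_subtopology)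
  have Ftop: "F \<subseteq> topspace (surface M)" using A.face_subset[OF A.face] by blast
  have g2: "\<psi> (g z) = \<phi> z" if "z \<in> ball 0 1" for z
  proof -
    have "\<phi> z \<in> F" using A.image_ball that by blast
    then show ?thesis using \<psi>' Ftop by (auto simp: homeomorphic_maps_def g_def)
  qed
  have dense: "cball 0 1 \<subseteq> closure (ball (0::complex) 1)" by simp
  obtain G where G: "continuous_map (top_of_set (cball 0 1)) euclidean G" "\<And>z. z \<in> ball 0 1 \<Longrightarrow> G z = g z"
  proof (rule continuous_map_extension_pointwise_alt[of euclidean "ball 0 1" "cball 0 1" euclidean g])
    show "\<exists>l. limitin euclidean g l (atin_within euclidean t (ball 0 1))" if "t \<in> cball 0 1 - ball 0 1" for t
      using transition_limit[OF _ cg] g1 g2 that by auto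
  qed (use cg dense regular_space_euclidean in auto)
  have cG: "continuous_on (cball 0 1) G" using G(1) by simp
  have "G ` closure (ball 0 1) \<subseteq> cball 0 1"
  proof (rule image_closure_subset)
    show "G ` ball 0 1 \<subseteq> cball 0 1" using G(2) g1 ball_subset_cball by fastforce
  qed (use cG in auto)
  then have G1: "G z \<in> cball 0 1" if "z \<in> cball 0 1" for z
    using that closure_ball[of 1 "0::complex"] by (metis image_subset_iff zero_less_one)
  have "continuous_map (top_of_set (cball 0 1)) (top_of_set (cball 0 1)) G"
    using G(1) G1 by (auto simp: continuous_map_in_subtopology)
  from continuous_map_compose[OF this B.cont]
  have c\<psi>G: "continuous_map (top_of_set (cball 0 1)) (surface M) (\<psi> \<circ> G)" .
  have "(\<psi> \<circ> G) z = \<phi> z" if "z \<in> cball 0 1" for z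
  proof (rule forall_in_closure_of_eq[OF _ A.Hausdorff c\<psi>G A.cont])
    show "z \<in> top_of_set (cball 0 1) closure_of ball 0 1"
      using that by (simp add: closure_of_subtopology Int_absorb1 ball_subset_cball)
    show "(\<psi> \<circ> G) x = \<phi> x" if "x \<in> ball 0 1" for x using G(2) g2 that by simp
  qed
  then show ?thesis using that cG G(2) g1 G1 by simp
qed

end

sublocale two_parametrizations \<subseteq> swap: two_parametrizations M F w' \<psi> w \<phi>
  by unfold_locales

context two_parametrizations
begin

text \<open>The extension \<open>H\<close> for the swapped parametrizations inverts
  \<open>G\<close>: on the open disk by injectivity of \<open>\<phi>\<close>, on the closed disk by
  continuity. The circle is preserved because in either parametrization it is the preimage of the
  skeleton.\<close>

lemma transition_homeomorphism:
  obtains G where "continuous_on (cball 0 1) G" "inj_on G (cball 0 1)"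
    "\<And>z. z \<in> cball 0 1 \<Longrightarrow> G z \<in> cball 0 1" "\<And>z. z \<in> cball 0 1 \<Longrightarrow> \<psi> (G z) = \<phi> z"
    "\<And>z. z \<in> sphere 0 1 \<Longrightarrow> G z \<in> sphere 0 1"
proof -
  obtain G where G: "continuous_on (cball 0 1) G" "\<And>z. z \<in> ball 0 1 \<Longrightarrow> G z \<in> ball 0 1"
    "\<And>z. z \<in> cball 0 1 \<Longrightarrow> G z \<in> cball 0 1" "\<And>z. z \<in> cball 0 1 \<Longrightarrow> \<psi> (G z) = \<phi> z"
    by (rule transition_extends) (rule that)
  obtain H where H: "continuous_on (cball 0 1) H" "\<And>z. z \<in> ball 0 1 \<Longrightarrow> H z \<in> ball 0 1"
    "\<And>z. z \<in> cball 0 1 \<Longrightarrow> H z \<in> cball 0 1" "\<And>z. z \<in> cball 0 1 \<Longrightarrow> \<phi> (H z) = \<psi> z"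
    by (rule swap.transition_extends) (rule that)
  have HG: "H (G z) = z" if "z \<in> ball 0 1" for z
    using inj_onD[OF A.inj_ball, of "H (G z)" z] G(2-4)[of z] H(2,4)[of "G z"] that by auto
  have "H (G z) = z" if "z \<in> cball 0 1" for z
  proof (rule continuous_constant_on_closure[of "ball 0 1" "\<lambda>z. H (G z) - z" 0 z, simplified])
    show "continuous_on (cball 0 1) (\<lambda>z. H (G z) - z)"
      by (intro continuous_intros continuous_on_compose2[OF H(1) G(1)]) (use G(3) in auto)
  qed (use that HG in auto)
  then have "inj_on G (cball 0 1)" by (rule inj_on_inverseI)
  moreover have "G z \<in> sphere 0 1" if "z \<in> sphere 0 1" for z
  proof -
    have "z \<in> cball 0 1" using that by simp
    then show ?thesis using A.sphere_skeleton[OF that] B.sphere_iff[OF G(3)] G(4) by metis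
  qed
  ultimately show ?thesis using that G by blast
qed

text \<open>The transition takes corners to corners, which defines \<open>\<kappa>\<close>, and each
  open side, being connected, into a single side, which defines \<open>\<pi>\<close>. The last
  equation is between unordered pairs because the transition may reverse the direction of the
  walk.\<close>

lemma walks_correspond:
  obtains \<kappa> \<pi> where
    "\<And>k. k < length w \<Longrightarrow> \<kappa> k < length w' \<and> \<pi> k < length w'"
    "\<And>k. k < length w \<Longrightarrow> fst (w' ! \<kappa> k) = fst (w ! k)"
    "\<And>k. k < length w \<Longrightarrow> snd (w' ! \<pi> k) = snd (w ! k)"
    "\<And>k. k < length w \<Longrightarrow> {\<kappa> k, \<kappa> ((k + 1) mod length w)} = {\<pi> k, (\<pi> k + 1) mod length w'}"
proof -
  obtain G where cG: "continuous_on (cball 0 1) G" and inj: "inj_on G (cball 0 1)"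
    and G1: "\<And>z. z \<in> cball 0 1 \<Longrightarrow> G z \<in> cball 0 1" and G2: "\<And>z. z \<in> cball 0 1 \<Longrightarrow> \<psi> (G z) = \<phi> z"
    and G3: "\<And>z. z \<in> sphere 0 1 \<Longrightarrow> G z \<in> sphere 0 1"
    by (rule transition_homeomorphism) (rule that)
  have "\<exists>m<length w'. G (circ A.p (real k)) = circ B.p (real m) \<and> fst (w' ! m) = fst (w ! k)"
    if "k < length w" for k
  proof -
    have "circ A.p (real k) \<in> cball 0 1" by simp
    then show ?thesis
      using B.vertex_preimage[OF G1 A.V_in[OF that], of "circ A.p (real k)"] G2 A.at_corner[OF that] by metis
  qed
  then obtain \<kappa> where \<kappa>: "\<And>k. k < length w \<Longrightarrow> \<kappa> k < length w'"
    "\<And>k. k < length w \<Longrightarrow> G (circ A.p (real k)) = circ B.p (real (\<kappa> k))"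
    "\<And>k. k < length w \<Longrightarrow> fst (w' ! \<kappa> k) = fst (w ! k)"
    by metis
  have "\<exists>j<length w'. snd (w' ! j) = snd (w ! k) \<and> G ` side A.p k \<subseteq> side B.p j" if k: "k < length w" for k
  proof -
    let ?S = "circ A.p ` {real k<..<real k + 1}"
    have S: "?S = sector A.p k \<inter> sphere 0 1" by (simp add: sector_Int_sphere)
    have edge: "\<psi> (G z) \<in> edge_interior M (A.E k)" if "z \<in> ?S" for z
    proof -
      have "z \<in> sector A.p k \<inter> sphere 0 1" using that S by simp
      moreover from this have "z \<in> cball 0 1" by auto
      ultimately show ?thesis using A.sector_edge_interior[OF k] G2 by simp
    qed
    have pre: "\<exists>j<length w'. G z \<in> sector B.p j \<inter> sphere 0 1 \<and> B.E j = A.E k" if "z \<in> ?S" for z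
    proof -
      have "z \<in> cball 0 1" using that by auto
      then show ?thesis using B.edge_interior_preimage[OF G1 A.E_in[OF k] edge[OF that]] by metis
    qed
    have "connected (G ` ?S)"
      by (intro connected_continuous_image continuous_on_subset[OF cG] continuous_intros) auto
    moreover have "G ` ?S \<noteq> {}" by simp
    moreover have "G ` ?S \<subseteq> (\<Union>j<B.p. sector B.p j)" using pre by blast
    ultimately obtain j where j: "j < B.p" "G ` ?S \<subseteq> sector B.p j"
      using connected_in_one_of_disjoint_open[where S = "G ` ?S" and I = "{..<B.p}" and U = "sector B.p"] open_sector[OF B.p_pos] sector_disjoint
      by (metis (no_types, lifting) inf_bot_left lessThan_iff)
    \<comment> \<open>One sample point identifies the edge: the sector that contains its image
      carries the right edge, and sectors are disjoint.\<close>
    have "circ A.p (real k + 1/2) \<in> ?S" by simp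
    then obtain i where "i < B.p" "G (circ A.p (real k + 1/2)) \<in> sector B.p i" "B.E i = A.E k"
      using pre by blast
    moreover have "G (circ A.p (real k + 1/2)) \<in> sector B.p j" using j(2) by auto
    ultimately have "B.E j = A.E k" using sector_disjoint[of i B.p j] j(1) by blast
    moreover have "G ` side A.p k \<subseteq> side B.p j"
    proof -
      have S_side: "G ` ?S \<subseteq> side B.p j"
      proof
        fix y assume y: "y \<in> G ` ?S"
        then have "y \<in> sphere 0 1" using pre by blast
        then show "y \<in> side B.p j" using y j(2) unfolding side_eq by blast
      qed
      \<comment> \<open>The corners of a side are limits of its open part, and the target side is
        closed.\<close>
      have "side A.p k = circ A.p ` closure {real k<..<real k + 1}"
        by (simp add: side_eq_circ)
      also have "\<dots> \<subseteq> closure ?S"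
        by (rule continuous_image_closure_subset[of UNIV]) (auto intro!: continuous_intros)
      finally have "G ` side A.p k \<subseteq> G ` closure ?S" by blast
      also have "\<dots> \<subseteq> side B.p j"
      proof (rule image_closure_subset)
        have "closure ?S \<subseteq> cball 0 1" by (rule closure_minimal) auto
        then show "continuous_on (closure ?S) G" using cG continuous_on_subset by blast
        show "closed (side B.p j)" by (simp add: compact_imp_closed)
        show "G ` ?S \<subseteq> side B.p j" by (rule S_side)
      qed
      finally show ?thesis .
    qed
    ultimately show ?thesis using j(1) by blast
  qed
  then obtain \<pi> where \<pi>: "\<And>k. k < length w \<Longrightarrow> \<pi> k < length w'"
    "\<And>k. k < length w \<Longrightarrow> snd (w' ! \<pi> k) = snd (w ! k)"
    "\<And>k. k < length w \<Longrightarrow> G ` side A.p k \<subseteq> side B.p (\<pi> k)"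
    by metis
  have "{\<kappa> k, \<kappa> ((k + 1) mod length w)} = {\<pi> k, (\<pi> k + 1) mod length w'}" if k: "k < length w" for k
  proof -
    let ?k = "(k + 1) mod length w" and ?j = "(\<pi> k + 1) mod length w'"
    have k': "?k < length w" using A.p_pos by (rule mod_less_divisor)
    have j': "?j < length w'" using B.p_pos by (rule mod_less_divisor)
    have corner: "\<kappa> i \<in> {\<pi> k, ?j}" if "i < length w" "circ A.p (real i) \<in> side A.p k" for i
    proof -
      have "circ B.p (real (\<kappa> i)) \<in> side B.p (\<pi> k)" using \<kappa>(2) \<pi>(3)[OF k] that by force
      then have "circ B.p (real (\<kappa> i)) = circ B.p (real (\<pi> k)) \<or> circ B.p (real (\<kappa> i)) = circ B.p (real ?j)"
        using circ_not_in_sector[OF \<kappa>(1)[OF that(1)] \<pi>(1)[OF k]] circ_Suc_mod[OF \<pi>(1)[OF k]] by (auto simp: side_eq)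
      then show ?thesis using circ_real_inj \<kappa>(1)[OF that(1)] \<pi>(1)[OF k] j' by auto
    qed
    have "\<kappa> k \<in> {\<pi> k, ?j}" using corner[OF k] A.corner_in_side(1) by blast
    moreover have "\<kappa> ?k \<in> {\<pi> k, ?j}" using corner[OF k'] A.corner_in_side(2)[of k] circ_Suc_mod[OF k] by simp
    moreover have "\<kappa> k \<noteq> \<kappa> ?k"
    proof
      assume "\<kappa> k = \<kappa> ?k"
      then have "G (circ A.p (real k)) = G (circ A.p (real ?k))" using \<kappa>(2)[OF k] \<kappa>(2)[OF k'] by metis
      from inj_onD[OF inj this] have "circ A.p (real k) = circ A.p (real ?k)" by simp
      then show False using circ_real_inj[OF k k'] A.Suc_mod_neq[OF k] by metis
    qed
    ultimately show ?thesis by auto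
  qed
  then show ?thesis using that[of \<kappa> \<pi>] \<kappa>(1,3) \<pi>(1,2) by blast
qed

end

subsection \<open>Empty walks and symmetries\<close>

context embedded_map
begin

text \<open>The closed disk of a face with empty walk is the face together with one vertex; as a point
  does not separate a surface locally, this set is open as well, hence the whole surface.\<close>

lemma walk_nonempty:
  assumes F: "F \<in> faces M" and bw: "boundary_walk M F w" and E: "edges M \<noteq> {}"
  shows "w \<noteq> []"
proof
  assume wnil: "w = []"
  obtain \<phi> :: "complex \<Rightarrow> 'a" where cont: "continuous_map (top_of_set (cball 0 1)) (surface M) \<phi>"
    and hom: "homeomorphic_map (top_of_set (ball 0 1)) (subtopology (surface M) F) \<phi>"
    and const: "\<exists>v\<in>verts M. \<forall>z\<in>sphere 0 1. \<phi> z = vpos M v"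
    using bw unfolding boundary_walk_def if_P[OF wnil] by blast
  from const obtain v where v: "v \<in> verts M" "\<And>z. z \<in> sphere 0 1 \<Longrightarrow> \<phi> z = vpos M v" by blast
  let ?X = "surface M" and ?v = "vpos M v"
  have Ftop: "F \<subseteq> topspace ?X" using face_subset[OF F] by blast
  have inj: "inj_on \<phi> (ball 0 1)" and im: "\<phi> ` ball 0 1 = F"
    using hom Ftop by (auto simp: homeomorphic_eq_everything_map)
  have "continuous_map (top_of_set (ball 0 1)) ?X \<phi>"
    by (rule continuous_map_from_subtopology_mono[OF cont]) auto
  then have oF: "openin ?X F" using invariance_of_domain_into_surface[OF surface open_ball _ inj] im by simp
  have "\<phi> ` cball 0 1 = insert ?v F"
  proof -
    have "cball 0 1 = ball 0 1 \<union> sphere (0::complex) 1" by auto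
    moreover have "\<phi> ` sphere 0 1 = {?v}"
    proof
      have "1 \<in> sphere (0::complex) 1" by simp
      then show "{?v} \<subseteq> \<phi> ` sphere 0 1" using v(2) by (metis imageI insert_subset empty_subsetI)
    qed (use v(2) in auto)
    ultimately show ?thesis using im by (simp add: image_Un)
  qed
  moreover have "closed_map (top_of_set (cball 0 1)) ?X \<phi>"
    by (rule continuous_imp_closed_map[OF cont _ Hausdorff]) (simp add: compact_space_subtopology)
  ultimately have cl: "closedin ?X (insert ?v F)"
    unfolding closed_map_def by (metis closedin_topspace topspace_euclidean_subtopology)
  have "?v \<in> topspace ?X" using vpos_in v by blast
  then obtain U and h :: "'a \<Rightarrow> complex" and h' where U: "openin ?X U" "?v \<in> U" "U \<subseteq> topspace ?X"
    and ch: "continuous_map (subtopology ?X U) euclidean h" and ch': "continuous_map euclidean (subtopology ?X U) h'"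
    and hh: "\<And>y. y \<in> U \<Longrightarrow> h' (h y) = y" and hh': "\<And>z. h (h' z) = z"
    by (rule surface_chart[OF surface]) (rule that)
  have h'U: "h' z \<in> U" for z
    using continuous_map_image_subset_topspace[OF ch'] by auto
  have "connected (- {h ?v})" by (rule connected_punctured_universe) simp
  then have "connectedin euclidean (- {h ?v})" by simp
  from connectedin_continuous_map_image[OF ch' this]
  have "connectedin (subtopology ?X U) (h' ` (- {h ?v}))" .
  moreover have "h' ` (- {h ?v}) = U - {?v}"
  proof (intro equalityI subsetI)
    fix y assume "y \<in> h' ` (- {h ?v})"
    then obtain z where "y = h' z" "z \<noteq> h ?v" by blast
    then show "y \<in> U - {?v}" using h'U hh'[of z] by auto
  next
    fix y assume y: "y \<in> U - {?v}"
    then have "h y \<noteq> h ?v" using hh[of y] hh[OF U(2)] by auto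
    then show "y \<in> h' ` (- {h ?v})" using hh[of y] y by (metis ComplI Diff_iff image_eqI singletonD)
  qed
  ultimately have con: "connectedin ?X (U - {?v})" by (simp add: connectedin_subtopology)
  have vF: "?v \<notin> F" using face_subset[OF F] vertex_in_skeleton v by blast
  have "F \<inter> U \<noteq> {}"
  proof -
    have "openin (top_of_set (cball 0 1)) {z \<in> cball 0 1. \<phi> z \<in> U}"
      using openin_continuous_map_preimage[OF cont U(1)] by simp
    moreover have "1 \<in> {z \<in> cball 0 1. \<phi> z \<in> U}" using v(2)[of 1] U(2) by simp
    ultimately obtain \<delta> where \<delta>: "0 < \<delta>" "ball 1 \<delta> \<inter> cball 0 1 \<subseteq> {z \<in> cball 0 1. \<phi> z \<in> U}"
      unfolding openin_contains_ball by blast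
    have "1 \<in> closure (ball (0::complex) 1)" by simp
    then obtain z :: complex where "z \<in> ball 0 1" "dist z 1 < \<delta>" using \<delta>(1) unfolding closure_approachable by blast
    then have "z \<in> ball 1 \<delta> \<inter> cball 0 1" "z \<in> ball 0 1" by (auto simp: dist_commute)
    then show ?thesis using \<delta>(2) im by blast
  qed
  have "U - {?v} \<subseteq> F"
  proof (rule ccontr)
    assume "\<not> U - {?v} \<subseteq> F"
    then have ne: "(topspace ?X - insert ?v F) \<inter> (U - {?v}) \<noteq> {}" using U(3) by blast
    have o: "openin ?X (topspace ?X - insert ?v F)" using cl by blast
    have "F \<inter> (U - {?v}) \<noteq> {}" using \<open>F \<inter> U \<noteq> {}\<close> vF by blast
    moreover have "U - {?v} \<subseteq> F \<union> (topspace ?X - insert ?v F)" using U(3) by blast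
    moreover have "F \<inter> (topspace ?X - insert ?v F) \<inter> (U - {?v}) = {}" by blast
    ultimately show False using con ne oF o unfolding connectedin by blast
  qed
  then have "insert ?v F = F \<union> U" using U(2) by blast
  then have "openin ?X (insert ?v F)" using oF U(1) by (simp add: openin_Un)
  then have "insert ?v F = topspace ?X"
    using cl surface unfolding closed_surface_def connected_space_clopen_in by blast
  moreover obtain e where e: "e \<in> edges M" using E by blast
  moreover have "epath M e (1/2) \<in> edge_interior M e" by simp
  moreover have "edge_interior M e \<subseteq> topspace ?X - F"
    using compactin_subset_topspace[OF compactin_edge[OF e]] edge_in_skeleton[OF e] edge_points_eq[of e] face_subset[OF F] by blast
  ultimately show False using edge_interior_not_vertex[OF e] v(1) by blast
qed

lemma boundary_walk_parametrization:
  assumes "F \<in> faces M" "boundary_walk M F w" "edges M \<noteq> {}"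
  obtains \<phi> where "parametrized_face M F w \<phi>"
proof -
  have ne: "w \<noteq> []" using walk_nonempty[OF assms] .
  then obtain \<phi> where "continuous_map (top_of_set (cball 0 1)) (surface M) \<phi>"
    "homeomorphic_map (top_of_set (ball 0 1)) (subtopology (surface M) F) \<phi>"
    "\<forall>k<length w. case w ! k of (v, e) \<Rightarrow>
        v \<in> verts M \<and> e \<in> edges M \<and>
        \<phi> (cis (2 * pi * real k / real (length w))) = vpos M v \<and>
        inj_on \<phi> (side (length w) k) \<and>
        \<phi> ` side (length w) k = edge_points M e"
    using assms(2) unfolding boundary_walk_def by auto
  then have "parametrized_face M F w \<phi>" using assms(1) ne is_map unfolding parametrized_face_def parametrized_face_axioms_def embedded_map_def by blast
  then show ?thesis by (rule that)
qed

text \<open>The homeomorphism behind a symmetry preserves the skeleton and hence permutes the faces.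
  Composed with the parametrization of \<open>F\<close>, it parametrizes the image face along the
  relabelled walk.\<close>

lemma symmetry_boundary_walk:
  assumes "(\<alpha>, \<beta>) \<in> symmetries M" "F \<in> faces M" "boundary_walk M F w"
  obtains G where "G \<in> faces M" "boundary_walk M G (map (map_prod \<alpha> \<beta>) w)"
proof -
  obtain h where aut: "skeleton_automorphism M (\<alpha>, \<beta>)"
    and h: "homeomorphic_map (surface M) (surface M) h"
    and hv: "\<And>v. v \<in> verts M \<Longrightarrow> h (vpos M v) = vpos M (\<alpha> v)"
    and he: "\<And>e. e \<in> edges M \<Longrightarrow> h ` edge_points M e = edge_points M (\<beta> e)"
    using assms(1) by (auto simp: symmetries_def)
  let ?X = "surface M" and ?S = "skeleton_points M"
  have \<alpha>: "\<alpha> ` verts M = verts M" and \<beta>: "\<beta> ` edges M = edges M"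
    using aut by (auto simp: skeleton_automorphism_def bij_betw_def)
  have hV: "h ` vpos M ` verts M = vpos M ` verts M"
  proof -
    have "h ` vpos M ` verts M = vpos M ` \<alpha> ` verts M" using hv by (force simp: image_iff)
    then show ?thesis by (simp only: \<alpha>)
  qed
  have hE: "h ` (\<Union>e\<in>edges M. edge_points M e) = (\<Union>e\<in>edges M. edge_points M e)"
  proof -
    have "h ` (\<Union>e\<in>edges M. edge_points M e) = (\<Union>e\<in>edges M. edge_points M (\<beta> e))"
      unfolding image_UN by (rule SUP_cong[OF refl he])
    also have "\<dots> = (\<Union>e\<in>\<beta> ` edges M. edge_points M e)" by blast
    finally show ?thesis by (simp only: \<beta>)
  qed
  have hS: "h ` ?S = ?S" by (simp only: skeleton_points_def image_Un hV hE)
  have hX: "h ` topspace ?X = topspace ?X" and hinj: "inj_on h (topspace ?X)"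
    using h by (auto simp: homeomorphic_eq_everything_map)
  have Stop: "?S \<subseteq> topspace ?X"
    using vpos_in compactin_subset_topspace[OF compactin_edge] unfolding skeleton_points_def by blast
  have "h ` (topspace ?X - ?S) = topspace ?X - ?S"
    using inj_on_image_set_diff[OF hinj, of "topspace ?X" ?S] hX hS Stop by simp
  then have "homeomorphic_map (subtopology ?X (topspace ?X - ?S)) (subtopology ?X (topspace ?X - ?S)) h"
    by (intro homeomorphic_map_subtopologies[OF h]) (simp add: Int_absorb1 Diff_subset)
  then have "faces M = image h ` faces M"
    unfolding faces_def by (rule homeomorphic_map_connected_components_of)
  then have G: "h ` F \<in> faces M" using assms(2) by blast
  obtain \<phi> where cont: "continuous_map (top_of_set (cball 0 1)) ?X \<phi>"
    and hom: "homeomorphic_map (top_of_set (ball 0 1)) (subtopology ?X F) \<phi>"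
    and walk: "if w = [] then \<exists>v\<in>verts M. \<forall>z\<in>sphere 0 1. \<phi> z = vpos M v
      else \<forall>k<length w. case w ! k of (v, e) \<Rightarrow>
        v \<in> verts M \<and> e \<in> edges M \<and>
        \<phi> (cis (2 * pi * real k / real (length w))) = vpos M v \<and>
        inj_on \<phi> (side (length w) k) \<and>
        \<phi> ` side (length w) k = edge_points M e"
    using assms(3) unfolding boundary_walk_def by blast
  have "homeomorphic_map (subtopology ?X F) (subtopology ?X (h ` F)) h"
  proof (rule homeomorphic_map_subtopologies[OF h])
    have "F \<subseteq> topspace ?X" using face_subset[OF assms(2)] by blast
    then show "h ` (topspace ?X \<inter> F) = topspace ?X \<inter> h ` F" using hX by blast
  qed
  then have hom': "homeomorphic_map (top_of_set (ball 0 1)) (subtopology ?X (h ` F)) (h \<circ> \<phi>)"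
    by (rule homeomorphic_map_compose[OF hom])
  have cont': "continuous_map (top_of_set (cball 0 1)) ?X (h \<circ> \<phi>)"
    using continuous_map_compose[OF cont] h homeomorphic_imp_continuous_map by blast
  have "boundary_walk M (h ` F) (map (map_prod \<alpha> \<beta>) w)"
    unfolding boundary_walk_def
  proof (intro exI[of _ "h \<circ> \<phi>"] conjI cont' hom')
    show "if map (map_prod \<alpha> \<beta>) w = [] then \<exists>v\<in>verts M. \<forall>z\<in>sphere 0 1. (h \<circ> \<phi>) z = vpos M v
      else \<forall>k<length (map (map_prod \<alpha> \<beta>) w). case map (map_prod \<alpha> \<beta>) w ! k of (v, e) \<Rightarrow>
        v \<in> verts M \<and> e \<in> edges M \<and>
        (h \<circ> \<phi>) (cis (2 * pi * real k / real (length (map (map_prod \<alpha> \<beta>) w)))) = vpos M v \<and>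
        inj_on (h \<circ> \<phi>) (side (length (map (map_prod \<alpha> \<beta>) w)) k) \<and>
        (h \<circ> \<phi>) ` side (length (map (map_prod \<alpha> \<beta>) w)) k = edge_points M e"
    proof (cases "w = []")
      case True
      then obtain v where "v \<in> verts M" "\<forall>z\<in>sphere 0 1. \<phi> z = vpos M v" using walk by auto
      then have "\<alpha> v \<in> verts M" "\<forall>z\<in>sphere 0 1. (h \<circ> \<phi>) z = vpos M (\<alpha> v)" using \<alpha> hv by auto
      then show ?thesis using True by auto
    next
      case False
      have "\<alpha> v \<in> verts M \<and> \<beta> e \<in> edges M \<and>
        (h \<circ> \<phi>) (cis (2 * pi * real k / real (length w))) = vpos M (\<alpha> v) \<and>
        inj_on (h \<circ> \<phi>) (side (length w) k) \<and>
        (h \<circ> \<phi>) ` side (length w) k = edge_points M (\<beta> e)"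
        if k: "k < length w" "w ! k = (v, e)" for k v e
      proof -
        have *: "v \<in> verts M" "e \<in> edges M" "\<phi> (cis (2 * pi * real k / real (length w))) = vpos M v"
          "inj_on \<phi> (side (length w) k)" "\<phi> ` side (length w) k = edge_points M e"
          using spec[OF walk[unfolded if_not_P[OF False]], of k] k by (simp_all only: prod.case simp_thms)
        have "inj_on h (\<phi> ` side (length w) k)"
          using inj_on_subset[OF hinj] compactin_subset_topspace[OF compactin_edge[OF *(2)]] *(5) by simp
        then have "inj_on (h \<circ> \<phi>) (side (length w) k)" using *(4) by (rule comp_inj_on[rotated])
        moreover have "(h \<circ> \<phi>) ` side (length w) k = edge_points M (\<beta> e)"
          using *(5) he[OF *(2)] by (metis image_comp)
        ultimately show ?thesis using * \<alpha> \<beta> hv by auto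
      qed
      then have "case map (map_prod \<alpha> \<beta>) w ! k of (v, e) \<Rightarrow>
          v \<in> verts M \<and> e \<in> edges M \<and>
          (h \<circ> \<phi>) (cis (2 * pi * real k / real (length w))) = vpos M v \<and>
          inj_on (h \<circ> \<phi>) (side (length w) k) \<and>
          (h \<circ> \<phi>) ` side (length w) k = edge_points M e" if "k < length w" for k
        using that by (cases "w ! k") (simp only: nth_map map_prod_simp prod.case)
      then show ?thesis using False by (simp only: length_map map_is_Nil_conv if_False simp_thms) blast
    qed
  qed
  then show ?thesis using that G by blast
qed

end

subsection \<open>The two sides of an edge\<close>

lemma sector_scale: "z \<in> sector p k \<Longrightarrow> 0 < r \<Longrightarrow> of_real r * z \<in> sector p k"
proof -
  assume "z \<in> sector p k" "0 < r"
  then obtain s t where "z = of_real s * circ p t" "0 < s" "real k < t" "t < real k + 1"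
    by (auto simp: sector_def)
  then have "of_real r * z = of_real (r * s) * circ p t" "0 < r * s"
    using \<open>0 < r\<close> by auto
  then show ?thesis using \<open>real k < t\<close> \<open>t < real k + 1\<close> unfolding sector_def by blast
qed

context parametrized_face
begin

text \<open>A continuous injection of the compact side into a Hausdorff space is an embedding. Its
  inverse turns the parametrization of the edge into one of the open side, in one direction or the
  other.\<close>

lemma side_coordinate:
  assumes k: "k < p"
  obtains \<gamma> where "continuous_on {0<..<1} \<gamma>" "inj_on \<gamma> {0<..<1}"
    "\<And>t. t \<in> {0<..<1} \<Longrightarrow> \<gamma> t \<in> sector p k \<inter> sphere 0 1"
    "\<And>t. t \<in> {0<..<1} \<Longrightarrow> \<phi> (\<gamma> t) = epath M (E k) t"
proof -
  let ?X = "surface M" and ?e = "E k"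
  have "continuous_map (top_of_set (side p k)) ?X \<phi>"
    by (rule continuous_map_from_subtopology_mono[OF cont])
      (metis side_subset_sphere sphere_cball subset_trans)
  then have "embedding_map (top_of_set (side p k)) ?X \<phi>"
    using Hausdorff inj_side[OF k] by (intro continuous_imp_embedding_map) (auto simp: compact_space_subtopology)
  then have "homeomorphic_map (top_of_set (side p k)) (subtopology ?X (edge_points M ?e)) \<phi>"
    using image_side[OF k] by (simp add: embedding_map_def)
  then obtain \<delta> where "homeomorphic_maps (top_of_set (side p k)) (subtopology ?X (edge_points M ?e)) \<phi> \<delta>"
    unfolding homeomorphic_map_maps by blast
  moreover have top: "topspace (subtopology ?X (edge_points M ?e)) = edge_points M ?e"
    using compactin_subset_topspace[OF compactin_edge[OF E_in[OF k]]] by (simp add: Int_absorb1)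
  ultimately have c\<delta>: "continuous_map (subtopology ?X (edge_points M ?e)) (top_of_set (side p k)) \<delta>"
    and \<phi>\<delta>: "\<And>x. x \<in> edge_points M ?e \<Longrightarrow> \<phi> (\<delta> x) = x"
    by (auto simp: homeomorphic_maps_def)
  have \<delta>side: "\<delta> x \<in> side p k" if "x \<in> edge_points M ?e" for x
    using continuous_map_image_subset_topspace[OF c\<delta>] that top by auto
  define \<gamma> where "\<gamma> = \<delta> \<circ> epath M ?e"
  have on_edge: "epath M ?e t \<in> edge_points M ?e" if "t \<in> {0<..<1}" for t using that by auto
  show ?thesis
  proof (rule that[of \<gamma>])
    have "continuous_map (top_of_set {0<..<1}) ?X (epath M ?e)"
      by (rule continuous_map_from_subtopology_mono[OF continuous_epath[OF E_in[OF k]]]) auto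
    then have "continuous_map (top_of_set {0<..<1}) (subtopology ?X (edge_points M ?e)) (epath M ?e)"
      by (auto simp: continuous_map_in_subtopology)
    from continuous_map_compose[OF this c\<delta>] show "continuous_on {0<..<1} \<gamma>"
      by (simp add: continuous_map_in_subtopology \<gamma>_def)
    show val: "\<phi> (\<gamma> t) = epath M ?e t" if "t \<in> {0<..<1}" for t
      using \<phi>\<delta> on_edge[OF that] by (simp add: \<gamma>_def)
    show "inj_on \<gamma> {0<..<1}"
    proof (rule inj_onI)
      fix s t :: real assume st: "s \<in> {0<..<1}" "t \<in> {0<..<1}" "\<gamma> s = \<gamma> t"
      then have "epath M ?e s = epath M ?e t" using val by metis
      then show "s = t" using st(1,2) by (intro inj_onD[OF inj_epath[OF E_in[OF k]]]) auto
    qed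
    show "\<gamma> t \<in> sector p k \<inter> sphere 0 1" if "t \<in> {0<..<1}" for t
    proof -
      have \<gamma>s: "\<gamma> t \<in> side p k" using \<delta>side on_edge[OF that] by (simp add: \<gamma>_def)
      have "\<phi> (\<gamma> t) \<in> edge_interior M ?e" using val[OF that] that by simp
      then have "\<phi> (\<gamma> t) \<notin> vpos M ` verts M" using edge_interior_not_vertex[OF E_in[OF k]] by blast
      moreover have "(k + 1) mod p < p" using p_pos by (rule mod_less_divisor)
      ultimately have "\<gamma> t \<noteq> circ p (real k)" "\<gamma> t \<noteq> circ p (real k + 1)"
        using at_corner[OF k] at_next_corner[OF k] V_in k by auto
      then show ?thesis using \<gamma>s by (auto simp: side_eq)
    qed
  qed
qed

text \<open>The polar region between the open side and the centre of the disk, with the coordinate along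
  the side taken from the edge, so that the strips on the two sides of an edge fit together.\<close>

lemma half_strip:
  assumes k: "k < p"
  obtains H where "continuous_map (top_of_set {z. 0 < Re z \<and> Re z < 1 \<and> 0 \<le> Im z \<and> Im z < 1}) (surface M) H"
    "inj_on H {z. 0 < Re z \<and> Re z < 1 \<and> 0 \<le> Im z \<and> Im z < 1}"
    "\<And>z. 0 < Re z \<Longrightarrow> Re z < 1 \<Longrightarrow> Im z = 0 \<Longrightarrow> H z = epath M (E k) (Re z)"
    "\<And>z. 0 < Re z \<Longrightarrow> Re z < 1 \<Longrightarrow> 0 < Im z \<Longrightarrow> Im z < 1 \<Longrightarrow> H z \<in> \<phi> ` (sector p k \<inter> ball 0 1)"
proof -
  obtain \<gamma> where c\<gamma>: "continuous_on {0<..<1} \<gamma>" and inj\<gamma>: "inj_on \<gamma> {0<..<1}"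
    and sec: "\<And>t. t \<in> {0<..<1} \<Longrightarrow> \<gamma> t \<in> sector p k \<inter> sphere 0 1"
    and val: "\<And>t. t \<in> {0<..<1} \<Longrightarrow> \<phi> (\<gamma> t) = epath M (E k) t"
    by (rule side_coordinate[OF k]) (rule that)
  let ?D = "{z. 0 < Re z \<and> Re z < 1 \<and> 0 \<le> Im z \<and> Im z < 1}"
  \<comment> \<open>Polar coordinates: the height \<open>Im z\<close> is the distance from the
    circle, and heights below 1 avoid the centre, where the angular coordinate is lost.\<close>
  define P where "P z = of_real (1 - Im z) * \<gamma> (Re z)" for z
  have nP: "cmod (P z) = 1 - Im z" if "z \<in> ?D" for z
  proof -
    have "cmod (\<gamma> (Re z)) = 1" using sec[of "Re z"] that by auto
    then show ?thesis using that unfolding P_def norm_mult norm_of_real by simp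
  qed
  have Psec: "P z \<in> sector p k" if "z \<in> ?D" for z
    using sec[of "Re z"] that unfolding P_def by (intro sector_scale) auto
  have "continuous_on ?D P"
    unfolding P_def by (intro continuous_intros continuous_on_compose2[OF c\<gamma>]) auto
  moreover have "P ` ?D \<subseteq> cball 0 1" using nP by auto
  ultimately have "continuous_map (top_of_set ?D) (top_of_set (cball 0 1)) P"
    by (auto simp: continuous_map_in_subtopology)
  from continuous_map_compose[OF this cont]
  have "continuous_map (top_of_set ?D) (surface M) (\<phi> \<circ> P)" .
  moreover have "inj_on (\<phi> \<circ> P) ?D"
  proof (rule inj_onI)
    fix x y assume xy: "x \<in> ?D" "y \<in> ?D" "(\<phi> \<circ> P) x = (\<phi> \<circ> P) y"
    have "P z \<in> ball 0 1 \<union> (sector p k \<inter> sphere 0 1)" if "z \<in> ?D" for z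
      using nP[OF that] Psec[OF that] that by auto
    then have "P x = P y" using xy by (intro inj_onD[OF inj_on_ball_sector[OF k]]) auto
    then have im: "Im x = Im y" using nP[OF xy(1)] nP[OF xy(2)] by simp
    have "of_real (1 - Im x) \<noteq> (0::complex)" using xy(1) by (simp only: of_real_eq_0_iff mem_Collect_eq) linarith
    then have "\<gamma> (Re x) = \<gamma> (Re y)" using \<open>P x = P y\<close> im unfolding P_def by (metis mult_cancel_left)
    then have "Re x = Re y" using xy(1,2) by (intro inj_onD[OF inj\<gamma>]) auto
    then show "x = y" using im by (simp add: complex_eq_iff)
  qed
  moreover have "(\<phi> \<circ> P) z = epath M (E k) (Re z)" if "0 < Re z" "Re z < 1" "Im z = 0" for z
    using val[of "Re z"] that by (simp add: P_def)
  moreover have "(\<phi> \<circ> P) z \<in> \<phi> ` (sector p k \<inter> ball 0 1)" if "0 < Re z" "Re z < 1" "0 < Im z" "Im z < 1" for z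
  proof -
    have "z \<in> ?D" using that by simp
    then have "P z \<in> sector p k \<inter> ball 0 1" using Psec nP that by auto
    then show ?thesis by simp
  qed
  ultimately show ?thesis by (rule that)
qed

end

section \<open>Half disks attached along the sides of an edge\<close>

locale parametrized_map = embedded_map M for M :: "('v, 'e, 'a) drawing" +
  fixes W :: "'a set \<Rightarrow> ('v \<times> 'e) list" and \<Phi> :: "'a set \<Rightarrow> complex \<Rightarrow> 'a"
  assumes param: "\<And>F. F \<in> faces M \<Longrightarrow> parametrized_face M F (W F) (\<Phi> F)"
begin

text \<open>A side is an occurrence of the edge in a walk, so that an edge met twice by one face has
  two sides in that face.\<close>

definition sides :: "'e \<Rightarrow> ('a set \<times> nat) set" where
  "sides e = {(F, k). F \<in> faces M \<and> k < length (W F) \<and> snd (W F ! k) = e}"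

text \<open>Only the sector behind the side is taken, not the whole face; this keeps two sides of an
  edge apart even when they belong to the same face.\<close>

definition piece :: "'a set \<times> nat \<Rightarrow> 'a set" where
  "piece s = \<Phi> (fst s) ` (sector (length (W (fst s))) (snd s) \<inter> ball 0 1)"

lemma piece_subset: "s \<in> sides e \<Longrightarrow> piece s \<subseteq> fst s"
  using parametrized_face.image_ball[OF param] by (fastforce simp: piece_def sides_def)

lemma piece_disjoint:
  assumes "s \<in> sides e" "t \<in> sides e" "s \<noteq> t" shows "piece s \<inter> piece t = {}"
proof (cases "fst s = fst t")
  case False
  have "fst s \<in> faces M" "fst t \<in> faces M" using assms by (auto simp: sides_def)
  then have "fst s \<inter> fst t = {}" using False faces_disjoint by blast
  then show ?thesis using piece_subset[OF assms(1)] piece_subset[OF assms(2)] by blast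
next
  case True
  then obtain F j k where st: "s = (F, j)" "t = (F, k)" "j \<noteq> k" using assms(3) by (metis prod.collapse)
  then have F: "F \<in> faces M" "j < length (W F)" "k < length (W F)" using assms by (auto simp: sides_def)
  interpret parametrized_face M F "W F" "\<Phi> F" by (rule param[OF F(1)])
  have "sector p j \<inter> sector p k = {}" using sector_disjoint F st(3) by blast
  moreover have "sector p j \<inter> ball 0 1 \<subseteq> ball 0 1" "sector p k \<inter> ball 0 1 \<subseteq> ball 0 1" by auto
  ultimately show ?thesis
    unfolding piece_def st fst_conv snd_conv
    using inj_on_image_Int[OF inj_ball, of "sector p j \<inter> ball 0 1" "sector p k \<inter> ball 0 1"] by blast
qed

lemma piece_edge: "s \<in> sides e \<Longrightarrow> e' \<in> edges M \<Longrightarrow> piece s \<inter> edge_interior M e' = {}"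
  using piece_subset[of s e] face_subset[of "fst s"] edge_in_skeleton[of e'] edge_points_eq[of e']
  by (fastforce simp: sides_def)

lemma sides_edge: "s \<in> sides e \<Longrightarrow> e \<in> edges M"
  using parametrized_face.E_in[OF param] by (auto simp: sides_def)

lemma half_strip_side:
  assumes "s \<in> sides e"
  obtains H where "continuous_map (top_of_set {z. 0 < Re z \<and> Re z < 1 \<and> 0 \<le> Im z \<and> Im z < 1}) (surface M) H"
    "inj_on H {z. 0 < Re z \<and> Re z < 1 \<and> 0 \<le> Im z \<and> Im z < 1}"
    "\<And>z. 0 < Re z \<Longrightarrow> Re z < 1 \<Longrightarrow> Im z = 0 \<Longrightarrow> H z = epath M e (Re z)"
    "\<And>z. 0 < Re z \<Longrightarrow> Re z < 1 \<Longrightarrow> 0 < Im z \<Longrightarrow> Im z < 1 \<Longrightarrow> H z \<in> piece s"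
proof -
  obtain F k where s: "s = (F, k)" "F \<in> faces M" "k < length (W F)" "snd (W F ! k) = e"
    using assms by (auto simp: sides_def)
  interpret parametrized_face M F "W F" "\<Phi> F" by (rule param[OF s(2)])
  obtain H where H: "continuous_map (top_of_set {z. 0 < Re z \<and> Re z < 1 \<and> 0 \<le> Im z \<and> Im z < 1}) (surface M) H"
    "inj_on H {z. 0 < Re z \<and> Re z < 1 \<and> 0 \<le> Im z \<and> Im z < 1}"
    "\<And>z. 0 < Re z \<Longrightarrow> Re z < 1 \<Longrightarrow> Im z = 0 \<Longrightarrow> H z = epath M (E k) (Re z)"
    "\<And>z. 0 < Re z \<Longrightarrow> Re z < 1 \<Longrightarrow> 0 < Im z \<Longrightarrow> Im z < 1 \<Longrightarrow> H z \<in> \<Phi> F ` (sector p k \<inter> ball 0 1)"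
    by (rule half_strip[OF s(3)]) (rule that)
  show ?thesis
    by (rule that[OF H(1,2)]) (simp_all only: H(3) s(4), simp only: H(4) piece_def s(1) fst_conv snd_conv)
qed

lemma two_sides_open:
  assumes a: "a \<in> sides e" and b: "b \<in> sides e" and "a \<noteq> b"
  obtains N where "openin (surface M) N" "edge_interior M e \<subseteq> N" "N \<subseteq> edge_interior M e \<union> piece a \<union> piece b"
proof -
  let ?D = "{z. 0 < Re z \<and> Re z < 1 \<and> 0 \<le> Im z \<and> Im z < 1}"
  let ?D' = "{z. 0 < Re z \<and> Re z < 1 \<and> - 1 < Im z \<and> Im z < 1}"
  have e: "e \<in> edges M" using sides_edge[OF a] .
  obtain H where cH: "continuous_map (top_of_set ?D) (surface M) H" and iH: "inj_on H ?D"
    and H0: "\<And>z. 0 < Re z \<Longrightarrow> Re z < 1 \<Longrightarrow> Im z = 0 \<Longrightarrow> H z = epath M e (Re z)"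
    and H1: "\<And>z. 0 < Re z \<Longrightarrow> Re z < 1 \<Longrightarrow> 0 < Im z \<Longrightarrow> Im z < 1 \<Longrightarrow> H z \<in> piece a"
    by (rule half_strip_side[OF a]) (rule that)
  obtain K where cK: "continuous_map (top_of_set ?D) (surface M) K" and iK: "inj_on K ?D"
    and K0: "\<And>z. 0 < Re z \<Longrightarrow> Re z < 1 \<Longrightarrow> Im z = 0 \<Longrightarrow> K z = epath M e (Re z)"
    and K1: "\<And>z. 0 < Re z \<Longrightarrow> Re z < 1 \<Longrightarrow> 0 < Im z \<Longrightarrow> Im z < 1 \<Longrightarrow> K z \<in> piece b"
    by (rule half_strip_side[OF b]) (rule that)
  \<comment> \<open>The second strip is reflected into the lower half plane. On the real axis both
    strips are given by \<open>epath M e\<close>, so they fit together continuously.\<close>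
  define Q where "Q z = (if 0 \<le> Im z then H z else K (cnj z))" for z
  have "open ?D'"
  proof -
    have "?D' = {z. 0 < Re z} \<inter> {z. Re z < 1} \<inter> {z. - 1 < Im z} \<inter> {z. Im z < 1}" by blast
    then show ?thesis
      by (simp only:) (intro open_Int open_halfspace_Re_gt open_halfspace_Re_lt open_halfspace_Im_gt open_halfspace_Im_lt)
  qed
  moreover have "continuous_map (top_of_set ?D') (surface M) Q"
    unfolding Q_def
  proof (rule continuous_map_cases_le)
    show "continuous_map (subtopology (top_of_set ?D') {z \<in> topspace (top_of_set ?D'). 0 \<le> Im z}) (surface M) H"
      unfolding subtopology_subtopology
      by (rule continuous_map_from_subtopology_mono[OF cH]) auto
    have "continuous_map (subtopology (top_of_set ?D') {z \<in> topspace (top_of_set ?D'). Im z \<le> 0}) (top_of_set ?D) cnj"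
      unfolding subtopology_subtopology by (auto simp: continuous_map_in_subtopology intro!: continuous_intros)
    from continuous_map_compose[OF this cK]
    show "continuous_map (subtopology (top_of_set ?D') {z \<in> topspace (top_of_set ?D'). Im z \<le> 0}) (surface M) (\<lambda>z. K (cnj z))"
      by (simp add: o_def)
    show "H z = K (cnj z)" if "z \<in> topspace (top_of_set ?D')" "0 = Im z" for z
      using that H0[of z] K0[of "cnj z"] by simp
  qed (auto intro!: continuous_intros)
  moreover have Qa: "Q z \<in> edge_interior M e \<union> piece a" if "z \<in> ?D'" "0 \<le> Im z" for z
  proof (cases "Im z = 0")
    case True
    then show ?thesis using H0[of z] that by (simp add: Q_def)
  next
    case False
    then show ?thesis using H1[of z] that by (simp add: Q_def)
  qed
  moreover have Qb: "Q z \<in> piece b" if "z \<in> ?D'" "Im z < 0" for z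
    using K1[of "cnj z"] that by (simp add: Q_def)
  moreover have "inj_on Q ?D'"
  proof (rule inj_onI)
    fix x y assume x: "x \<in> ?D'" and y: "y \<in> ?D'" and eq: "Q x = Q y"
    \<comment> \<open>Disjointness of the pieces makes the image reveal in which half the point
      lies.\<close>
    have "piece b \<inter> (edge_interior M e \<union> piece a) = {}"
      using piece_disjoint[OF a b] \<open>a \<noteq> b\<close> piece_edge[OF b e] by blast
    then have iff: "0 \<le> Im x \<longleftrightarrow> 0 \<le> Im y"
      using Qa[OF x] Qb[OF x] Qa[OF y] Qb[OF y] eq by (metis IntI emptyE not_le)
    show "x = y"
    proof (cases "0 \<le> Im x")
      case True
      then show ?thesis using iff eq x y by (intro inj_onD[OF iH]) (auto simp: Q_def)
    next
      case False
      then have "cnj x = cnj y" using iff eq x y by (intro inj_onD[OF iK]) (auto simp: Q_def)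
      then show ?thesis by simp
    qed
  qed
  ultimately have "openin (surface M) (Q ` ?D')" "Q ` ?D' \<subseteq> edge_interior M e \<union> piece a \<union> piece b"
    using invariance_of_domain_into_surface[OF surface, of ?D' Q] by (simp, force)
  moreover have "edge_interior M e \<subseteq> Q ` ?D'"
  proof
    fix x assume "x \<in> edge_interior M e"
    then obtain t where "0 < t" "t < 1" "x = epath M e t" by auto
    then have "Complex t 0 \<in> ?D'" "x = Q (Complex t 0)" using H0[of "Complex t 0"] by (auto simp: Q_def)
    then show "x \<in> Q ` ?D'" by blast
  qed
  ultimately show ?thesis using that by blast
qed

text \<open>The third half disk has points arbitrarily close to the edge. They enter the open set
  \<open>N\<close> around the edge, although \<open>N\<close> consists only of points of the edge
  and of the other two pieces.\<close>

lemma no_three_sides: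
  assumes "a \<in> sides e" "b \<in> sides e" "c \<in> sides e" "a \<noteq> b" "a \<noteq> c" "b \<noteq> c"
  shows False
proof -
  obtain N where N: "openin (surface M) N" "edge_interior M e \<subseteq> N" "N \<subseteq> edge_interior M e \<union> piece a \<union> piece b"
    by (rule two_sides_open[OF assms(1,2,4)]) (rule that)
  let ?D = "{z. 0 < Re z \<and> Re z < 1 \<and> 0 \<le> Im z \<and> Im z < 1}"
  obtain H where cH: "continuous_map (top_of_set ?D) (surface M) H"
    and H0: "\<And>z. 0 < Re z \<Longrightarrow> Re z < 1 \<Longrightarrow> Im z = 0 \<Longrightarrow> H z = epath M e (Re z)"
    and H1: "\<And>z. 0 < Re z \<Longrightarrow> Re z < 1 \<Longrightarrow> 0 < Im z \<Longrightarrow> Im z < 1 \<Longrightarrow> H z \<in> piece c"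
    by (rule half_strip_side[OF assms(3)]) (rule that)
  have op: "openin (top_of_set ?D) {z \<in> ?D. H z \<in> N}"
    using openin_continuous_map_preimage[OF cH N(1)] by simp
  have "Complex (1/2) 0 \<in> {z \<in> ?D. H z \<in> N}" using H0[of "Complex (1/2) 0"] N(2) by auto
  then obtain d where d: "0 < d" "ball (Complex (1/2) 0) d \<inter> ?D \<subseteq> {z \<in> ?D. H z \<in> N}"
    using op unfolding openin_contains_ball by blast
  \<comment> \<open>A height below 1 stays in the strip, and one below \<open>d\<close> stays in the
    ball.\<close>
  define s where "s = min (1/2) (d/2)"
  have s: "0 < s" "s < 1" "s < d" using d(1) by (auto simp: s_def min_def)
  let ?z = "Complex (1/2) s"
  have "dist (Complex (1/2) 0) ?z = s" using s by (simp add: dist_norm cmod_def)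
  then have "?z \<in> ball (Complex (1/2) 0) d \<inter> ?D" using s by simp
  then have "H ?z \<in> N" using d(2) by blast
  moreover have "H ?z \<in> piece c" using H1[of ?z] s by simp
  ultimately show False
    using N(3) piece_disjoint[OF assms(1,3,5)] piece_disjoint[OF assms(2,3,6)]
      piece_edge[OF assms(3) sides_edge[OF assms(1)]] by blast
qed

lemma finite_sides: "finite (sides e)" and card_sides_le: "card (sides e) \<le> 2"
proof -
  have "\<not> (T \<subseteq> sides e \<and> card T = 3)" for T
  proof
    assume T: "T \<subseteq> sides e \<and> card T = 3"
    then obtain a b c where abc: "T = {a, b, c}" "a \<noteq> b" "b \<noteq> c" "a \<noteq> c" unfolding card_3_iff by blast
    then have "a \<in> sides e" "b \<in> sides e" "c \<in> sides e" using T by blast+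
    then show False using no_three_sides abc(2-4) by blast
  qed
  then show "finite (sides e)" "card (sides e) \<le> 2"
    using infinite_arbitrarily_large[of "sides e" 3] obtain_subset_with_card_n[of 3 "sides e"]
    by (metis, metis Suc_leI not_le numeral_2_eq_2 numeral_3_eq_3)
qed

text \<open>Every face has a side on some edge, and each edge has finitely many sides. Finiteness
  makes the union of the closed disks of the faces a closed set, as the next arguments
  require.\<close>

lemma finite_faces: "finite (faces M)"
proof -
  have "faces M \<subseteq> fst ` (\<Union>e\<in>edges M. sides e)"
  proof
    fix F assume F: "F \<in> faces M"
    interpret parametrized_face M F "W F" "\<Phi> F" by (rule param[OF F])
    have "(F, 0) \<in> sides (E 0)" using F p_pos by (auto simp: sides_def)
    then show "F \<in> fst ` (\<Union>e\<in>edges M. sides e)" using E_in[OF p_pos] by force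
  qed
  then show ?thesis by (rule finite_subset) (intro finite_imageI finite_UN_I finite_edges finite_sides)
qed

lemma skeleton_edge_interior:
  assumes e: "e \<in> edges M" and y: "y \<in> skeleton_points M" "y \<notin> vpos M ` verts M"
    "y \<notin> (\<Union>e'\<in>edges M - {e}. edge_points M e')"
  shows "y \<in> edge_interior M e"
proof -
  have "y \<in> (\<Union>e'\<in>edges M. edge_points M e')" using y(1,2) unfolding skeleton_points_def by blast
  then have "y \<in> edge_points M e" using y(3) by blast
  then have "y \<in> edge_interior M e \<or> y \<in> vpos M ` ends M e" using edge_points_eq_ends[OF e] by blast
  then show ?thesis using ends_subset[OF e] y(2) by blast
qed

text \<open>Otherwise removing all closed disks, the vertices and the other edges would leave an
  open neighbourhood of \<open>x\<close> inside the edge. The coordinate along the edge would embed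
  this open subset of a surface in a line, against invariance of domain.\<close>

lemma edge_covered_by_disks:
  assumes e: "e \<in> edges M" and x: "x \<in> edge_interior M e"
  obtains F z where "F \<in> faces M" "z \<in> cball 0 1" "\<Phi> F z = x"
proof (rule ccontr)
  assume no: "\<not> thesis"
  let ?X = "surface M"
  define K where "K = (\<Union>F\<in>faces M. \<Phi> F ` cball 0 1) \<union> vpos M ` verts M \<union> (\<Union>e'\<in>edges M - {e}. edge_points M e')"
  have "closedin ?X (\<Phi> F ` cball 0 1)" if "F \<in> faces M" for F
    using parametrized_face.closedin_image[OF param[OF that]] by simp
  moreover have "closedin ?X (vpos M ` verts M)"
    using finite_verts vpos_in Hausdorff by (intro closedin_Hausdorff_finite) auto
  moreover have "closedin ?X (edge_points M e')" if "e' \<in> edges M" for e'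
    using compactin_imp_closedin[OF Hausdorff compactin_edge[OF that]] .
  ultimately have "closedin ?X K"
    unfolding K_def using finite_faces finite_edges by (intro closedin_Un closedin_Union) auto
  then have oV: "openin ?X (topspace ?X - K)" by blast
  let ?V = "topspace ?X - K"
  have Ve: "?V \<subseteq> edge_interior M e"
  proof
    fix y assume y: "y \<in> ?V"
    have "y \<notin> \<Union> (faces M)"
    proof
      assume "y \<in> \<Union> (faces M)"
      then obtain F where F: "F \<in> faces M" "y \<in> F" by blast
      then obtain z where "z \<in> ball 0 1" "y = \<Phi> F z" using parametrized_face.image_ball[OF param[OF F(1)]] by blast
      then have "y \<in> \<Phi> F ` cball 0 1" using ball_subset_cball by blast
      then show False using y F(1) unfolding K_def by blast
    qed
    then have "y \<in> skeleton_points M" using y Union_faces by blast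
    then show "y \<in> edge_interior M e" by (rule skeleton_edge_interior[OF e]) (use y in \<open>auto simp: K_def\<close>)
  qed
  have xV: "x \<in> ?V"
  proof -
    have "x \<in> topspace ?X"
      using compactin_subset_topspace[OF compactin_edge[OF e]] x edge_points_eq[of e] by blast
    moreover have "x \<notin> (\<Union>F\<in>faces M. \<Phi> F ` cball 0 1)" using no that by blast
    moreover have "x \<notin> vpos M ` verts M" using edge_interior_not_vertex[OF e] x by blast
    moreover have "x \<notin> (\<Union>e'\<in>edges M - {e}. edge_points M e')" using edge_interior_in_edge[OF e _ x] by blast
    ultimately show ?thesis unfolding K_def by blast
  qed
  obtain g where g: "continuous_map (subtopology ?X (edge_points M e)) euclideanreal g"
    and ge: "\<And>t. t \<in> {0..1} \<Longrightarrow> g (epath M e t) = t"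
    using edge_inverse[OF e] by metis
  have Ve': "?V \<subseteq> edge_points M e" using Ve edge_points_eq[of e] by blast
  have "continuous_map (subtopology ?X ?V) euclideanreal g"
    using continuous_map_from_subtopology_mono[OF g Ve'] .
  then have "continuous_map (subtopology ?X ?V) euclidean (\<lambda>y. complex_of_real (g y))"
    using continuous_map_compose[of "subtopology ?X ?V" euclideanreal g euclidean complex_of_real]
    by (auto simp: o_def intro!: continuous_intros)
  moreover have "inj_on (\<lambda>y. complex_of_real (g y)) ?V"
  proof (rule inj_onI)
    fix y y' assume "y \<in> ?V" "y' \<in> ?V" "complex_of_real (g y) = complex_of_real (g y')"
    then show "y = y'" using Ve' ge by (metis (no_types, lifting) imageE of_real_eq_iff subsetD)
  qed
  ultimately have "open ((\<lambda>y. complex_of_real (g y)) ` ?V)"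
    using invariance_of_domain_from_surface[OF surface oV] by blast
  moreover have "complex_of_real (g x) \<in> (\<lambda>y. complex_of_real (g y)) ` ?V" using xV by blast
  ultimately obtain d where d: "0 < d" "ball (complex_of_real (g x)) d \<subseteq> (\<lambda>y. complex_of_real (g y)) ` ?V"
    using openE by blast
  \<comment> \<open>A point of the ball off the real line, which the real-valued coordinate cannot
    reach.\<close>
  have "complex_of_real (g x) + \<i> * of_real (d / 2) \<in> ball (complex_of_real (g x)) d"
    using d(1) by (simp add: dist_norm norm_mult)
  then obtain y where "complex_of_real (g x) + \<i> * of_real (d / 2) = complex_of_real (g y)" using d(2) by blast
  then have "Im (complex_of_real (g x) + \<i> * of_real (d / 2)) = Im (complex_of_real (g y))" by (rule arg_cong)
  then show False using d(1) by simp
qed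

text \<open>If only one half disk were attached along an edge, its boundary points would have
  half-disk neighbourhoods.\<close>

lemma not_one_side:
  assumes e: "e \<in> edges M" shows "sides e \<noteq> {s}"
proof
  assume one: "sides e = {s}"
  let ?X = "surface M"
  obtain F k where s: "s = (F, k)" and F: "F \<in> faces M" and k: "k < length (W F)" and ek: "snd (W F ! k) = e"
  proof -
    have "s \<in> sides e" using one by simp
    then show ?thesis using that by (auto simp: sides_def)
  qed
  have uniq: "G = F \<and> j = k" if "G \<in> faces M" "j < length (W G)" "snd (W G ! j) = e" for G j
  proof -
    have "(G, j) \<in> sides e" using that by (simp add: sides_def)
    then show ?thesis using one s by simp
  qed
  interpret parametrized_face M F "W F" "\<Phi> F" by (rule param[OF F])
  \<comment> \<open>Removing \<open>K\<close> leaves only points reached from the sector at the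
    single side; the edge midpoint is among them.\<close>
  define K where "K = (\<Union>G\<in>faces M - {F}. \<Phi> G ` cball 0 1) \<union> vpos M ` verts M \<union>
    (\<Union>e'\<in>edges M - {e}. edge_points M e') \<union> \<Phi> F ` (cball 0 1 - sector p k)"
  have "closedin ?X (\<Phi> G ` cball 0 1)" if "G \<in> faces M" for G
    using parametrized_face.closedin_image[OF param[OF that]] by simp
  moreover have "closedin ?X (vpos M ` verts M)"
    using finite_verts vpos_in Hausdorff by (intro closedin_Hausdorff_finite) auto
  moreover have "closedin ?X (edge_points M e')" if "e' \<in> edges M" for e'
    using compactin_imp_closedin[OF Hausdorff compactin_edge[OF that]] .
  moreover have "closedin ?X (\<Phi> F ` (cball 0 1 - sector p k))"
    using open_sector[OF p_pos] by (intro closedin_image closed_Diff) auto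
  ultimately have "closedin ?X K"
    unfolding K_def using finite_faces finite_edges by (intro closedin_Un closedin_Union) auto
  then have oV: "openin ?X (topspace ?X - K)" by blast
  let ?V = "topspace ?X - K"
  have VF: "?V \<subseteq> \<Phi> F ` (cball 0 1 \<inter> sector p k)"
  proof
    fix y assume y: "y \<in> ?V"
    have "\<exists>G z. G \<in> faces M \<and> z \<in> cball 0 1 \<and> \<Phi> G z = y"
    proof (cases "y \<in> \<Union> (faces M)")
      case True
      then obtain G where G: "G \<in> faces M" "y \<in> G" by blast
      then obtain z where "z \<in> ball 0 1" "y = \<Phi> G z" using parametrized_face.image_ball[OF param[OF G(1)]] by blast
      then show ?thesis using G(1) ball_subset_cball by blast
    next
      case False
      then have "y \<in> skeleton_points M" using y Union_faces by blast
      then have "y \<in> edge_interior M e" by (rule skeleton_edge_interior[OF e]) (use y in \<open>auto simp: K_def\<close>)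
      then show ?thesis using edge_covered_by_disks[OF e] by metis
    qed
    then obtain G z where Gz: "G \<in> faces M" "z \<in> cball 0 1" "\<Phi> G z = y" by blast
    have "G = F" using Gz y unfolding K_def by blast
    moreover have "z \<in> sector p k"
    proof (rule ccontr)
      assume "z \<notin> sector p k"
      then have "y \<in> \<Phi> F ` (cball 0 1 - sector p k)" using Gz(2,3) \<open>G = F\<close> by blast
      then show False using y unfolding K_def by blast
    qed
    ultimately show "y \<in> \<Phi> F ` (cball 0 1 \<inter> sector p k)" using Gz(2,3) by blast
  qed
  define A where "A = {z \<in> cball 0 1. \<Phi> F z \<in> ?V}"
  have A: "A \<subseteq> ball 0 1 \<union> (sector p k \<inter> sphere 0 1)"
  proof
    fix z assume "z \<in> A"
    then have "z \<in> cball 0 1" "z \<in> sector p k" by (auto simp: A_def K_def)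
    then show "z \<in> ball 0 1 \<union> (sector p k \<inter> sphere 0 1)" by auto
  qed
  have imA: "\<Phi> F ` A = ?V" using VF by (auto simp: A_def)
  \<comment> \<open>\<open>A\<close> is the full preimage of the open set \<open>?V\<close>, so the
    restriction of the closed map is closed again and, being injective, a homeomorphism.\<close>
  have "closed_map (subtopology (top_of_set (cball 0 1)) A) (subtopology ?X ?V) (\<Phi> F)"
    by (rule closed_map_restriction[OF closed_map]) (simp add: A_def)
  moreover have topA: "subtopology (top_of_set (cball 0 1)) A = top_of_set A"
    unfolding subtopology_subtopology A_def by (rule arg_cong[of _ _ "subtopology euclidean"]) blast
  moreover have "continuous_map (top_of_set A) (subtopology ?X ?V) (\<Phi> F)"
  proof -
    have "continuous_map (top_of_set A) ?X (\<Phi> F)"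
      by (rule continuous_map_from_subtopology_mono[OF cont]) (auto simp: A_def)
    then show ?thesis using imA by (auto simp: continuous_map_in_subtopology)
  qed
  moreover have "inj_on (\<Phi> F) A" using inj_on_subset[OF inj_on_ball_sector[OF k] A] .
  ultimately have "homeomorphic_map (top_of_set A) (subtopology ?X ?V) (\<Phi> F)"
    using imA by (intro bijective_closed_imp_homeomorphic_map) (auto simp: Int_absorb1)
  then obtain g where "homeomorphic_maps (top_of_set A) (subtopology ?X ?V) (\<Phi> F) g"
    unfolding homeomorphic_map_maps by blast
  then have g: "homeomorphic_map (subtopology ?X ?V) (top_of_set A) g"
    using homeomorphic_maps_map homeomorphic_maps_sym by blast
  have "g ` ?V = A" "inj_on g ?V" "continuous_map (subtopology ?X ?V) euclidean g"
    using g by (auto simp: homeomorphic_eq_everything_map continuous_map_in_subtopology Int_absorb1)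
  then have "open A" using invariance_of_domain_from_surface[OF surface oV] by metis
  moreover have "A \<subseteq> cball 0 1" by (auto simp: A_def)
  \<comment> \<open>An open set inside the closed disk avoids the circle. Hence all of
    \<open>?V\<close> would lie in the face \<open>F\<close>, including the midpoint
    \<open>x\<close> of the edge.\<close>
  ultimately have Ab: "A \<subseteq> ball 0 1" using interior_maximal by (metis interior_cball)
  define x where "x = epath M e (1/2)"
  have x: "x \<in> edge_interior M e" by (simp add: x_def)
  have side_of: "G = F \<and> z \<in> sector p k" if Gz: "G \<in> faces M" "z \<in> cball 0 1" "\<Phi> G z = x" for G z
  proof -
    interpret G: parametrized_face M G "W G" "\<Phi> G" by (rule param[OF Gz(1)])
    obtain j where "j < G.p" "z \<in> sector G.p j" "G.E j = e"
      using G.edge_interior_preimage[OF Gz(2) e] Gz(3) x by blast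
    then show ?thesis using uniq[OF Gz(1)] by blast
  qed
  have "x \<in> ?V"
  proof -
    have "x \<in> topspace ?X"
      using compactin_subset_topspace[OF compactin_edge[OF e]] x edge_points_eq[of e] by blast
    moreover have "x \<notin> (\<Union>G\<in>faces M - {F}. \<Phi> G ` cball 0 1)" using side_of by blast
    moreover have "x \<notin> \<Phi> F ` (cball 0 1 - sector p k)" using side_of[OF F] by blast
    moreover have "x \<notin> vpos M ` verts M" using edge_interior_not_vertex[OF e] x by blast
    moreover have "x \<notin> (\<Union>e'\<in>edges M - {e}. edge_points M e')" using edge_interior_in_edge[OF e _ x] by blast
    ultimately show ?thesis unfolding K_def by blast
  qed
  then have "x \<in> \<Phi> F ` A" unfolding imA .
  then have "x \<in> F" using image_mono[OF Ab, of "\<Phi> F"] unfolding image_ball by (rule rev_subsetD)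
  then show False using face_subset[OF F] edge_in_skeleton[OF e] edge_points_eq[of e] x by blast
qed

lemma card_sides:
  assumes e: "e \<in> edges M" shows "card (sides e) = 2"
proof -
  have "epath M e (1/2) \<in> edge_interior M e" by simp
  then obtain F z where F: "F \<in> faces M" and z: "z \<in> cball 0 1" "\<Phi> F z \<in> edge_interior M e"
    using edge_covered_by_disks[OF e] by metis
  interpret parametrized_face M F "W F" "\<Phi> F" by (rule param[OF F])
  obtain k where "k < p" "E k = e" using edge_interior_preimage[OF z(1) e z(2)] by blast
  then have "(F, k) \<in> sides e" using F by (simp add: sides_def)
  then have "card (sides e) \<noteq> 0" using finite_sides by auto
  moreover have "card (sides e) \<noteq> 1" using not_one_side[OF e] by (auto simp: card_1_singleton_iff)
  ultimately show ?thesis using card_sides_le[of e] by linarith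
qed

end

subsection \<open>In-wedges and out-wedges\<close>

lemma Suc_mod_cancel: "0 < n \<Longrightarrow> Suc i mod n = Suc j mod n \<longleftrightarrow> i mod n = j mod n" for n :: nat
  by (auto simp: mod_Suc split: if_splits)

text \<open>Cyclic predecessors are written \<open>k + n - 1\<close> throughout, which avoids
  truncated subtraction at 0.\<close>

lemma Suc_pred_mod: "0 < n \<Longrightarrow> Suc (k + n - 1) mod n = k mod n" for n :: nat
  by simp

lemma walk_corner_Suc:
  "walk_corner w k = (fst (w ! (Suc k mod length w)), {snd (w ! k), snd (w ! (Suc k mod length w))})"
  by (simp add: walk_corner_def Let_def)

lemma corner_proper: "(v, {e, e'}) \<in> corners M \<Longrightarrow> e \<noteq> e'"
  by (auto simp: corners_def doubleton_eq_iff)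

section \<open>Transfer of wedges between two walks of one face\<close>

context two_parametrizations
begin

text \<open>Place \<open>k\<close> sits at the corner \<open>k + 1\<close>, so its counterpart is
  the predecessor of the matching \<open>\<kappa>\<close>-value. The sides \<open>\<pi>\<close>
  assigns to the two edges there both touch the matched corner; they are different since the edges
  of a corner are, so they are exactly the two sides at it.\<close>

lemma walk_corners_correspond:
  obtains \<kappa> \<pi> where
    "\<And>k. k < length w \<Longrightarrow> \<kappa> k < length w' \<and> \<pi> k < length w'"
    "\<And>k. k < length w \<Longrightarrow> snd (w' ! \<pi> k) = snd (w ! k)"
    "\<And>k. k < length w \<Longrightarrow> {\<kappa> k, \<kappa> (Suc k mod length w)} = {\<pi> k, Suc (\<pi> k) mod length w'}"
    "\<And>k j. k < length w \<Longrightarrow> j < length w' \<Longrightarrow> walk_corner w k \<in> corners M \<Longrightarrow>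
      Suc j mod length w' = \<kappa> (Suc k mod length w) \<Longrightarrow> walk_corner w' j = walk_corner w k"
proof -
  let ?p = "length w" and ?q = "length w'"
  obtain \<kappa> \<pi> where less: "\<And>k. k < ?p \<Longrightarrow> \<kappa> k < ?q \<and> \<pi> k < ?q"
    and \<kappa>: "\<And>k. k < ?p \<Longrightarrow> fst (w' ! \<kappa> k) = fst (w ! k)"
    and \<pi>: "\<And>k. k < ?p \<Longrightarrow> snd (w' ! \<pi> k) = snd (w ! k)"
    and ends': "\<And>k. k < ?p \<Longrightarrow> {\<kappa> k, \<kappa> ((k + 1) mod ?p)} = {\<pi> k, (\<pi> k + 1) mod ?q}"
    by (rule walks_correspond) (rule that)
  have ends: "{\<kappa> k, \<kappa> (Suc k mod ?p)} = {\<pi> k, Suc (\<pi> k) mod ?q}" if "k < ?p" for k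
    using ends'[OF that] by simp
  have "walk_corner w' j = walk_corner w k"
    if k: "k < ?p" and j: "j < ?q" and c: "walk_corner w k \<in> corners M" and eq: "Suc j mod ?q = \<kappa> (Suc k mod ?p)" for k j
  proof -
    let ?k = "Suc k mod ?p" and ?j = "Suc j mod ?q"
    have k': "?k < ?p" using A.p_pos by (rule mod_less_divisor)
    have "snd (w ! k) \<noteq> snd (w ! ?k)" using c unfolding walk_corner_Suc by (rule corner_proper)
    then have ne: "\<pi> k \<noteq> \<pi> ?k" using \<pi>[OF k] \<pi>[OF k'] by metis
    have pred_j: "i = j" if "i < ?q" "Suc i mod ?q = ?j" for i
      using that j Suc_mod_cancel[OF B.p_pos, of i j] by simp
    have at_j: "\<pi> i \<in> {j, ?j}" if i: "i < ?p" "?j \<in> {\<pi> i, Suc (\<pi> i) mod ?q}" for i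
    proof (cases "?j = \<pi> i")
      case False
      then have "Suc (\<pi> i) mod ?q = ?j" using i(2) by auto
      then show ?thesis using pred_j less[OF i(1)] by blast
    qed simp
    have a: "\<pi> k \<in> {j, ?j}" by (rule at_j[OF k]) (use ends[OF k] in \<open>simp only: eq, blast\<close>)
    have b: "\<pi> ?k \<in> {j, ?j}" by (rule at_j[OF k']) (use ends[OF k'] in \<open>simp only: eq, blast\<close>)
    have "{\<pi> k, \<pi> ?k} = {j, ?j}" using a b ne by auto
    then have "{snd (w' ! j), snd (w' ! ?j)} = {snd (w' ! \<pi> k), snd (w' ! \<pi> ?k)}" by (metis image_empty image_insert)
    also have "\<dots> = {snd (w ! k), snd (w ! ?k)}" using \<pi>[OF k] \<pi>[OF k'] by simp
    finally show ?thesis using \<kappa>[OF k'] unfolding walk_corner_Suc eq by simp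
  qed
  then show ?thesis using that[of \<kappa> \<pi>] less \<pi> ends by blast
qed

end

context embedded_map
begin

lemma walks_two_parametrizations:
  assumes "F \<in> faces M" "boundary_walk M F w" "boundary_walk M F w'" "edges M \<noteq> {}"
  obtains \<phi> \<psi> where "two_parametrizations M F w \<phi> w' \<psi>"
proof -
  obtain \<phi> where "parametrized_face M F w \<phi>" using boundary_walk_parametrization assms by metis
  moreover obtain \<psi> where "parametrized_face M F w' \<psi>" using boundary_walk_parametrization assms by metis
  ultimately show ?thesis using that by (simp add: two_parametrizations_def)
qed

lemma corner_transfer:
  assumes F: "F \<in> faces M" "boundary_walk M F w" "boundary_walk M F w'" "edges M \<noteq> {}"
    and k: "k < length w" and c: "walk_corner w k \<in> corners M"
  obtains j where "j < length w'" "walk_corner w' j = walk_corner w k"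
proof -
  obtain \<phi> \<psi> where "two_parametrizations M F w \<phi> w' \<psi>" by (rule walks_two_parametrizations[OF F])
  then interpret two_parametrizations M F w \<phi> w' \<psi> .
  let ?p = "length w" and ?q = "length w'"
  obtain \<kappa> \<pi> where less: "\<And>k. k < ?p \<Longrightarrow> \<kappa> k < ?q \<and> \<pi> k < ?q"
    and cor: "\<And>k j. k < ?p \<Longrightarrow> j < ?q \<Longrightarrow> walk_corner w k \<in> corners M \<Longrightarrow>
      Suc j mod ?q = \<kappa> (Suc k mod ?p) \<Longrightarrow> walk_corner w' j = walk_corner w k"
    by (rule walk_corners_correspond) (rule that)
  have m: "\<kappa> (Suc k mod ?p) < ?q" using less A.p_pos mod_less_divisor by blast
  define j where "j = (\<kappa> (Suc k mod ?p) + ?q - 1) mod ?q"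
  have "j < ?q" "Suc j mod ?q = \<kappa> (Suc k mod ?p)"
    using m B.p_pos unfolding j_def by (simp_all only: mod_less_divisor mod_Suc_eq Suc_pred_mod mod_less)
  then show ?thesis using that cor[OF k _ c] by blast
qed

text \<open>Used for two in-wedges separated by one edge: both the pair and the edge between survive
  the change of walk. The pair is unordered because the direction may be reversed.\<close>

lemma side_transfer:
  assumes F: "F \<in> faces M" "boundary_walk M F w" "boundary_walk M F w'" "edges M \<noteq> {}"
    and k: "k < length w" and c: "walk_corner w k \<in> corners M" "walk_corner w (Suc k mod length w) \<in> corners M"
  obtains j where "j < length w'" "snd (w' ! (Suc j mod length w')) = snd (w ! (Suc k mod length w))"
    "{walk_corner w' j, walk_corner w' (Suc j mod length w')} = {walk_corner w k, walk_corner w (Suc k mod length w)}"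
proof -
  obtain \<phi> \<psi> where "two_parametrizations M F w \<phi> w' \<psi>" by (rule walks_two_parametrizations[OF F])
  then interpret two_parametrizations M F w \<phi> w' \<psi> .
  let ?p = "length w" and ?q = "length w'"
  obtain \<kappa> \<pi> where less: "\<And>k. k < ?p \<Longrightarrow> \<kappa> k < ?q \<and> \<pi> k < ?q"
    and \<pi>: "\<And>k. k < length w \<Longrightarrow> snd (w' ! \<pi> k) = snd (w ! k)"
    and ends: "\<And>k. k < ?p \<Longrightarrow> {\<kappa> k, \<kappa> (Suc k mod ?p)} = {\<pi> k, Suc (\<pi> k) mod ?q}"
    and cor: "\<And>k j. k < ?p \<Longrightarrow> j < ?q \<Longrightarrow> walk_corner w k \<in> corners M \<Longrightarrow>
      Suc j mod ?q = \<kappa> (Suc k mod ?p) \<Longrightarrow> walk_corner w' j = walk_corner w k"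
    by (rule walk_corners_correspond) (rule that)
  let ?k = "Suc k mod ?p"
  have k': "?k < ?p" using A.p_pos by (rule mod_less_divisor)
  define j where "j = (\<pi> ?k + ?q - 1) mod ?q"
  have j: "j < ?q" "Suc j mod ?q = \<pi> ?k"
    using less[OF k'] B.p_pos unfolding j_def by (simp_all only: mod_less_divisor mod_Suc_eq Suc_pred_mod mod_less)
  have l: "\<pi> ?k < ?q" using less[OF k'] by blast
  \<comment> \<open>The two walks run along this side in the same direction or in opposite
    directions.\<close>
  consider "\<kappa> ?k = \<pi> ?k" "\<kappa> (Suc ?k mod ?p) = Suc (\<pi> ?k) mod ?q"
    | "\<kappa> ?k = Suc (\<pi> ?k) mod ?q" "\<kappa> (Suc ?k mod ?p) = \<pi> ?k"
    using ends[OF k'] unfolding doubleton_eq_iff by blast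
  then have "{walk_corner w' j, walk_corner w' (\<pi> ?k)} = {walk_corner w k, walk_corner w ?k}"
  proof cases
    case 1
    have "walk_corner w' j = walk_corner w k" by (rule cor[OF k j(1) c(1)]) (simp only: j(2) 1)
    moreover have "walk_corner w' (\<pi> ?k) = walk_corner w ?k" by (rule cor[OF k' l c(2)]) (simp only: 1)
    ultimately show ?thesis by simp
  next
    case 2
    have "walk_corner w' (\<pi> ?k) = walk_corner w k" by (rule cor[OF k l c(1)]) (simp only: 2)
    moreover have "walk_corner w' j = walk_corner w ?k" by (rule cor[OF k' j(1) c(2)]) (simp only: j(2) 2)
    ultimately show ?thesis by auto
  qed
  then show ?thesis using that[OF j(1)] \<pi>[OF k'] j(2) by metis
qed

end

section \<open>Chosen walks and the two places at a dart\<close>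

locale corneration_map = embedded_map M for M :: "('v, 'e, 'a) drawing" +
  fixes L :: "('v, 'e) corner set"
  assumes unambiguous: "wedges_unambiguous M"
    and corneration: "corneration M L"
    and transitive: "transitive M L"
    and L_wedges: "L \<subseteq> wedges M"
    and edges_nonempty: "edges M \<noteq> {}"
begin

definition W :: "'a set \<Rightarrow> ('v \<times> 'e) list" where
  "W F = (SOME w. boundary_walk M F w)"

lemma walk_W: "F \<in> faces M \<Longrightarrow> boundary_walk M F (W F)"
  unfolding W_def using is_map someI_ex[of "boundary_walk M F"] by (auto simp: is_map_def)

lemma choice_parametrization:
  assumes "\<And>F. F \<in> faces M \<Longrightarrow> boundary_walk M F (W' F)"
  obtains \<Phi> where "parametrized_map M W' \<Phi>"
proof -
  have "\<forall>F\<in>faces M. \<exists>\<phi>. parametrized_face M F (W' F) \<phi>"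
    using boundary_walk_parametrization[OF _ assms edges_nonempty] by metis
  then obtain \<Phi> where "\<And>F. F \<in> faces M \<Longrightarrow> parametrized_face M F (W' F) (\<Phi> F)" by metis
  then have "parametrized_map M W' \<Phi>"
    using embedded_map_axioms by (simp add: parametrized_map_def parametrized_map_axioms_def)
  then show ?thesis by (rule that)
qed

definition \<Phi> :: "'a set \<Rightarrow> complex \<Rightarrow> 'a" where
  "\<Phi> = (SOME \<Phi>. parametrized_map M W \<Phi>)"

sublocale parametrized_map M W \<Phi>
proof -
  obtain \<Phi>' where "parametrized_map M W \<Phi>'" by (rule choice_parametrization[OF walk_W])
  then show "parametrized_map M W \<Phi>" unfolding \<Phi>_def by (rule someI[of "parametrized_map M W"])
qed

abbreviation len :: "'a set \<Rightarrow> nat" where "len F \<equiv> length (W F)"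
text \<open>Indices are read modulo the length, so every face gives periodic sequences on all
  naturals and patterns become properties of the sequence \<open>inw F\<close>. Place
  \<open>i\<close> lies between edges \<open>i\<close> and \<open>i + 1\<close>, at vertex
  \<open>i + 1\<close>.\<close>

definition vtx :: "'a set \<Rightarrow> nat \<Rightarrow> 'v" where "vtx F i = fst (W F ! (i mod len F))"
definition edg :: "'a set \<Rightarrow> nat \<Rightarrow> 'e" where "edg F i = snd (W F ! (i mod len F))"
definition plc :: "'a set \<Rightarrow> nat \<Rightarrow> ('v, 'e) corner" where "plc F i = walk_corner (W F) (i mod len F)"
definition inw :: "'a set \<Rightarrow> nat \<Rightarrow> bool" where "inw F i \<longleftrightarrow> plc F i \<in> L"

lemma mod_len [simp]: "vtx F (i mod len F) = vtx F i" "edg F (i mod len F) = edg F i"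
  "plc F (i mod len F) = plc F i" "inw F (i mod len F) = inw F i"
  by (simp_all add: vtx_def edg_def plc_def inw_def)

lemma Suc_mod_len [simp]: "vtx F (Suc (i mod len F)) = vtx F (Suc i)" "edg F (Suc (i mod len F)) = edg F (Suc i)"
  "inw F (Suc (i mod len F)) = inw F (Suc i)"
  by (simp_all add: vtx_def edg_def plc_def inw_def mod_Suc_eq)

lemma plc_eq: "plc F i = (vtx F (Suc i), {edg F i, edg F (Suc i)})"
  by (simp add: plc_def walk_corner_Suc vtx_def edg_def mod_Suc_eq)

lemma len_ge_2: "F \<in> faces M \<Longrightarrow> 2 \<le> len F"
  and len_pos: "F \<in> faces M \<Longrightarrow> 0 < len F"
  using parametrized_face.p_ge_2[OF param] by fastforce+

lemma edg_in: "F \<in> faces M \<Longrightarrow> edg F i \<in> edges M"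
  using parametrized_face.E_in[OF param] len_pos by (simp add: edg_def)

lemma ends_edg: "F \<in> faces M \<Longrightarrow> ends M (edg F i) = {vtx F i, vtx F (Suc i)}"
  and vtx_neq: "F \<in> faces M \<Longrightarrow> vtx F i \<noteq> vtx F (Suc i)"
  using parametrized_face.ends_E[OF param, of F "i mod len F"] len_pos[of F]
  by (simp_all add: edg_def vtx_def mod_Suc_eq)

lemma pred_len: "F \<in> faces M \<Longrightarrow> vtx F (Suc (k + len F - 1)) = vtx F k"
  "F \<in> faces M \<Longrightarrow> edg F (Suc (k + len F - 1)) = edg F k"
  using len_pos[of F] by (simp_all add: vtx_def edg_def)

lemma sides_iff: "(F, k) \<in> sides e \<longleftrightarrow> F \<in> faces M \<and> k < len F \<and> edg F k = e"
  by (auto simp: sides_def edg_def)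

lemma obtain_other_side:
  assumes "s \<in> sides e"
  obtains t where "t \<in> sides e" "t \<noteq> s"
proof -
  have "card (sides e) = 2" using card_sides sides_edge[OF assms] by blast
  then obtain a b where "sides e = {a, b}" "a \<noteq> b" by (auto simp only: card_2_iff)
  then show ?thesis using that assms by (metis insertE insertI1 insertI2 singletonD)
qed

lemma sides_eq:
  assumes "s \<in> sides e" "t \<in> sides e" "s \<noteq> t" shows "sides e = {s, t}"
  using card_sides[OF sides_edge[OF assms(1)]] assms by (auto simp: card_2_iff)

text \<open>The in- and out-wedges are treated as places of the boundary walks; \<open>places v e\<close> are those at
  the dart \<open>(v, e)\<close>, and \<open>pl v\<close> takes a side of \<open>e\<close> to its place at the end \<open>v\<close>.\<close>

definition places :: "'v \<Rightarrow> 'e \<Rightarrow> ('a set \<times> nat) set" where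
  "places v e = {(F, m). F \<in> faces M \<and> m < len F \<and> vtx F (Suc m) = v \<and> (edg F m = e \<or> edg F (Suc m) = e)}"

definition pl :: "'v \<Rightarrow> 'a set \<times> nat \<Rightarrow> 'a set \<times> nat" where
  "pl v = (\<lambda>(F, k). (F, if vtx F k = v then (k + len F - 1) mod len F else k))"

lemma pl_in_places:
  assumes "s \<in> sides e" "v \<in> ends M e" shows "pl v s \<in> places v e"
proof -
  obtain F k where s: "s = (F, k)" and F: "F \<in> faces M" "k < len F" "edg F k = e"
    using assms(1) by (cases s) (auto simp: sides_iff)
  show ?thesis
  proof (cases "vtx F k = v")
    case True
    then show ?thesis using F pred_len[OF F(1), of k] len_pos[OF F(1)] by (simp add: s pl_def places_def)
  next
    case False
    then have "vtx F (Suc k) = v" using ends_edg[OF F(1), of k] F(3) assms(2) by auto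
    then show ?thesis using F False by (simp add: s pl_def places_def)
  qed
qed

text \<open>Together with \<open>card_sides\<close> this bounds the number of places at a dart by
  two.\<close>

lemma places_subset: "places v e \<subseteq> pl v ` sides e"
proof
  fix x assume "x \<in> places v e"
  then obtain F m where x: "x = (F, m)" and F: "F \<in> faces M" "m < len F" "vtx F (Suc m) = v"
    and e: "edg F m = e \<or> edg F (Suc m) = e" by (auto simp: places_def)
  show "x \<in> pl v ` sides e"
  proof (cases "edg F m = e")
    case True
    then have "(F, m) \<in> sides e" using F by (simp add: sides_iff)
    moreover have "pl v (F, m) = x" using vtx_neq[OF F(1), of m] F(3) by (simp add: pl_def x)
    ultimately show ?thesis by force
  next
    case False
    then have "(F, Suc m mod len F) \<in> sides e" using F e len_pos by (simp add: sides_iff)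
    moreover have "pl v (F, Suc m mod len F) = x"
    proof -
      have "(Suc m mod len F + len F - 1) mod len F = m"
        using F(2) by (cases "Suc m = len F") auto
      then show ?thesis using F(3) by (simp add: pl_def x)
    qed
    ultimately show ?thesis by force
  qed
qed

lemma L_in_corners: "L \<subseteq> corners M"
  using corneration by (simp add: corneration_def)

lemma inw_edges_neq: "inw F i \<Longrightarrow> edg F i \<noteq> edg F (Suc i)"
  using subsetD[OF L_in_corners, of "plc F i"] corner_proper unfolding inw_def plc_eq by metis

lemma L_place:
  assumes "c \<in> L"
  obtains F m where "F \<in> faces M" "m < len F" "plc F m = c"
proof -
  have "c \<in> wedges M" using assms L_wedges by blast
  then obtain F w k where F: "F \<in> faces M" "boundary_walk M F w" "k < length w" "walk_corner w k = c"
    by (auto simp: wedges_def)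
  have "walk_corner w k \<in> corners M" using F(4) assms L_in_corners by blast
  then obtain j where "j < len F" "walk_corner (W F) j = c"
    using corner_transfer[OF F(1,2) walk_W[OF F(1)] edges_nonempty F(3)] F(4) by metis
  then show ?thesis using that F(1) by (simp add: plc_def)
qed

text \<open>The convention on wedges enters here: it makes counting corners of \<open>L\<close> the
  same as counting in-places of the walks.\<close>

lemma L_place_unique:
  assumes "plc F m \<in> L" "plc G n = plc F m" "F \<in> faces M" "G \<in> faces M" "m < len F" "n < len G"
  shows "(F, m) = (G, n)"
proof -
  have "plc F m \<in> wedges M" using assms(1) L_wedges by blast
  then have u: "\<exists>!F'. F' \<in> faces M \<and> (\<exists>w. boundary_walk M F' w \<and> (\<exists>k<length w. walk_corner w k = plc F m))"
    "\<And>F' w j k. F' \<in> faces M \<Longrightarrow> boundary_walk M F' w \<Longrightarrow> j < length w \<Longrightarrow> k < length w \<Longrightarrow>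
      walk_corner w j = plc F m \<Longrightarrow> walk_corner w k = plc F m \<Longrightarrow> j = k"
    using bspec[OF unambiguous[unfolded wedges_unambiguous_def], of "plc F m"] by metis+
  have Fm: "walk_corner (W F) m = plc F m" and Gn: "walk_corner (W G) n = plc F m"
    using assms by (auto simp: plc_def)
  have "F = G" using u(1) Fm Gn assms(3-6) walk_W by blast
  moreover have "m = n"
    using u(2)[OF assms(3) walk_W[OF assms(3)], of m n] Fm Gn assms(5,6) \<open>F = G\<close> by simp
  ultimately show ?thesis by simp
qed

lemma dart_corner_unique: "(v, e) \<in> darts M \<Longrightarrow> \<exists>!c. c \<in> L \<and> (v, e) \<in> corner_darts c"
  using corneration by (simp add: corneration_def)

text \<open>The one corner of \<open>L\<close> at the dart provides exactly one in-place, coming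
  from one side of \<open>e\<close>. The other side must yield a second place, which is then an
  out-place.\<close>

lemma dart_places:
  assumes e: "e \<in> edges M" and v: "v \<in> ends M e"
  obtains x y where "places v e = {x, y}" "x \<noteq> y" "inw (fst x) (snd x)" "\<not> inw (fst y) (snd y)"
proof -
  have vd: "(v, e) \<in> darts M" using e v by (simp add: darts_def)
  then obtain c where c: "c \<in> L" "(v, e) \<in> corner_darts c" using dart_corner_unique by blast
  obtain F m where F: "F \<in> faces M" "m < len F" and Fm: "plc F m = c" by (rule L_place[OF c(1)])
  have x: "(F, m) \<in> places v e" using F c(2) Fm[symmetric] by (auto simp: places_def plc_eq corner_darts_def)
  have inx: "inw F m" using Fm c(1) by (simp add: inw_def)
  have neq: "edg F m \<noteq> edg F (Suc m)" using inw_edges_neq[OF inx] .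
  have only: "z = (F, m)" if "z \<in> places v e" "inw (fst z) (snd z)" for z
  proof -
    obtain G n where z: "z = (G, n)" by (cases z)
    have G: "G \<in> faces M" "n < len G" using that(1) by (auto simp: places_def z)
    have "(v, e) \<in> corner_darts (plc G n)" using that(1) by (auto simp: z places_def plc_eq corner_darts_def)
    moreover have "plc G n \<in> L" using that(2) by (simp add: z inw_def)
    ultimately have "plc G n = c" using dart_corner_unique[OF vd] c by blast
    then show ?thesis using L_place_unique[of F m G n] Fm c(1) F G z by simp
  qed
  obtain s where s: "s \<in> sides e" "pl v s = (F, m)" using places_subset[of v e] x by (auto simp only: image_iff dest!: subsetD)
  obtain t where t: "t \<in> sides e" "t \<noteq> s" by (rule obtain_other_side[OF s(1)])
  \<comment> \<open>If both sides led to this place, \<open>e\<close> would be the edge before it as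
    well as the edge after it, contrary to \<open>neq\<close>.\<close>
  have "pl v t \<noteq> (F, m)"
  proof
    assume tm: "pl v t = (F, m)"
    obtain k where k: "s = (F, k)" "k < len F" "edg F k = e" using s by (cases s) (auto simp: sides_iff pl_def)
    obtain l where l: "t = (F, l)" "l < len F" "edg F l = e" using t(1) tm by (cases t) (auto simp: sides_iff pl_def)
    have "k \<noteq> l" using t(2) k(1) l(1) by simp
    have *: "edg F (Suc m) = e \<and> Suc m mod len F = i \<or> edg F m = e \<and> m = i" if "pl v (F, i) = (F, m)" "i < len F" "edg F i = e" for i
    proof (cases "vtx F i = v")
      case True
      then have m: "m = (i + len F - 1) mod len F" using that(1) by (simp add: pl_def)
      then have "Suc m mod len F = i" using len_pos[OF F(1)] that(2) by (simp only: mod_Suc_eq Suc_pred_mod mod_less)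
      moreover from this have "edg F (Suc m) = e" using that(3) mod_len(2)[of F "Suc m"] by simp
      ultimately show ?thesis by blast
    next
      case False
      then show ?thesis using that by (simp add: pl_def)
    qed
    have "edg F (Suc m) = e \<and> edg F m = e"
      using *[of k] *[of l] s(2) tm k l \<open>k \<noteq> l\<close> by blast
    then show False using neq by simp
  qed
  moreover have "sides e = {s, t}" using sides_eq[OF s(1) t(1)] t(2) by blast
  moreover have "pl v t \<in> places v e" using pl_in_places[OF t(1) v] .
  ultimately have "places v e = {(F, m), pl v t}" using places_subset[of v e] x s(2) by auto
  moreover have "\<not> inw (fst (pl v t)) (snd (pl v t))"
    using only[OF \<open>pl v t \<in> places v e\<close>] \<open>pl v t \<noteq> (F, m)\<close> by blast
  ultimately show ?thesis using that[of "(F, m)" "pl v t"] \<open>pl v t \<noteq> (F, m)\<close> inx by auto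
qed

lemma pl_sides:
  assumes "s \<in> sides e" "t \<in> sides e" "s \<noteq> t" "v \<in> ends M e"
  shows "pl v s \<noteq> pl v t"
    "inw (fst (pl v s)) (snd (pl v s)) \<longleftrightarrow> \<not> inw (fst (pl v t)) (snd (pl v t))"
proof -
  obtain x y where xy: "places v e = {x, y}" "x \<noteq> y" "inw (fst x) (snd x)" "\<not> inw (fst y) (snd y)"
    by (rule dart_places[OF sides_edge[OF assms(1)] assms(4)])
  have "{x, y} \<subseteq> {pl v s, pl v t}"
    using places_subset[of v e] sides_eq[OF assms(1-3)] unfolding xy(1) by auto
  then have "{x, y} = {pl v s, pl v t}" using xy(2) by auto
  then have "x = pl v s \<and> y = pl v t \<or> x = pl v t \<and> y = pl v s" by (simp add: doubleton_eq_iff)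
  then show "pl v s \<noteq> pl v t"
    "inw (fst (pl v s)) (snd (pl v s)) \<longleftrightarrow> \<not> inw (fst (pl v t)) (snd (pl v t))"
    using xy(2-4) by auto
qed

text \<open>A walk that turned back along the same edge would assign to both sides of that edge a
  common place at the turning vertex. It follows that every place is a proper corner.\<close>

lemma edges_neq:
  assumes F: "F \<in> faces M" shows "edg F m \<noteq> edg F (Suc m)"
proof
  assume eq: "edg F m = edg F (Suc m)"
  let ?v = "vtx F (Suc m)" and ?e = "edg F m" and ?n = "len F"
  have n: "2 \<le> ?n" "0 < ?n" using len_ge_2[OF F] by auto
  have s: "(F, m mod ?n) \<in> sides ?e" and t: "(F, Suc m mod ?n) \<in> sides ?e"
    using F n eq by (auto simp: sides_iff)
  have ne: "m mod ?n \<noteq> Suc m mod ?n" using n by (auto simp: mod_Suc)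
  have v: "?v \<in> ends M ?e" using ends_edg[OF F] by simp
  have "pl ?v (F, m mod ?n) = (F, m mod ?n)" using vtx_neq[OF F, of m] by (simp add: pl_def)
  moreover have "pl ?v (F, Suc m mod ?n) = (F, m mod ?n)"
  proof -
    have "(Suc m mod ?n + ?n - 1) mod ?n = m mod ?n" using n by (auto simp: mod_Suc)
    then show ?thesis by (simp add: pl_def)
  qed
  ultimately show False using pl_sides(1)[OF s t _ v] ne by simp
qed

text \<open>At each end of the common edge the kinds of the two places are opposite. The two
  alternatives correspond to walks that run along the edge in the same or in opposite directions,
  since the chosen walks are not oriented coherently.\<close>

lemma opposite_side:
  assumes F: "F \<in> faces M" and G: "G \<in> faces M" and eq: "edg F (Suc i) = edg G (Suc j)"
    and ne: "(F, i mod len F) \<noteq> (G, j mod len G)"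
  shows "(inw G j \<longleftrightarrow> \<not> inw F i) \<and> (inw G (Suc j) \<longleftrightarrow> \<not> inw F (Suc i)) \<or>
    (inw G j \<longleftrightarrow> \<not> inw F (Suc i)) \<and> (inw G (Suc j) \<longleftrightarrow> \<not> inw F i)"
proof -
  let ?e = "edg F (Suc i)" and ?s = "(F, Suc i mod len F)" and ?t = "(G, Suc j mod len G)"
  have s: "?s \<in> sides ?e" and t: "?t \<in> sides ?e"
    using F G eq len_pos by (auto simp: sides_iff)
  have st: "?s \<noteq> ?t" using ne Suc_mod_cancel len_pos F by auto
  have ends: "ends M ?e = {vtx F (Suc i), vtx F (Suc (Suc i))}" "ends M ?e = {vtx G (Suc j), vtx G (Suc (Suc j))}"
    using ends_edg[OF F, of "Suc i"] ends_edg[OF G, of "Suc j"] eq by auto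
  \<comment> \<open>For the side with index \<open>k + 1\<close>, the place at its start is
    \<open>k\<close> and the place at its end is \<open>k + 1\<close>.\<close>
  have p: "inw (fst (pl (vtx H (Suc k)) (H, Suc k mod len H))) (snd (pl (vtx H (Suc k)) (H, Suc k mod len H))) = inw H k"
    "inw (fst (pl (vtx H (Suc (Suc k))) (H, Suc k mod len H))) (snd (pl (vtx H (Suc (Suc k))) (H, Suc k mod len H))) = inw H (Suc k)"
    if "H \<in> faces M" for H k
  proof -
    have "(Suc k mod len H + len H - 1) mod len H = k mod len H" using len_pos[OF that] by (auto simp: mod_Suc)
    then have "pl (vtx H (Suc k)) (H, Suc k mod len H) = (H, k mod len H)" by (simp add: pl_def)
    then show "inw (fst (pl (vtx H (Suc k)) (H, Suc k mod len H))) (snd (pl (vtx H (Suc k)) (H, Suc k mod len H))) = inw H k" by simp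
    have "pl (vtx H (Suc (Suc k))) (H, Suc k mod len H) = (H, Suc k mod len H)"
      using vtx_neq[OF that, of "Suc k"] by (simp add: pl_def)
    then show "inw (fst (pl (vtx H (Suc (Suc k))) (H, Suc k mod len H))) (snd (pl (vtx H (Suc (Suc k))) (H, Suc k mod len H))) = inw H (Suc k)" by simp
  qed
  have a: "inw (fst (pl v ?s)) (snd (pl v ?s)) \<longleftrightarrow> \<not> inw (fst (pl v ?t)) (snd (pl v ?t))" if "v \<in> ends M ?e" for v
    using pl_sides(2)[OF s t st that] .
  consider "vtx F (Suc i) = vtx G (Suc j)" "vtx F (Suc (Suc i)) = vtx G (Suc (Suc j))"
    | "vtx F (Suc i) = vtx G (Suc (Suc j))" "vtx F (Suc (Suc i)) = vtx G (Suc j)"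
    using ends(1)[unfolded ends(2)] unfolding doubleton_eq_iff by fastforce
  then show ?thesis
  proof cases
    case 1
    then show ?thesis using a[of "vtx F (Suc i)"] a[of "vtx F (Suc (Suc i))"] p[OF F, of i] p[OF G, of j] ends(1) by auto
  next
    case 2
    then show ?thesis using a[of "vtx F (Suc i)"] a[of "vtx F (Suc (Suc i))"] p[OF F, of i] p[OF G, of j] ends(1) by auto
  qed
qed

lemma obtain_opposite_side:
  assumes F: "F \<in> faces M"
  obtains G j where "G \<in> faces M" "edg F (Suc i) = edg G (Suc j)" "(F, i mod len F) \<noteq> (G, j mod len G)"
proof -
  have "(F, Suc i mod len F) \<in> sides (edg F (Suc i))" using F len_pos by (simp add: sides_iff)
  then obtain t where t: "t \<in> sides (edg F (Suc i))" "t \<noteq> (F, Suc i mod len F)" by (rule obtain_other_side)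
  then obtain G k where G: "t = (G, k)" "G \<in> faces M" "k < len G" "edg G k = edg F (Suc i)"
    by (cases t) (auto simp: sides_iff)
  let ?j = "k + len G - 1"
  have k: "Suc ?j mod len G = k" using G(2,3) len_pos by (simp only: Suc_pred_mod mod_less)
  have "edg F (Suc i) = edg G (Suc ?j)" using pred_len(2)[OF G(2)] G(4) by simp
  moreover have "(F, i mod len F) \<noteq> (G, ?j mod len G)"
  proof
    assume "(F, i mod len F) = (G, ?j mod len G)"
    then have "F = G" "Suc i mod len F = Suc ?j mod len G" using Suc_mod_cancel[OF len_pos[OF F]] by auto
    then show False using t(2) G(1) k by simp
  qed
  ultimately show ?thesis using that G(2) by blast
qed

end

subsection \<open>Straight edges\<close>

lemma alternating_sequence:
  assumes step: "\<And>i. b (Suc i) \<longleftrightarrow> \<not> b i" and per: "b (0 + p) = b 0"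
  shows "2 dvd p \<and> (\<exists>s. \<forall>k. b k \<longleftrightarrow> (k + s) mod 2 = (0 :: nat))"
proof -
  have b: "b k \<longleftrightarrow> (even k \<longleftrightarrow> b 0)" for k
    by (induction k) (auto simp: step)
  have "2 dvd p" using b[of p] per by auto
  moreover have "\<forall>k. b k \<longleftrightarrow> (k + (if b 0 then 0 else 1)) mod 2 = 0"
  proof
    fix k show "b k \<longleftrightarrow> (k + (if b 0 then 0 else 1)) mod 2 = 0"
      using b[of k] by (cases "b 0") (simp_all, presburger+)
  qed
  ultimately show ?thesis by blast
qed

lemma period_four_sequence:
  assumes step: "\<And>i. b (Suc (Suc i)) \<longleftrightarrow> \<not> b i" and per: "\<And>i. b (i + p) = b i"
  shows "4 dvd p \<and> (\<exists>s. \<forall>k. b k \<longleftrightarrow> (k + s) mod 4 \<in> {0, 1 :: nat})"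
proof -
  \<comment> \<open>The phase is read off from the first two values: in-in is 0, in-out is 1,
    out-out is 2 and out-in is 3.\<close>
  define s :: nat where "s = (if b 0 then if b 1 then 0 else 1 else if b 1 then 3 else 2)"
  have half: "(m + 2) mod 4 \<in> {0, 1} \<longleftrightarrow> m mod 4 \<notin> {0, 1}" for m :: nat
    by (simp only: insert_iff empty_iff) presburger
  have bs: "b k \<longleftrightarrow> (k + s) mod 4 \<in> {0, 1}" for k
  proof (induction k rule: induct_nat_012)
    case (ge2 n)
    then show ?case using step[of n] half[of "n + s"] by simp
  qed (auto simp: s_def)
  have shift: "(i + p + s) mod 4 \<in> {0, 1} \<longleftrightarrow> (i + s) mod 4 \<in> {0, 1}" for i
    using per[of i] bs[of "i + p"] bs[of i] by simp
  have "s \<le> 3" by (simp add: s_def)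
  \<comment> \<open>The indices \<open>4 - s\<close> and \<open>7 - s\<close> have phases 0 and 3. A
    shift by \<open>p\<close> must keep the first an in-place and the second an out-place, which
    only multiples of 4 do.\<close>
  then have e: "4 - s + p + s = p + 4" "4 - s + s = 4" "7 - s + p + s = p + 7" "7 - s + s = 7" by simp_all
  have "(p + 4) mod 4 \<in> {0, 1}" using shift[of "4 - s"] unfolding e by simp
  moreover have "(p + 7) mod 4 \<notin> {0, 1}" using shift[of "7 - s"] unfolding e by simp
  ultimately have "4 dvd p" by (simp, presburger)
  then show ?thesis using bs by blast
qed

lemma period_three_sequence:
  assumes step: "\<And>i. \<not> b i \<Longrightarrow> b (Suc i) \<and> b (Suc (Suc i)) \<and> \<not> b (Suc (Suc (Suc i)))"
    and per: "\<And>i. b (i + p) = b i" and p: "0 < p" and "\<not> b i0"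
  shows "3 dvd p \<and> (\<exists>s. \<forall>k. b k \<longleftrightarrow> (k + s) mod 3 \<noteq> (0 :: nat))"
proof -
  have out: "\<not> b (i0 + 3 * n)" for n
    by (induction n) (use assms(4) step in \<open>auto simp: numeral_3_eq_3\<close>)
  have b: "b (i0 + k) \<longleftrightarrow> k mod 3 \<noteq> 0" for k
  proof -
    define n where "n = k div 3"
    have "k = 3 * n \<or> k = Suc (3 * n) \<or> k = Suc (Suc (3 * n))" unfolding n_def by presburger
    then show ?thesis using step[OF out[of n]] out[of n] by (elim disjE) (simp_all, presburger+)
  qed
  have "3 dvd p" using b[of p] per[of i0] assms(4) by auto
  have pers: "b (k + p * n) = b k" for k n
  proof (induction n)
    case (Suc n)
    have "k + p * Suc n = k + p * n + p" by simp
    then show ?case using per Suc by metis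
  qed simp
  \<comment> \<open>The phase should be minus \<open>i0\<close>; modulo 3 this is
    \<open>2 * i0\<close>.\<close>
  have "b k \<longleftrightarrow> (k + 2 * i0) mod 3 \<noteq> 0" for k
  proof -
    obtain q where q: "p = 3 * q" using \<open>3 dvd p\<close> by (auto elim: dvdE)
    \<comment> \<open>The values are known only from \<open>i0\<close> onwards; a shift by
      \<open>p * i0\<close> moves every index beyond \<open>i0\<close>.\<close>
    have "i0 \<le> p * i0" using p by simp
    then obtain d where d: "p * i0 = i0 + d" using le_Suc_ex by blast
    have "b k \<longleftrightarrow> (k + d) mod 3 \<noteq> 0" using pers[of k i0] b[of "k + d"] unfolding d by (simp add: algebra_simps)
    moreover obtain x where "i0 + d = 3 * x" using d q by (metis mult.assoc)
    then have "k + d + 3 * i0 = k + 2 * i0 + 3 * x" by simp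
    then have "(k + d) mod 3 = (k + 2 * i0) mod 3" by (metis mod_mult_self2)
    ultimately show ?thesis by simp
  qed
  then show ?thesis using \<open>3 dvd p\<close> by blast
qed

context corneration_map
begin

text \<open>A straight edge has both in-wedges on one side and both out-wedges on the other; any other edge
  has an in-wedge and an out-wedge on each side.\<close>

definition straight :: "'e \<Rightarrow> bool" where
  "straight e \<longleftrightarrow> (\<exists>F\<in>faces M. \<exists>i. edg F (Suc i) = e \<and> inw F i \<and> inw F (Suc i))"

lemma inw_period: "inw F (i + len F) = inw F i"
  by (metis mod_add_self2 mod_len(4))

lemma inw_mod_cong: "i mod len F = j mod len F \<Longrightarrow> inw F i = inw F j \<and> inw F (Suc i) = inw F (Suc j)"
  by (metis mod_len(4) Suc_mod_len(3))

text \<open>Passing to the other side of an edge exchanges the kinds at both ends, so equality of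
  the two kinds does not depend on the side. An out-out side has an in-in side opposite to
  it.\<close>

lemma straight_iff:
  assumes F: "F \<in> faces M"
  shows "straight (edg F (Suc i)) \<longleftrightarrow> (inw F i \<longleftrightarrow> inw F (Suc i))"
proof
  assume "straight (edg F (Suc i))"
  then obtain G j where G: "G \<in> faces M" "edg G (Suc j) = edg F (Suc i)" "inw G j" "inw G (Suc j)"
    by (auto simp: straight_def)
  show "inw F i \<longleftrightarrow> inw F (Suc i)"
  proof (cases "(G, j mod len G) = (F, i mod len F)")
    case True
    then show ?thesis using G(3,4) inw_mod_cong[of j F i] by auto
  next
    case False
    then show ?thesis using opposite_side[OF G(1) F G(2)] G(3,4) by auto
  qed
next
  assume eq: "inw F i \<longleftrightarrow> inw F (Suc i)"
  show "straight (edg F (Suc i))"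
  proof (cases "inw F i")
    case True
    then show ?thesis using eq F by (auto simp: straight_def)
  next
    case False
    obtain G j where G: "G \<in> faces M" "edg F (Suc i) = edg G (Suc j)" "(F, i mod len F) \<noteq> (G, j mod len G)"
      by (rule obtain_opposite_side[OF F])
    then have "inw G j" "inw G (Suc j)" using opposite_side[OF F G] False eq by auto
    then show ?thesis using G(1) unfolding straight_def G(2) by blast
  qed
qed

lemma in_place_at_dart:
  assumes "e \<in> edges M" "v \<in> ends M e"
  obtains F i where "F \<in> faces M" "inw F i" "vtx F (Suc i) = v" "edg F i = e \<or> edg F (Suc i) = e"
proof -
  obtain x y where xy: "places v e = {x, y}" "inw (fst x) (snd x)"
    using dart_places[OF assms] by metis
  have "x \<in> places v e" using xy(1) by simp
  then show ?thesis using that[of "fst x" "snd x"] xy(2) by (auto simp: places_def)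
qed

lemma ends_nonempty:
  assumes "e \<in> edges M" obtains v where "v \<in> ends M e"
  using card_ends[OF assms] by (metis card.empty ex_in_conv zero_neq_numeral)

lemma plc_corner: "F \<in> faces M \<Longrightarrow> plc F i \<in> corners M"
  using edges_neq[of F i] edg_in[of F i] edg_in[of F "Suc i"] ends_edg[of F i] ends_edg[of F "Suc i"]
  unfolding plc_eq corners_def darts_def by blast

lemma plc_walk: "k < len F \<Longrightarrow> walk_corner (W F) k = plc F k"
  by (simp add: plc_def)

lemma corner_in: "(v, {e, e'}) \<in> corners M \<Longrightarrow> v \<in> verts M \<and> e \<in> edges M \<and> e' \<in> edges M"
  using ends_subset unfolding corners_def darts_def by (auto simp: doubleton_eq_iff)

section \<open>Symmetries act on places and preserve straightness\<close>

lemma symmetry_walk_corner: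
  assumes "k < length w"
  shows "walk_corner (map (map_prod \<alpha> \<beta>) w) k = corner_image (\<alpha>, \<beta>) (walk_corner w k)"
proof -
  have "Suc k mod length w < length w" using assms by (intro mod_less_divisor) auto
  then show ?thesis using assms by (simp add: walk_corner_Suc corner_image_def)
qed

lemma corner_symmetryD:
  assumes "(\<alpha>, \<beta>) \<in> corner_symmetries M L"
  shows "(\<alpha>, \<beta>) \<in> symmetries M" "corner_image (\<alpha>, \<beta>) ` L = L"
    "inj_on \<alpha> (verts M)" "inj_on \<beta> (edges M)" "\<beta> ` edges M = edges M"
    "\<And>e. e \<in> edges M \<Longrightarrow> ends M (\<beta> e) = \<alpha> ` ends M e"
  using assms by (auto simp: corner_symmetries_def symmetries_def skeleton_automorphism_def bij_betw_def)

text \<open>A symmetry is only known to map \<open>L\<close> onto \<open>L\<close>; injectivity on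
  corners is what keeps images of out-wedges outside \<open>L\<close>.\<close>

lemma corner_image_inj:
  assumes \<sigma>: "(\<alpha>, \<beta>) \<in> corner_symmetries M L"
    and c: "(v, {e, f}) \<in> corners M" "(v', {e', f'}) \<in> corners M"
    and eq: "corner_image (\<alpha>, \<beta>) (v, {e, f}) = corner_image (\<alpha>, \<beta>) (v', {e', f'})"
  shows "(v, {e, f}) = (v', {e', f'})"
proof -
  note in_M = corner_in[OF c(1)] corner_in[OF c(2)]
  have "\<alpha> v = \<alpha> v'" "\<beta> ` {e, f} = \<beta> ` {e', f'}" using eq by (simp_all only: corner_image_def fst_conv snd_conv prod.inject)
  then have "v = v'" "{e, f} = {e', f'}"
    using inj_onD[OF corner_symmetryD(3)[OF \<sigma>]] in_M inj_on_image_eq_iff[OF corner_symmetryD(4)[OF \<sigma>], of "{e, f}" "{e', f'}"]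
    by auto
  then show ?thesis by simp
qed

lemma corner_image_corners:
  assumes \<sigma>: "(\<alpha>, \<beta>) \<in> corner_symmetries M L" and c: "(v, {e, f}) \<in> corners M"
  shows "corner_image (\<alpha>, \<beta>) (v, {e, f}) \<in> corners M"
proof -
  have ef: "e \<in> edges M" "f \<in> edges M" "v \<in> ends M e" "v \<in> ends M f" "e \<noteq> f"
    using c corner_proper[OF c] unfolding corners_def darts_def by (auto simp: doubleton_eq_iff)
  have "\<beta> e \<in> edges M" "\<beta> f \<in> edges M" using ef(1,2) corner_symmetryD(5)[OF \<sigma>] by blast+
  moreover have "\<alpha> v \<in> ends M (\<beta> e)" "\<alpha> v \<in> ends M (\<beta> f)"
    using ef(3,4) corner_symmetryD(6)[OF \<sigma> ef(1)] corner_symmetryD(6)[OF \<sigma> ef(2)] by auto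
  moreover have "\<beta> e \<noteq> \<beta> f" using inj_onD[OF corner_symmetryD(4)[OF \<sigma>]] ef by blast
  ultimately show ?thesis unfolding corner_image_def corners_def darts_def by auto
qed

lemma symmetry_place:
  assumes \<sigma>: "(\<alpha>, \<beta>) \<in> corner_symmetries M L" and F: "F \<in> faces M"
  obtains G m where "G \<in> faces M" "plc G m = corner_image (\<alpha>, \<beta>) (plc F i)" "m < len G"
proof -
  let ?w = "map (map_prod \<alpha> \<beta>) (W F)" and ?i = "i mod len F"
  obtain G where G: "G \<in> faces M" "boundary_walk M G ?w"
    by (rule symmetry_boundary_walk[OF corner_symmetryD(1)[OF \<sigma>] F walk_W[OF F]])
  have i: "?i < len F" using len_pos[OF F] by simp
  then have wc: "walk_corner ?w ?i = corner_image (\<alpha>, \<beta>) (plc F i)"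
    using symmetry_walk_corner[OF i] plc_walk[OF i] by simp
  moreover have "corner_image (\<alpha>, \<beta>) (plc F i) \<in> corners M"
    using corner_image_corners[OF \<sigma>] plc_corner[OF F, of i] unfolding plc_eq .
  ultimately obtain j where "j < len G" "walk_corner (W G) j = walk_corner ?w ?i"
    using corner_transfer[OF G(1,2) walk_W[OF G(1)] edges_nonempty, of ?i] i by (metis length_map)
  then show ?thesis using that[OF G(1), of j] wc plc_walk by simp
qed

text \<open>Straightness is witnessed by two in-wedges at consecutive places. The image walk need
  not be the chosen one of its face, so the pair is carried over with
  \<open>side_transfer\<close>.\<close>

lemma symmetry_straight:
  assumes \<sigma>: "(\<alpha>, \<beta>) \<in> corner_symmetries M L" and "straight e"
  shows "straight (\<beta> e)"
proof -
  obtain F i where F: "F \<in> faces M" and e: "edg F (Suc i) = e" and io: "inw F i" "inw F (Suc i)"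
    using assms(2) by (auto simp: straight_def)
  let ?w = "map (map_prod \<alpha> \<beta>) (W F)" and ?k = "i mod len F"
  obtain G where G: "G \<in> faces M" "boundary_walk M G ?w"
    by (rule symmetry_boundary_walk[OF corner_symmetryD(1)[OF \<sigma>] F walk_W[OF F]])
  have k: "?k < len F" "Suc ?k mod len F < len F" using len_pos[OF F] by simp_all
  have S: "plc F (Suc ?k mod len F) = plc F (Suc i)" by (simp add: plc_def mod_Suc_eq)
  have wc: "walk_corner ?w ?k = corner_image (\<alpha>, \<beta>) (plc F i)"
    "walk_corner ?w (Suc ?k mod len F) = corner_image (\<alpha>, \<beta>) (plc F (Suc i))"
    using symmetry_walk_corner[OF k(1)] symmetry_walk_corner[OF k(2)] plc_walk[OF k(1)] plc_walk[OF k(2)] S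
    by (simp_all only: mod_len)
  have inL: "corner_image (\<alpha>, \<beta>) (plc F i) \<in> L" "corner_image (\<alpha>, \<beta>) (plc F (Suc i)) \<in> L"
    using io corner_symmetryD(2)[OF \<sigma>] unfolding inw_def by blast+
  obtain j where j: "j < len G" "snd (W G ! (Suc j mod len G)) = snd (?w ! (Suc ?k mod len F))"
    "{walk_corner (W G) j, walk_corner (W G) (Suc j mod len G)} = {walk_corner ?w ?k, walk_corner ?w (Suc ?k mod len F)}"
  proof (rule side_transfer[OF G(1,2) walk_W[OF G(1)] edges_nonempty, of ?k])
    show "?k < length ?w" using k by simp
    show "walk_corner ?w ?k \<in> corners M" using wc(1) inL(1) L_in_corners by auto
    show "walk_corner ?w (Suc ?k mod length ?w) \<in> corners M" using wc(2) inL(2) L_in_corners by auto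
  qed (simp only: length_map that)
  have "edg G (Suc j) = \<beta> e" using j(2) k(2) e unfolding edg_def by (simp add: mod_Suc_eq)
  moreover have "{plc G j, plc G (Suc j)} \<subseteq> L"
  proof -
    have "walk_corner (W G) (Suc j mod len G) = plc G (Suc j)" by (simp add: plc_def)
    then show ?thesis using j(3) plc_walk[OF j(1)] wc inL by auto
  qed
  ultimately show ?thesis using G(1) unfolding straight_def inw_def by blast
qed

text \<open>The converse follows by counting: an injective map of the finite set of straight edges
  into itself is onto.\<close>

lemma symmetry_straight_iff:
  assumes \<sigma>: "(\<alpha>, \<beta>) \<in> corner_symmetries M L" and e: "e \<in> edges M"
  shows "straight (\<beta> e) \<longleftrightarrow> straight e"
proof
  let ?S = "{e \<in> edges M. straight e}"
  assume "straight (\<beta> e)"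
  have "\<beta> ` ?S \<subseteq> ?S" using symmetry_straight[OF \<sigma>] corner_symmetryD(5)[OF \<sigma>] by auto
  moreover have "inj_on \<beta> ?S" by (rule inj_on_subset[OF corner_symmetryD(4)[OF \<sigma>]]) auto
  ultimately have "\<beta> ` ?S = ?S" using finite_edges by (intro endo_inj_surj) auto
  moreover have "\<beta> e \<in> ?S" using \<open>straight (\<beta> e)\<close> e corner_symmetryD(5)[OF \<sigma>] by blast
  ultimately obtain e' where "e' \<in> ?S" "\<beta> e = \<beta> e'" by (metis (no_types, lifting) imageE)
  then show "straight e" using inj_onD[OF corner_symmetryD(4)[OF \<sigma>]] e by blast
qed (rule symmetry_straight[OF \<sigma>])

lemma symmetry_between_in_places:
  assumes F: "F \<in> faces M" "inw F i" and G: "G \<in> faces M" "inw G j"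
  obtains \<alpha> \<beta> where "(\<alpha>, \<beta>) \<in> corner_symmetries M L" "\<alpha> (vtx F (Suc i)) = vtx G (Suc j)"
    "{\<beta> (edg F i), \<beta> (edg F (Suc i))} = {edg G j, edg G (Suc j)}"
proof -
  obtain \<sigma> where "\<sigma> \<in> corner_symmetries M L" "corner_image \<sigma> (plc F i) = plc G j"
    using transitive F(2) G(2) unfolding transitive_def inw_def by blast
  then show ?thesis using that[of "fst \<sigma>" "snd \<sigma>"] by (simp add: corner_image_def plc_eq)
qed

text \<open>A set of truth values, since a symmetry may exchange the two edges of a wedge. It is a
  singleton exactly if both edges are of the same kind.\<close>

definition status :: "'a set \<Rightarrow> nat \<Rightarrow> bool set" where
  "status F i = {straight (edg F i), straight (edg F (Suc i))}"

lemma status_constant: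
  assumes F: "F \<in> faces M" "inw F i" and G: "G \<in> faces M" "inw G j"
  shows "status G j = status F i"
proof -
  obtain \<alpha> \<beta> where \<sigma>: "(\<alpha>, \<beta>) \<in> corner_symmetries M L"
    and e: "{\<beta> (edg F i), \<beta> (edg F (Suc i))} = {edg G j, edg G (Suc j)}"
    by (rule symmetry_between_in_places[OF F G]) (rule that)
  have "status G j = straight ` {\<beta> (edg F i), \<beta> (edg F (Suc i))}" unfolding e status_def by simp
  also have "\<dots> = status F i"
    using symmetry_straight_iff[OF \<sigma>] edg_in[OF F(1)] by (simp add: status_def)
  finally show ?thesis .
qed

section \<open>Patterns and borders expressed through the chosen walks\<close>

lemma pattern_B_face:
  assumes F: "F \<in> faces M" and "\<And>i. \<not> straight (edg F (Suc i))"
  shows "pattern_B M L F"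
proof -
  have "2 dvd len F \<and> (\<exists>s. \<forall>k. inw F k \<longleftrightarrow> (k + s) mod 2 = 0)"
  proof (rule alternating_sequence[of "inw F" "len F"])
    show "inw F (Suc i) \<longleftrightarrow> \<not> inw F i" for i using assms(2)[of i] straight_iff[OF F, of i] by blast
  qed (rule inw_period)
  then show ?thesis unfolding pattern_B_def using walk_W[OF F] plc_walk unfolding inw_def by metis
qed

lemma borders_sides:
  assumes "borders M F G"
  obtains i j where "F \<in> faces M" "G \<in> faces M" "edg F (Suc i) = edg G (Suc j)" "(F, i mod len F) \<noteq> (G, j mod len G)"
proof -
  have F: "F \<in> faces M" and G: "G \<in> faces M" using assms by (auto simp: borders_def)
  obtain s t e where st: "s \<in> sides e" "t \<in> sides e" "s \<noteq> t" "fst s = F" "fst t = G"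
  proof (cases "F = G")
    case True
    then obtain w j k where w: "boundary_walk M F w" "j < length w" "k < length w" "j \<noteq> k" "snd (w ! j) = snd (w ! k)"
      using assms by (auto simp: borders_def)
    \<comment> \<open>\<open>walks_correspond\<close> does not assert that distinct occurrences stay
      distinct. Counting replaces it: with \<open>w\<close> as the walk of \<open>F\<close>, both
      sides of the edge belong to \<open>F\<close>, so no other face meets the edge and both sides
      in the original walks belong to \<open>F\<close> too.\<close>
    let ?W = "W(F := w)" and ?e = "snd (w ! j)"
    obtain \<Phi>' where "parametrized_map M ?W \<Phi>'"
      by (rule choice_parametrization[of ?W]) (use w(1) walk_W in auto)
    then interpret P: parametrized_map M ?W \<Phi>' .
    have P: "(F, j) \<in> P.sides ?e" "(F, k) \<in> P.sides ?e" using w F by (auto simp: P.sides_def)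
    have e: "?e \<in> edges M" using P.sides_edge[OF P(1)] .
    have two: "P.sides ?e = {(F, j), (F, k)}"
      using P.card_sides[OF e] P w(4) by (auto simp: card_2_iff)
    have "fst s = F" if "s \<in> sides ?e" for s
    proof (rule ccontr)
      assume "fst s \<noteq> F"
      then have "s \<in> P.sides ?e" using that by (auto simp: P.sides_def sides_def)
      then show False using two \<open>fst s \<noteq> F\<close> by auto
    qed
    moreover obtain s t where "sides ?e = {s, t}" "s \<noteq> t" using card_sides[OF e] by (auto simp: card_2_iff)
    ultimately show ?thesis using that[of s ?e t] True by auto
  next
    case False
    then obtain w w' j k where w: "boundary_walk M F w" "boundary_walk M G w'" "j < length w" "k < length w'"
        "snd (w ! j) = snd (w' ! k)"
      using assms by (auto simp: borders_def)
    have on_side: "\<exists>s\<in>sides (snd (u ! i)). fst s = H" if H: "H \<in> faces M" "boundary_walk M H u" "i < length u" for H u i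
    proof -
      obtain \<phi> \<psi> where "two_parametrizations M H u \<phi> (W H) \<psi>"
        by (rule walks_two_parametrizations[OF H(1,2) walk_W[OF H(1)] edges_nonempty])
      then interpret two_parametrizations M H u \<phi> "W H" \<psi> .
      obtain \<kappa> \<pi> where "\<And>k. k < length u \<Longrightarrow> \<kappa> k < len H \<and> \<pi> k < len H"
        "\<And>k. k < length u \<Longrightarrow> snd (W H ! \<pi> k) = snd (u ! k)"
        using walks_correspond by metis
      then have "(H, \<pi> i) \<in> sides (snd (u ! i))" using H by (auto simp: sides_def)
      then show ?thesis by force
    qed
    show ?thesis using on_side[OF F w(1,3)] on_side[OF G w(2,4)] w(5) False that by metis
  qed
  have idx: "\<exists>i. edg H (Suc i) = e \<and> Suc i mod len H = k" if "(H, k) \<in> sides e" for H k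
  proof (intro exI[of _ "k + len H - 1"] conjI)
    have H: "H \<in> faces M" "k < len H" "edg H k = e" using that by (auto simp: sides_iff)
    show "edg H (Suc (k + len H - 1)) = e" using pred_len(2)[OF H(1)] H(3) by simp
    show "Suc (k + len H - 1) mod len H = k" using H(2) len_pos[OF H(1)] by (simp only: Suc_pred_mod mod_less)
  qed
  obtain k l where kl: "s = (F, k)" "t = (G, l)" using st(4,5) by (metis prod.collapse)
  obtain i where i: "edg F (Suc i) = e" "Suc i mod len F = k" using idx st(1) kl(1) by blast
  obtain j where j: "edg G (Suc j) = e" "Suc j mod len G = l" using idx st(2) kl(2) by blast
  have "(F, i mod len F) \<noteq> (G, j mod len G)"
  proof
    assume "(F, i mod len F) = (G, j mod len G)"
    then have "F = G" "k = l" using i(2) j(2) Suc_mod_cancel[OF len_pos[OF F]] by auto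
    then show False using st(3) kl by simp
  qed
  then show ?thesis using that[of i j] F G i(1) j(1) by simp
qed

lemma bordersI:
  assumes F: "F \<in> faces M" and G: "G \<in> faces M" and eq: "edg F (Suc i) = edg G (Suc j)"
    and ne: "(F, i mod len F) \<noteq> (G, j mod len G)"
  shows "borders M F G"
proof -
  let ?k = "Suc i mod len F" and ?l = "Suc j mod len G"
  have k: "?k < len F" "?l < len G" "snd (W F ! ?k) = snd (W G ! ?l)"
    using len_pos F G eq by (auto simp: edg_def)
  show ?thesis
  proof (cases "F = G")
    case True
    then have "?k \<noteq> ?l" using ne Suc_mod_cancel[OF len_pos[OF F]] by auto
    then show ?thesis using True F k walk_W[OF F] unfolding borders_def by auto
  next
    case False
    then show ?thesis using F G k walk_W[OF F] walk_W[OF G] unfolding borders_def by auto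
  qed
qed

lemma all_straight:
  assumes st: "\<And>e. e \<in> edges M \<Longrightarrow> straight e"
  shows "\<exists>P Q. face_coloring M P Q \<and> (\<forall>F\<in>P. pattern_A M L F) \<and> (\<forall>F\<in>Q. pattern_E M L F)"
proof -
  have const: "inw F i = inw F 0" if F: "F \<in> faces M" for F i
    by (induction i) (use straight_iff[OF F] st[OF edg_in[OF F]] in auto)
  let ?P = "{F \<in> faces M. inw F 0}" and ?Q = "{F \<in> faces M. \<not> inw F 0}"
  have opp: "inw G 0 \<longleftrightarrow> \<not> inw F 0" if bd: "borders M F G" for F G
  proof -
    obtain i j where ij: "F \<in> faces M" "G \<in> faces M" "edg F (Suc i) = edg G (Suc j)" "(F, i mod len F) \<noteq> (G, j mod len G)"
      by (rule borders_sides[OF bd]) (rule that)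
    show ?thesis using opposite_side[OF ij] const[OF ij(1)] const[OF ij(2)] by metis
  qed
  have "face_coloring M ?P ?Q"
    unfolding face_coloring_def
  proof (intro conjI ballI allI impI)
    fix F G assume "F \<in> ?P" and bd: "borders M F G"
    moreover have "G \<in> faces M" using bd by (simp add: borders_def)
    ultimately show "G \<in> ?Q" using opp[OF bd] by blast
  next
    fix F G assume "F \<in> ?Q" and bd: "borders M F G"
    moreover have "G \<in> faces M" using bd by (simp add: borders_def)
    ultimately show "G \<in> ?P" using opp[OF bd] by blast
  qed auto
  moreover have "pattern_A M L F" if "F \<in> ?P" for F
    unfolding pattern_A_def using that walk_W[of F] plc_walk[of _ F] const[of F] by (auto simp: inw_def)
  moreover have "pattern_E M L F" if "F \<in> ?Q" for F
    unfolding pattern_E_def using that walk_W[of F] plc_walk[of _ F] const[of F] by (auto simp: inw_def)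
  ultimately show ?thesis by blast
qed

text \<open>The pattern refers to some walk of the face. Every place of \<open>W F\<close> is a
  proper corner and therefore occurs in that walk as well.\<close>

lemma pattern_E_iff:
  assumes F: "F \<in> faces M" shows "pattern_E M L F \<longleftrightarrow> (\<forall>i. \<not> inw F i)"
proof
  assume "pattern_E M L F"
  then obtain w where w: "boundary_walk M F w" "\<And>k. k < length w \<Longrightarrow> walk_corner w k \<notin> L"
    by (auto simp: pattern_E_def)
  show "\<forall>i. \<not> inw F i"
  proof (intro allI notI)
    fix i assume i: "inw F i"
    have m: "i mod len F < len F" using len_pos[OF F] by simp
    have "walk_corner (W F) (i mod len F) \<in> corners M" using plc_walk[OF m] plc_corner[OF F] by simp
    then obtain j where "j < length w" "walk_corner w j = walk_corner (W F) (i mod len F)"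
      using corner_transfer[OF F walk_W[OF F] w(1) edges_nonempty m] by metis
    then have "walk_corner w j \<in> L" using i plc_walk[OF m] by (simp add: inw_def)
    then show False using w(2) \<open>j < length w\<close> by blast
  qed
next
  assume "\<forall>i. \<not> inw F i"
  then show "pattern_E M L F" unfolding pattern_E_def
    using walk_W[OF F] plc_walk by (auto simp: inw_def)
qed

lemma pattern_C_in_place:
  assumes F: "F \<in> faces M" and "pattern_C M L F"
  obtains i where "inw F i"
proof -
  obtain w s where w: "boundary_walk M F w" "3 dvd length w"
    "\<And>k. k < length w \<Longrightarrow> walk_corner w k \<in> L \<longleftrightarrow> (k + s) mod 3 \<noteq> 0"
    using assms(2) by (auto simp: pattern_C_def)
  have "length w \<noteq> 0" using walk_nonempty[OF F w(1) edges_nonempty] by simp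
  then have "3 \<le> length w" using w(2) by (auto dest: dvd_imp_le)
  \<comment> \<open>One of the first two places has a phase that is nonzero modulo 3.\<close>
  define k :: nat where "k = (if s mod 3 = 0 then 1 else 0)"
  have "(k + s) mod 3 \<noteq> 0" unfolding k_def by (auto split: if_splits)
  moreover have k: "k < length w" using \<open>3 \<le> length w\<close> unfolding k_def by (split if_split) linarith
  ultimately have c: "walk_corner w k \<in> L" using w(3) by blast
  then obtain j where "j < len F" "walk_corner (W F) j = walk_corner w k"
    using corner_transfer[OF F w(1) walk_W[OF F] edges_nonempty k] L_in_corners by blast
  then have "inw F j" using c plc_walk by (simp add: inw_def)
  then show ?thesis by (rule that)
qed

end

subsection \<open>The mixed case\<close>

locale mixed_corneration = corneration_map M L
  for M :: "('v, 'e, 'a) drawing" and L +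
  assumes mixed: "\<And>F i. F \<in> faces M \<Longrightarrow> inw F i \<Longrightarrow> straight (edg F i) \<longleftrightarrow> \<not> straight (edg F (Suc i))"
begin

text \<open>Some symmetry takes an in-wedge at the first dart to one at the second. It preserves
  straightness, and the target wedge has only one edge of each kind, so \<open>e\<close> must go to
  \<open>e'\<close>.\<close>

lemma dart_transitive:
  assumes e: "e \<in> edges M" "v \<in> ends M e" and e': "e' \<in> edges M" "v' \<in> ends M e'"
    and eq: "straight e \<longleftrightarrow> straight e'"
  obtains \<alpha> \<beta> where "(\<alpha>, \<beta>) \<in> corner_symmetries M L" "\<alpha> v = v'" "\<beta> e = e'"
proof -
  obtain F i where F: "F \<in> faces M" "inw F i" "vtx F (Suc i) = v" "edg F i = e \<or> edg F (Suc i) = e"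
    by (rule in_place_at_dart[OF e])
  obtain G j where G: "G \<in> faces M" "inw G j" "vtx G (Suc j) = v'" "edg G j = e' \<or> edg G (Suc j) = e'"
    by (rule in_place_at_dart[OF e'])
  obtain \<alpha> \<beta> where \<sigma>: "(\<alpha>, \<beta>) \<in> corner_symmetries M L" "\<alpha> (vtx F (Suc i)) = vtx G (Suc j)"
    "{\<beta> (edg F i), \<beta> (edg F (Suc i))} = {edg G j, edg G (Suc j)}"
    by (rule symmetry_between_in_places[OF F(1,2) G(1,2)]) (rule that)
  have "\<beta> e = edg G j \<or> \<beta> e = edg G (Suc j)" using \<sigma>(3) F(4) by blast
  moreover have "straight (\<beta> e) \<longleftrightarrow> straight e'" using symmetry_straight_iff[OF \<sigma>(1) e(1)] eq by simp
  ultimately have "\<beta> e = e'" using G(4) mixed[OF G(1,2)] by auto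
  then show ?thesis using that \<sigma>(1,2) F(3) G(3) by simp
qed

lemma out_place_unique:
  assumes F: "F \<in> faces M" "\<not> inw F i" "e \<in> {edg F i, edg F (Suc i)}"
    and G: "G \<in> faces M" "\<not> inw G j" "e \<in> {edg G j, edg G (Suc j)}"
    and v: "vtx F (Suc i) = vtx G (Suc j)"
  shows "plc F i = plc G j"
proof -
  let ?v = "vtx F (Suc i)"
  have e: "e \<in> edges M" "?v \<in> ends M e"
    using F(3) edg_in[OF F(1)] ends_edg[OF F(1), of i] ends_edg[OF F(1), of "Suc i"] by auto
  obtain x y where xy: "places ?v e = {x, y}" "inw (fst x) (snd x)"
    by (rule dart_places[OF e])
  have "(F, i mod len F) \<in> places ?v e" "(G, j mod len G) \<in> places ?v e"
    using F G v len_pos by (auto simp: places_def)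
  moreover have "(F, i mod len F) \<noteq> x" "(G, j mod len G) \<noteq> x" using xy(2) F(2) G(2) by auto
  ultimately have "(F, i mod len F) = (G, j mod len G)" unfolding xy(1) by auto
  then show ?thesis by (metis mod_len(3) prod.inject)
qed

text \<open>A symmetry between the darts takes the out-place at the first to a place at the second.
  The image cannot be an in-place, since corners outside \<open>L\<close> stay outside, so it is the
  unique out-place there.\<close>

lemma out_place_map:
  assumes F: "F \<in> faces M" "\<not> inw F i" "e \<in> {edg F i, edg F (Suc i)}"
    and G: "G \<in> faces M" "\<not> inw G j" "e' \<in> {edg G j, edg G (Suc j)}"
    and eq: "straight e \<longleftrightarrow> straight e'"
  shows "status G j = status F i"
proof -
  have e: "e \<in> edges M" "vtx F (Suc i) \<in> ends M e"
    using F(3) edg_in[OF F(1)] ends_edg[OF F(1), of i] ends_edg[OF F(1), of "Suc i"] by auto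
  have e': "e' \<in> edges M" "vtx G (Suc j) \<in> ends M e'"
    using G(3) edg_in[OF G(1)] ends_edg[OF G(1), of j] ends_edg[OF G(1), of "Suc j"] by auto
  obtain \<alpha> \<beta> where \<sigma>: "(\<alpha>, \<beta>) \<in> corner_symmetries M L"
    and \<alpha>: "\<alpha> (vtx F (Suc i)) = vtx G (Suc j)" and \<beta>: "\<beta> e = e'"
    by (rule dart_transitive[OF e e' eq])
  obtain H m where H: "H \<in> faces M" "plc H m = corner_image (\<alpha>, \<beta>) (plc F i)"
    by (rule symmetry_place[OF \<sigma> F(1)])
  have Hv: "vtx H (Suc m) = vtx G (Suc j)" and He: "{edg H m, edg H (Suc m)} = {\<beta> (edg F i), \<beta> (edg F (Suc i))}"
    using H(2) \<alpha> by (simp_all add: plc_eq corner_image_def)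
  have "\<not> inw H m"
  proof
    assume "inw H m"
    then have "corner_image (\<alpha>, \<beta>) (plc F i) \<in> corner_image (\<alpha>, \<beta>) ` L"
      using H(2) corner_symmetryD(2)[OF \<sigma>] by (simp add: inw_def)
    then obtain c where c: "c \<in> L" "corner_image (\<alpha>, \<beta>) (plc F i) = corner_image (\<alpha>, \<beta>) c" by blast
    obtain K n where K: "K \<in> faces M" "plc K n = c" using L_place[OF c(1)] by metis
    have "plc F i = plc K n"
      using corner_image_inj[OF \<sigma>, of "vtx F (Suc i)" "edg F i" "edg F (Suc i)" "vtx K (Suc n)" "edg K n" "edg K (Suc n)"]
        plc_corner[OF F(1), of i] plc_corner[OF K(1), of n] c(2) K(2) unfolding plc_eq by simp
    then show False using c(1) K(2) F(2) by (simp add: inw_def)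
  qed
  moreover have "e' \<in> {edg H m, edg H (Suc m)}" unfolding He using F(3) \<beta> by auto
  ultimately have "plc H m = plc G j" using out_place_unique[OF H(1) _ _ G Hv] by blast
  then have "{edg G j, edg G (Suc j)} = {\<beta> (edg F i), \<beta> (edg F (Suc i))}" using He by (simp add: plc_eq)
  then have "status G j = straight ` {\<beta> (edg F i), \<beta> (edg F (Suc i))}" by (metis image_empty image_insert status_def)
  also have "\<dots> = status F i" using symmetry_straight_iff[OF \<sigma>] edg_in[OF F(1)] by (simp add: status_def)
  finally show ?thesis .
qed

text \<open>A mixed out-wedge has edges of both kinds, so every out-wedge shares a kind of edge with
  it and is mixed too. Straightness then alternates around each face, and two steps always change
  the kind of wedge exactly once.\<close>

lemma pattern_D_faces:
  assumes F: "F \<in> faces M" "\<not> inw F i" "straight (edg F i) \<longleftrightarrow> \<not> straight (edg F (Suc i))"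
    and G: "G \<in> faces M"
  shows "pattern_D M L G"
proof -
  have alt: "straight (edg G j) \<longleftrightarrow> \<not> straight (edg G (Suc j))" for j
  proof (cases "inw G j")
    case True
    then show ?thesis using mixed[OF G] by blast
  next
    case False
    obtain e where e: "e \<in> {edg F i, edg F (Suc i)}" "straight e \<longleftrightarrow> straight (edg G j)" using F(3) by blast
    have "status G j = status F i" by (rule out_place_map[OF F(1,2) e(1) G False _ e(2)]) simp
    moreover have "status F i = UNIV" using F(3) unfolding status_def by auto
    ultimately have "status G j = UNIV" by simp
    then show ?thesis unfolding status_def by (cases "straight (edg G j)"; cases "straight (edg G (Suc j))") auto
  qed
  have "4 dvd len G \<and> (\<exists>s. \<forall>k. inw G k \<longleftrightarrow> (k + s) mod 4 \<in> {0, 1})"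
  proof (rule period_four_sequence[of "inw G"])
    show "inw G (Suc (Suc j)) \<longleftrightarrow> \<not> inw G j" for j
      using straight_iff[OF G, of j] straight_iff[OF G, of "Suc j"] alt[of "Suc j"] by blast
  qed (rule inw_period)
  then show ?thesis unfolding pattern_D_def using walk_W[OF G] plc_walk unfolding inw_def by metis
qed

end

section \<open>No mixed out-wedge: patterns C and E\<close>

locale uniform_corneration = mixed_corneration M L
  for M :: "('v, 'e, 'a) drawing" and L +
  assumes uniform: "\<And>F i. F \<in> faces M \<Longrightarrow> \<not> inw F i \<Longrightarrow> straight (edg F i) \<longleftrightarrow> straight (edg F (Suc i))"
begin

text \<open>A straight edge leads from an out-place to another out-place, whose next edge is again
  straight by uniformity; this propagates around the whole face.\<close>

lemma out_straight_face:
  assumes F: "F \<in> faces M" "\<not> inw F i" "straight (edg F (Suc i))"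
  shows "\<not> inw F j"
proof -
  have "\<not> inw F (i + n) \<and> straight (edg F (Suc (i + n)))" for n
  proof (induction n)
    case (Suc n)
    then have "\<not> inw F (Suc (i + n))" using straight_iff[OF F(1), of "i + n"] by blast
    then show ?case using uniform[OF F(1), of "Suc (i + n)"] Suc by simp
  qed (use F in auto)
  moreover have "inw F (j + len F * i) = inw F j" by (metis mod_len(4) mod_mult_self2)
  \<comment> \<open>Propagation only runs forward, so \<open>j\<close> is first moved past
    \<open>i\<close> by a multiple of the length.\<close>
  moreover have "1 * i \<le> len F * i" using len_pos[OF F(1)] by (intro mult_le_mono1) (simp add: Suc_le_eq)
  then have "i \<le> j + len F * i" by (simp only: mult_1 trans_le_add2)
  ultimately show ?thesis by (metis le_add_diff_inverse)
qed

lemma pattern_C_face: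
  assumes F: "F \<in> faces M" "inw F i0" shows "pattern_C M L F"
proof -
  \<comment> \<open>In a face with an in-wedge no out-wedge is followed by a straight edge. After an
    out-place the edges are therefore non-straight, straight and non-straight, which gives two
    in-places and then an out-place.\<close>
  have step: "inw F (Suc i) \<and> inw F (Suc (Suc i)) \<and> \<not> inw F (Suc (Suc (Suc i)))" if "\<not> inw F i" for i
  proof -
    have ns: "\<not> straight (edg F (Suc i))" using out_straight_face[OF F(1) that] F(2) by blast
    then have 1: "inw F (Suc i)" using straight_iff[OF F(1), of i] that by blast
    then have s: "straight (edg F (Suc (Suc i)))" using mixed[OF F(1)] ns by blast
    then have 2: "inw F (Suc (Suc i))" using straight_iff[OF F(1), of "Suc i"] 1 by blast
    then have "\<not> straight (edg F (Suc (Suc (Suc i))))" using mixed[OF F(1)] s by blast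
    then show ?thesis using straight_iff[OF F(1), of "Suc (Suc i)"] 1 2 by blast
  qed
  have "\<exists>i. \<not> inw F i"
  proof (rule ccontr)
    assume "\<nexists>i. \<not> inw F i"
    then show False
      using mixed[OF F(1), of "Suc 0"] straight_iff[OF F(1), of 0] straight_iff[OF F(1), of "Suc 0"] by blast
  qed
  then obtain i where i: "\<not> inw F i" by blast
  have "3 dvd len F \<and> (\<exists>s. \<forall>k. inw F k \<longleftrightarrow> (k + s) mod 3 \<noteq> 0)"
    by (rule period_three_sequence[of "inw F", OF step inw_period len_pos[OF F(1)] i])
  then show ?thesis unfolding pattern_C_def using walk_W[OF F(1)] plc_walk unfolding inw_def by metis
qed

lemma pattern_C_iff: "F \<in> faces M \<Longrightarrow> pattern_C M L F \<longleftrightarrow> (\<exists>i. inw F i)"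
  using pattern_C_face pattern_C_in_place by metis

text \<open>Across a straight edge, two in-places face two out-places, whose face consists of
  out-places only. Across any other edge there is an in-place again.\<close>

lemma border_of_edge:
  assumes F: "F \<in> faces M" and i: "inw F i"
  shows "straight (edg F (Suc j)) \<Longrightarrow> inw F j \<Longrightarrow> \<exists>G. borders M F G \<and> pattern_E M L G"
    "\<not> straight (edg F (Suc j)) \<Longrightarrow> \<exists>G. borders M F G \<and> pattern_C M L G"
proof -
  obtain G k where G: "G \<in> faces M" "edg F (Suc j) = edg G (Suc k)" "(F, j mod len F) \<noteq> (G, k mod len G)"
    by (rule obtain_opposite_side[OF F])
  have bd: "borders M F G" by (rule bordersI[OF F G])
  note opp = opposite_side[OF F G]
  show "\<exists>G. borders M F G \<and> pattern_E M L G" if s: "straight (edg F (Suc j))" and "inw F j"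
  proof -
    have "\<not> inw G k" using opp that straight_iff[OF F, of j] by blast
    then have "\<forall>l. \<not> inw G l" using out_straight_face[OF G(1), of k] s G(2) by simp
    then show ?thesis using bd pattern_E_iff[OF G(1)] by blast
  qed
  show "\<exists>G. borders M F G \<and> pattern_C M L G" if "\<not> straight (edg F (Suc j))"
  proof -
    have "inw G k \<or> inw G (Suc k)" using opp that straight_iff[OF F, of j] by blast
    then show ?thesis using bd pattern_C_iff[OF G(1)] by blast
  qed
qed

lemma pattern_C_borders:
  assumes F: "F \<in> faces M" and "pattern_C M L F"
  shows "(\<exists>G. borders M F G \<and> pattern_C M L G) \<and> (\<exists>G. borders M F G \<and> pattern_E M L G)"
proof -
  obtain i where i: "inw F i" using pattern_C_iff[OF F] assms(2) by blast
  \<comment> \<open>The cyclic predecessor of \<open>i\<close>: it brings the edge before place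
    \<open>i\<close> into the form \<open>edg F (Suc ?i)\<close> used by
    \<open>straight_iff\<close>. The two edges of the in-wedge at \<open>i\<close> are of different
    kinds and provide the two borders.\<close>
  let ?i = "i + len F - 1"
  have S: "edg F (Suc ?i) = edg F i" using pred_len(2)[OF F] .
  have Si: "inw F (Suc ?i)" using i len_pos[OF F] inw_period[of F i] by simp
  note st = straight_iff[OF F, of ?i] straight_iff[OF F, of i]
  show ?thesis
  proof (cases "straight (edg F i)")
    case True
    then have "\<not> straight (edg F (Suc i))" using mixed[OF F i] by blast
    moreover have "inw F ?i" using True st(1) Si unfolding S by blast
    ultimately show ?thesis using border_of_edge(1)[OF F i, of ?i] border_of_edge(2)[OF F i, of i] True unfolding S by blast
  next
    case False
    then have "straight (edg F (Suc i))" using mixed[OF F i] by blast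
    then show ?thesis using border_of_edge(1)[OF F i, of i] border_of_edge(2)[OF F i, of ?i] False i unfolding S by blast
  qed
qed

lemma pattern_E_borders:
  assumes F: "F \<in> faces M" and "pattern_E M L F" and "borders M F G"
  shows "pattern_C M L G"
proof -
  obtain i j where ij: "F \<in> faces M" "G \<in> faces M" "edg F (Suc i) = edg G (Suc j)" "(F, i mod len F) \<noteq> (G, j mod len G)"
    by (rule borders_sides[OF assms(3)]) (rule that)
  have "\<not> inw F i" "\<not> inw F (Suc i)" using pattern_E_iff[OF F] assms(2) by auto
  then have "inw G j" using opposite_side[OF ij] by blast
  then show ?thesis using pattern_C_iff[OF ij(2)] by blast
qed

lemma patterns_C_E:
  "(\<forall>F\<in>faces M. pattern_C M L F \<or> pattern_E M L F) \<and>
   (\<exists>F\<in>faces M. pattern_C M L F) \<and> (\<exists>F\<in>faces M. pattern_E M L F) \<and>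
   (\<forall>F\<in>faces M. pattern_E M L F \<longrightarrow> (\<forall>G. borders M F G \<longrightarrow> pattern_C M L G)) \<and>
   (\<forall>F\<in>faces M. pattern_C M L F \<longrightarrow>
      (\<exists>G. borders M F G \<and> pattern_C M L G) \<and> (\<exists>G. borders M F G \<and> pattern_E M L G))"
proof -
  obtain e where e: "e \<in> edges M" using edges_nonempty by blast
  obtain v where v: "v \<in> ends M e" by (rule ends_nonempty[OF e])
  obtain F i where F: "F \<in> faces M" "inw F i" by (rule in_place_at_dart[OF e v])
  then have C: "pattern_C M L F" using pattern_C_iff by blast
  then obtain G where "borders M F G" "pattern_E M L G" using pattern_C_borders[OF F(1)] by blast
  then have "\<exists>F\<in>faces M. pattern_E M L F" by (auto simp: borders_def)
  moreover have "pattern_C M L F \<or> pattern_E M L F" if "F \<in> faces M" for F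
    using pattern_C_iff[OF that] pattern_E_iff[OF that] by blast
  ultimately show ?thesis using F(1) C pattern_C_borders pattern_E_borders by blast
qed

end

theorem theorem7p1:
  fixes M :: "('v, 'e, 'a) drawing" and L :: "('v, 'e) corner set"
  assumes "is_map M"
    and "wedges_unambiguous M"
    and "corneration M L"
    and "transitive M L"
    and "L \<subseteq> wedges M"
  shows
    "(\<exists>P Q. face_coloring M P Q \<and> (\<forall>F\<in>P. pattern_A M L F) \<and> (\<forall>F\<in>Q. pattern_E M L F)) \<or>
     (\<forall>F\<in>faces M. pattern_B M L F) \<or>
     ((\<forall>F\<in>faces M. pattern_C M L F \<or> pattern_E M L F) \<and>
      (\<exists>F\<in>faces M. pattern_C M L F) \<and> (\<exists>F\<in>faces M. pattern_E M L F) \<and>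
      (\<forall>F\<in>faces M. pattern_E M L F \<longrightarrow> (\<forall>G. borders M F G \<longrightarrow> pattern_C M L G)) \<and>
      (\<forall>F\<in>faces M. pattern_C M L F \<longrightarrow>
         (\<exists>G. borders M F G \<and> pattern_C M L G) \<and> (\<exists>G. borders M F G \<and> pattern_E M L G))) \<or>
     (\<forall>F\<in>faces M. pattern_D M L F)"
    (is "?A \<or> ?B \<or> ?C \<or> ?D")
proof (cases "edges M = {}")
  case True
  \<comment> \<open>Without edges every walk is empty, and pattern B holds vacuously with length
    0.\<close>
  have "pattern_B M L F" if F: "F \<in> faces M" for F
  proof -
    obtain w where w: "boundary_walk M F w" using assms(1) F unfolding is_map_def by blast
    have "w = []"
    proof (rule ccontr)
      assume "w \<noteq> []"
      then have "0 < length w" by simp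
      then show False using w True \<open>w \<noteq> []\<close> unfolding boundary_walk_def by (fastforce split: prod.splits)
    qed
    then show ?thesis using w by (auto simp: pattern_B_def)
  qed
  then show ?thesis by blast
next
  case False
  interpret corneration_map M L by unfold_locales (use assms False in auto)
  obtain e where e: "e \<in> edges M" using False by blast
  obtain v where v: "v \<in> ends M e" by (rule ends_nonempty[OF e])
  obtain F i where F: "F \<in> faces M" "inw F i" by (rule in_place_at_dart[OF e v])
  \<comment> \<open>The in-wedge at \<open>F\<close>, \<open>i\<close> serves as reference: every
    edge lies on some in-wedge, and all in-wedges have the same status.\<close>
  have at_edge: "straight e' \<in> status F i" if e': "e' \<in> edges M" for e'
  proof -
    obtain v' where v': "v' \<in> ends M e'" by (rule ends_nonempty[OF e'])
    obtain G j where G: "G \<in> faces M" "inw G j" "edg G j = e' \<or> edg G (Suc j) = e'"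
      by (rule in_place_at_dart[OF e' v'])
    have "straight e' \<in> status G j" using G(3) by (auto simp: status_def)
    then show ?thesis using status_constant[OF F G(1,2)] by simp
  qed
  consider "status F i = {True}" | "status F i = {False}" | "status F i = {True, False}"
    unfolding status_def by (cases "straight (edg F i)"; cases "straight (edg F (Suc i))") auto
  then show ?thesis
  proof cases
    case 1
    then have ?A using at_edge by (intro all_straight) auto
    then show ?thesis by blast
  next
    case 2
    then have "\<not> straight e'" if "e' \<in> edges M" for e' using at_edge[OF that] by auto
    then have ?B using pattern_B_face edg_in by blast
    then show ?thesis by blast
  next
    case 3
    have "straight (edg G j) \<longleftrightarrow> \<not> straight (edg G (Suc j))" if "G \<in> faces M" "inw G j" for G j
      using status_constant[OF F that] 3 unfolding status_def
      by (cases "straight (edg G j)"; cases "straight (edg G (Suc j))") auto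
    then interpret mixed_corneration M L by unfold_locales
    show ?thesis
    proof (cases "\<exists>G\<in>faces M. \<exists>j. \<not> inw G j \<and> (straight (edg G j) \<longleftrightarrow> \<not> straight (edg G (Suc j)))")
      case True
      then have ?D using pattern_D_faces by blast
      then show ?thesis by blast
    next
      case False
      then interpret uniform_corneration M L by unfold_locales blast
      show ?thesis using patterns_C_E by blast
    qed
  qed
qed

end
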